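(* Let $\boldsymbol{M}$ be a weight sequence such that $\widetilde{\boldsymbol{M}}$ is a weight sequence and $(p!)_p\subset\widetilde{\boldsymbol{M}}$, and let $\boldsymbol{A}$ be a sequence satisfying $\operatorname{(nq)}$ and such that $\widehat{\boldsymbol{A}}$ is a weight sequence. Then the following are equivalent: (i) $\displaystyle\sum_{p=0}^\infty\frac{1}{\widetilde{m}_p^{1/2}}=\infty$, where $\widetilde m_p=\widetilde M_{p+1}/\widetilde M_p$. (ii) $\mathcal{B}\colon\mathcal{A}_{\{\widetilde{\boldsymbol{M}}\}}(\mathbb{H})\to\Lambda_{\{\widetilde{\boldsymbol{M}}\}}$ is injective. (iii) $\mathcal{M}\colon C_{\{\boldsymbol{M}\}}(0,\infty)\to\Lambda_{\{\widetilde{\boldsymbol{M}}\}}$ is injective. (iv) $\mathcal{M}\colon\mathcal{S}_{\{\boldsymbol{M}\}}(0,\infty)\to\Lambda_{\{\widetilde{\boldsymbol{M}}\}}$ is injective. (v) $\mathcal{M}\colon\mathcal{S}^{\{\widehat{\boldsymbol{A}}\}}_{\{\boldsymbol{M}\}}(0,\infty)\to\Lambda_{\{\widetilde{\boldsymbol{M}}\}}$ is injective.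
   Context: Sequences are of positive reals indexed by $\mathbb{N}_0$; quotients $m_p=M_{p+1}/M_p$. A sequence is a weight sequence if it is log-convex ($M_p^2\le M_{p-1}M_{p+1}$, $p\ge1$) and its quotients tend to $\infty$. For a weight sequence $\boldsymbol{M}$ with $M_0=1$, $\widetilde{\boldsymbol{M}}=(\widetilde M_p)_p$ with $\widetilde M_p=M_{p+1}\log(e^2m_{p+1}/m_p)$. $\operatorname{(nq)}$ for $\boldsymbol{A}$: $\sum_p1/((p+1)a_p)<\infty$, $a_p=A_{p+1}/A_p$. $\widehat{\boldsymbol{A}}=(p!A_p)_p$. $(p!)_p\subset\boldsymbol{N}$ means $p!\le Ch^pN_p$ for all $p$ and some $C,h>0$. $\mathbb{H}$ = open upper half-plane. For a sequence $\boldsymbol{N}$, $\mathcal{A}_{\{\boldsymbol{N}\}}(\mathbb{H})$ is the space of holomorphic $f$ on $\mathbb{H}$ with $\sup_p\sup_{z\in\mathbb{H}}|f^{(p)}(z)|/(h^pN_p)<\infty$ for some $h>0$; such $f$ and its derivatives extend continuously to $\overline{\mathbb{H}}$ and $f^{(p)}(0)$ is the value of the extension at $0$. $\Lambda_{\{\boldsymbol{N}\}}$ is the space of complex sequences with $\sup_p|c_p|/(h^pN_p)<\infty$ for some $h>0$. $\mathcal{B}(f)=(f^{(p)}(0))_p$. $C_{\{\boldsymbol{M}\}}(0,\infty)$: continuous $\varphi$ on $(0,\infty)$ with $\sup_p\sup_{x>0}x^p|\varphi(x)|/(h^pM_p)<\infty$ for some $h>0$. $\mathcal{S}_{\{\boldsymbol{M}\}}(0,\infty)$: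 $\varphi\in C^\infty(\mathbb{R})$ supported in $[0,\infty)$ such that for some $h>0$, $\sup_p\sup_x|x^p\varphi^{(q)}(x)|/(h^pM_p)<\infty$ for every $q$. $\mathcal{S}^{\{\widehat{\boldsymbol{A}}\}}_{\{\boldsymbol{M}\}}(0,\infty)$: $\varphi\in C^\infty(\mathbb{R})$ supported in $[0,\infty)$ with $\sup_{p,q}\sup_x|x^p\varphi^{(q)}(x)|/(h^{p+q}M_pq!A_q)<\infty$ for some $h>0$. $\mathcal{M}(\varphi)=(\int_0^\infty x^p\varphi(x)\,dx)_p$, which maps $C_{\{\boldsymbol{M}\}}(0,\infty)$ into $\Lambda_{\{\widetilde{\boldsymbol{M}}\}}$. *)

theory Defs
  imports "HOL-Complex_Analysis.Complex_Analysis"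
begin

definition quot :: "(nat \<Rightarrow> real) \<Rightarrow> nat \<Rightarrow> real" where
  "quot M p = M (Suc p) / M p"

definition weight_seq :: "(nat \<Rightarrow> real) \<Rightarrow> bool" where
  "weight_seq M \<longleftrightarrow> (\<forall>p. M p > 0)
     \<and> (\<forall>p\<ge>1. (M p)^2 \<le> M (p - 1) * M (p + 1))
     \<and> filterlim (quot M) at_top sequentially"

text \<open>\<open>M tilde\<close>: \<open>Mt p = M (p+1) * log (e^2 m_{p+1} / m_p)\<close> (for \<open>M 0 = 1\<close>).\<close>
definition Mtilde :: "(nat \<Rightarrow> real) \<Rightarrow> nat \<Rightarrow> real" where
  "Mtilde M p = M (p + 1) * ln (exp 2 * quot M (p + 1) / quot M p)"

definition nq :: "(nat \<Rightarrow> real) \<Rightarrow> bool" where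
  "nq A \<longleftrightarrow> summable (\<lambda>p. 1 / ((real p + 1) * quot A p))"

definition Ahat :: "(nat \<Rightarrow> real) \<Rightarrow> nat \<Rightarrow> real" where
  "Ahat A p = fact p * A p"

definition fact_incl :: "(nat \<Rightarrow> real) \<Rightarrow> bool" where
  "fact_incl N \<longleftrightarrow> (\<exists>C>0. \<exists>h>0. \<forall>p. fact p \<le> C * h^p * N p)"

definition upper_half :: "complex set" where
  "upper_half = {z. Im z > 0}"

definition AH :: "(nat \<Rightarrow> real) \<Rightarrow> (complex \<Rightarrow> complex) set" where
  "AH N = {f. f holomorphic_on upper_half \<and>
     (\<exists>h>0. \<exists>B. \<forall>p. \<forall>z\<in>upper_half. norm ((deriv ^^ p) f z) \<le> B * h^p * N p)}"

text \<open>Borel map: value at 0 of the continuous extension of \<open>f^(p)\<close> to the closed half-plane.\<close>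
definition Borel_map :: "(complex \<Rightarrow> complex) \<Rightarrow> nat \<Rightarrow> complex" where
  "Borel_map f p = Lim (at 0 within upper_half) ((deriv ^^ p) f)"

definition CM :: "(nat \<Rightarrow> real) \<Rightarrow> (real \<Rightarrow> complex) set" where
  "CM M = {\<phi>. continuous_on {0<..} \<phi> \<and>
     (\<exists>h>0. \<exists>B. \<forall>p. \<forall>x>0. x^p * norm (\<phi> x) \<le> B * h^p * M p)}"

definition deriv_seq :: "(nat \<Rightarrow> real \<Rightarrow> complex) \<Rightarrow> bool" where
  "deriv_seq D \<longleftrightarrow> (\<forall>q x. (D q has_vector_derivative D (Suc q) x) (at x))"

definition SM :: "(nat \<Rightarrow> real) \<Rightarrow> (real \<Rightarrow> complex) set" where
  "SM M = {\<phi>. \<exists>D. deriv_seq D \<and> D 0 = \<phi> \<and> (\<forall>x<0. \<phi> x = 0) \<and>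
     (\<exists>h>0. \<forall>q. \<exists>B. \<forall>p x. \<bar>x\<bar>^p * norm (D q x) \<le> B * h^p * M p)}"

definition SMA :: "(nat \<Rightarrow> real) \<Rightarrow> (nat \<Rightarrow> real) \<Rightarrow> (real \<Rightarrow> complex) set" where
  "SMA M A = {\<phi>. \<exists>D. deriv_seq D \<and> D 0 = \<phi> \<and> (\<forall>x<0. \<phi> x = 0) \<and>
     (\<exists>h>0. \<exists>B. \<forall>p q x. \<bar>x\<bar>^p * norm (D q x) \<le> B * h^(p+q) * M p * Ahat A q)}"

definition moments :: "(real \<Rightarrow> complex) \<Rightarrow> nat \<Rightarrow> complex" where
  "moments \<phi> p = integral {0<..} (\<lambda>x. (x^p) *\<^sub>R \<phi> x)"

end

theory Submission
  imports Defs
begin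

text \<open>
  The implications are proved in a cycle; (iii) to (iv) to (v) are inclusions of function spaces.

  (i) to (ii): if \<open>f\<close> is flat at \<open>0\<close>, the transform \<open>J z = \<integral>\<^sub>0\<^sup>\<infinity> f (\<i> u / z) exp (- u z) du\<close> is holomorphic on
  the right half plane, and \<open>p\<close> integrations by parts turn the bounds on \<open>f\<^sup>(\<^sup>p\<^sup>)\<close> into
  \<open>\<bar>J z\<bar> \<le> C h\<^sup>p N\<^sub>p / (\<bar>z\<bar>\<^sup>2\<^sup>p Re z)\<close>. Multiplying \<open>J\<close> by \<open>\<Prod>\<^sub>j (1 + z / r\<^sub>j + z\<^sup>2 / r\<^sub>j\<^sup>2)\<close> with \<open>r\<^sub>j\<^sup>2 = h n\<^sub>j\<close>,
  whose factors are at most \<open>max 1 (\<bar>z\<bar>\<^sup>2 / r\<^sub>j\<^sup>2)\<close> on the imaginary axis and at least \<open>1 + x / r\<^sub>j\<close> at \<open>x > 0\<close>,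
  the maximum principle forces \<open>J = 0\<close> when \<open>\<Sum> 1 / r\<^sub>j\<close> diverges. Uniqueness for the Laplace transform
  then gives \<open>f = 0\<close>.

  (ii) to (iii): the Fourier-Laplace transform of \<open>\<phi>\<close> lies in \<open>AH (Mtilde M)\<close> and has derivatives
  \<open>\<i>\<^sup>p \<mu>\<^sub>p\<close> at \<open>0\<close>, where \<open>\<mu>\<^sub>p\<close> are the moments of \<open>\<phi>\<close>.

  (v) to (i): if the series converges, then so does \<open>\<Sum> m\<^sub>p\<^sup>-\<^sup>1\<^sup>/\<^sup>2\<close> by Carleman's inequality. A product
  \<open>K\<close> of factors \<open>((exp (\<i> c\<^sub>j z) - 1) / (\<i> c\<^sub>j z))\<^sup>2\<close> with \<open>c\<^sub>j = m\<^sub>j\<^sup>-\<^sup>1\<^sup>/\<^sup>2\<close> decays so fast in the upper half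
  plane that \<open>\<integral> t\<^sup>j K t dt = 0\<close> for all \<open>j\<close>; the Fourier transform of the analogous product for
  \<open>c\<^sub>j = A\<^sub>j / ((j + 1) A\<^sub>j\<^sub>+\<^sub>1)\<close> is a compactly supported test function \<open>\<psi>\<close>. Then
  \<open>\<Phi> x = \<integral> K t \<psi> (x - t\<^sup>2) dt\<close> is a nonzero element of \<open>SMA M A\<close> without moments.
\<close>

section \<open>Integrals depending on a parameter and the Laplace transform\<close>

text \<open>Along any sequence tending to \<open>x0\<close> the normalised remainders tend to 0
  pointwise and are bounded by \<open>2 * g\<close>, so dominated convergence applies. A derivative
  within a set is general enough to yield both the real and the complex version below.\<close>

lemma has_derivative_lebesgue_integral:
  fixes F :: "'a::real_normed_vector \<Rightarrow> 'x \<Rightarrow> 'b::{banach,second_countable_topology}"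
  assumes x0: "x0 \<in> S"
    and int: "\<And>y. y \<in> S \<Longrightarrow> integrable M (F y)"
    and g: "integrable M g"
    and der: "\<And>x. x \<in> space M \<Longrightarrow> ((\<lambda>y. F y x) has_derivative L x) (at x0 within S)"
    and lip: "\<And>x y. x \<in> space M \<Longrightarrow> y \<in> S \<Longrightarrow> norm (F y x - F x0 x) \<le> g x * norm (y - x0)"
    and Lm: "\<And>v. (\<lambda>x. L x v) \<in> borel_measurable M"
    and Lb: "\<And>x v. x \<in> space M \<Longrightarrow> norm (L x v) \<le> g x * norm v"
  shows "((\<lambda>y. \<integral>x. F y x \<partial>M) has_derivative (\<lambda>v. \<integral>x. L x v \<partial>M)) (at x0 within S)"
proof -
  have intL: "integrable M (\<lambda>x. L x v)" for v
    by (rule Bochner_Integration.integrable_bound[OF integrable_mult_left[OF g, of "norm v"] Lm])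
      (auto intro!: AE_I2 order_trans[OF Lb])
  have lin: "linear (L x)" if "x \<in> space M" for x
    using der[OF that] has_derivative_linear by blast
  have bl: "bounded_linear (\<lambda>v. \<integral>x. L x v \<partial>M)"
  proof (rule bounded_linear_intro[where K="\<integral>x. g x \<partial>M"])
    show "(\<integral>x. L x (u + v) \<partial>M) = (\<integral>x. L x u \<partial>M) + (\<integral>x. L x v \<partial>M)" for u v
      by (subst Bochner_Integration.integral_add[OF intL intL, symmetric])
        (auto intro!: Bochner_Integration.integral_cong simp: linear_add[OF lin])
    show "(\<integral>x. L x (r *\<^sub>R v) \<partial>M) = r *\<^sub>R (\<integral>x. L x v \<partial>M)" for r v
      by (simp add: linear_scale[OF lin] flip: Bochner_Integration.integral_scaleR_right
            cong: Bochner_Integration.integral_cong)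
    show "norm (\<integral>x. L x v \<partial>M) \<le> norm v * (\<integral>x. g x \<partial>M)" for v
    proof -
      have "norm (\<integral>x. L x v \<partial>M) \<le> (\<integral>x. norm (L x v) \<partial>M)" by simp
      also have "\<dots> \<le> (\<integral>x. g x * norm v \<partial>M)"
        by (intro integral_mono integrable_norm intL integrable_mult_left g Lb)
      also have "\<dots> = norm v * (\<integral>x. g x \<partial>M)" using g by (simp add: mult.commute)
      finally show ?thesis .
    qed
  qed
  have "((\<lambda>y. norm (((\<integral>x. F y x \<partial>M) - (\<integral>x. F x0 x \<partial>M) - (\<integral>x. L x (y - x0) \<partial>M)) /\<^sub>R norm (y - x0))) \<longlongrightarrow> 0)
         (at x0 within S)"
    unfolding tendsto_at_iff_sequentially
  proof (intro allI impI)
    fix X :: "nat \<Rightarrow> 'a" assume XS: "\<forall>i. X i \<in> S - {x0}" and Xl: "X \<longlonglongrightarrow> x0"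
    let ?s = "\<lambda>i x. (F (X i) x - F x0 x - L x (X i - x0)) /\<^sub>R norm (X i - x0)"
    have lim: "(\<lambda>i. \<integral>x. ?s i x \<partial>M) \<longlonglongrightarrow> (\<integral>x. 0 \<partial>M)"
    proof (rule integral_dominated_convergence[where w="\<lambda>x. 2 * g x"])
      show "?s i \<in> borel_measurable M" for i
        using int[of "X i"] int[OF x0] XS Lm[of "X i - x0"] by auto
      show "AE x in M. norm (?s i x) \<le> 2 * g x" for i
      proof (rule AE_I2)
        fix x assume x: "x \<in> space M"
        have p: "norm (X i - x0) > 0" using XS by auto
        have "norm (F (X i) x - F x0 x - L x (X i - x0)) \<le> g x * norm (X i - x0) + g x * norm (X i - x0)"
          using lip[OF x, of "X i"] Lb[OF x, of "X i - x0"] XS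
          by (meson Diff_iff add_mono norm_triangle_le_diff)
        then show "norm (?s i x) \<le> 2 * g x"
          unfolding norm_scaleR using p by (simp add: divide_inverse[symmetric] mult.commute[of "inverse _"] pos_divide_le_eq)
      qed
      show "AE x in M. (\<lambda>i. ?s i x) \<longlonglongrightarrow> 0"
      proof (rule AE_I2)
        fix x assume x: "x \<in> space M"
        have "((\<lambda>y. (F y x - F x0 x - L x (y - x0)) /\<^sub>R norm (y - x0)) \<longlongrightarrow> 0) (at x0 within S)"
          using der[OF x] by (simp add: has_derivative_within inverse_eq_divide diff_diff_eq)
        then show "(\<lambda>i. ?s i x) \<longlonglongrightarrow> 0"
          using XS Xl unfolding tendsto_at_iff_sequentially o_def by blast
      qed
    qed (use g in auto)
    have eq: "(\<integral>x. ?s i x \<partial>M) = ((\<integral>x. F (X i) x \<partial>M) - (\<integral>x. F x0 x \<partial>M) - (\<integral>x. L x (X i - x0) \<partial>M)) /\<^sub>R norm (X i - x0)" for i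
      using int[of "X i"] int[OF x0] intL XS by simp
    show "((\<lambda>y. norm (((\<integral>x. F y x \<partial>M) - (\<integral>x. F x0 x \<partial>M) - (\<integral>x. L x (y - x0) \<partial>M)) /\<^sub>R norm (y - x0))) \<circ> X) \<longlonglongrightarrow> 0"
      using tendsto_norm[OF lim] unfolding eq o_def by simp
  qed
  then show ?thesis
    using bl unfolding tendsto_norm_zero_iff by (simp add: has_derivative_within inverse_eq_divide diff_diff_eq)
qed

lemma integral_pos_isCont:
  fixes f :: "real \<Rightarrow> real"
  assumes f: "integrable lborel f" and nn: "\<And>x. f x \<ge> 0" and c: "isCont f a" and a: "f a > 0"
  shows "(\<integral>x. f x \<partial>lborel) > 0"
proof -
  have "(\<integral>x. f x \<partial>lborel) \<noteq> 0"
  proof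
    assume "(\<integral>x. f x \<partial>lborel) = 0"
    then have ae: "AE x in lborel. f x = 0"
      using f nn integral_nonneg_eq_0_iff_AE[OF f] by auto
    have "eventually (\<lambda>x. f x > 0) (at a)"
      using c a unfolding isCont_def by (rule order_tendstoD)
    then obtain d where d: "d > 0" "\<And>x. x \<noteq> a \<Longrightarrow> dist x a < d \<Longrightarrow> f x > 0"
      unfolding eventually_at by auto
    have "AE x in lborel. x \<notin> {a<..<a+d}"
      using ae by eventually_elim (use d(2) in \<open>force simp: dist_real_def\<close>)
    then have "emeasure lborel {a<..<a+d} = 0"
      using AE_iff_measurable[of "{a<..<a+d}" lborel "\<lambda>x. x \<notin> {a<..<a+d}"]
      by (simp add: greaterThanLessThan_def greaterThan_def lessThan_def Collect_conj_eq[symmetric])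
    then show False using d by simp
  qed
  moreover have "(\<integral>x. f x \<partial>lborel) \<ge> 0" using nn by simp
  ultimately show ?thesis by simp
qed

text \<open>The antiderivative is arctan, and the negative half line follows by reflection. Several
  later integrability claims on the whole line are reduced to this majorant.\<close>

lemma integrable_inverse_1_plus_square:
  "integrable lborel (\<lambda>x::real. 1 / (1 + x^2))"
proof -
  have "(\<integral>\<^sup>+x. ennreal (1 / (1 + x^2)) \<partial>lborel) < \<infinity>"
  proof -
    have h: "(\<integral>\<^sup>+x. ennreal (1 / (1 + x^2)) * indicator {0..} x \<partial>lborel) = ennreal (pi/2 - arctan 0)"
      by (rule nn_integral_FTC_atLeast)
        (auto intro!: derivative_eq_intros tendsto_arctan_at_top simp: power2_eq_square field_simps)
    have h2: "(\<integral>\<^sup>+x. ennreal (1 / (1 + x^2)) * indicator {..0} x \<partial>lborel) = ennreal (pi/2 - arctan 0)"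
      unfolding h[symmetric]
      by (subst nn_integral_real_affine[where c="-1" and t=0])
         (auto intro!: nn_integral_cong split: split_indicator)
    have "(\<integral>\<^sup>+x. ennreal (1 / (1 + x^2)) \<partial>lborel) \<le>
      (\<integral>\<^sup>+x. ennreal (1 / (1 + x^2)) * indicator {0..} x + ennreal (1 / (1 + x^2)) * indicator {..0} x \<partial>lborel)"
      by (rule nn_integral_mono) (auto split: split_indicator)
    also have "\<dots> = ennreal (pi/2 - arctan 0) + ennreal (pi/2 - arctan 0)"
      by (subst nn_integral_add) (auto simp only: h h2, auto)
    also have "\<dots> < \<infinity>" by (simp add: ennreal_plus[symmetric] del: ennreal_plus)
    finally show ?thesis .
  qed
  then show ?thesis
    by (intro integrableI_bounded) (auto simp: real_norm_def abs_of_nonneg)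
qed

lemma has_vector_derivative_lebesgue_integral:
  fixes F F' :: "real \<Rightarrow> 'x \<Rightarrow> 'b::{banach,second_countable_topology}"
  assumes int: "\<And>y. integrable M (F y)" and g: "integrable M g"
    and der: "\<And>x y. x \<in> space M \<Longrightarrow> ((\<lambda>y. F y x) has_vector_derivative F' y x) (at y)"
    and bound: "\<And>x y. x \<in> space M \<Longrightarrow> norm (F' y x) \<le> g x"
    and meas: "F' y0 \<in> borel_measurable M"
  shows "((\<lambda>y. \<integral>x. F y x \<partial>M) has_vector_derivative (\<integral>x. F' y0 x \<partial>M)) (at y0)"
proof -
  have "((\<lambda>y. \<integral>x. F y x \<partial>M) has_derivative (\<lambda>v. \<integral>x. v *\<^sub>R F' y0 x \<partial>M)) (at y0 within UNIV)"
  proof (rule has_derivative_lebesgue_integral[OF _ int g])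
    show "((\<lambda>y. F y x) has_derivative (\<lambda>v. v *\<^sub>R F' y0 x)) (at y0 within UNIV)" if "x \<in> space M" for x
      using der[OF that] by (simp add: has_vector_derivative_def)
    show "norm (F y x - F y0 x) \<le> g x * norm (y - y0)" if x: "x \<in> space M" for x y
    proof (rule differentiable_bound[of UNIV _ "\<lambda>y v. v *\<^sub>R F' y x"])
      show "onorm (\<lambda>v. v *\<^sub>R F' z x) \<le> g x" for z
        by (rule onorm_le) (use bound[OF x, of z] in \<open>simp add: mult.commute mult_left_mono\<close>)
    qed (use der[OF x] in \<open>auto simp: has_vector_derivative_def\<close>)
    show "norm (v *\<^sub>R F' y0 x) \<le> g x * norm v" if "x \<in> space M" for x v
      using bound[OF that, of y0] by (simp add: mult.commute mult_left_mono)
  qed (use meas in auto)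
  then show ?thesis by (simp add: has_vector_derivative_def)
qed

lemma has_field_derivative_lebesgue_integral:
  fixes F F' :: "complex \<Rightarrow> 'x \<Rightarrow> complex"
  assumes S: "open S" "convex S" "z0 \<in> S"
    and int: "\<And>z. z \<in> S \<Longrightarrow> integrable M (F z)" and g: "integrable M g"
    and der: "\<And>x z. x \<in> space M \<Longrightarrow> z \<in> S \<Longrightarrow> ((\<lambda>z. F z x) has_field_derivative F' z x) (at z)"
    and bound: "\<And>x z. x \<in> space M \<Longrightarrow> z \<in> S \<Longrightarrow> norm (F' z x) \<le> g x"
    and meas: "F' z0 \<in> borel_measurable M"
  shows "((\<lambda>z. \<integral>x. F z x \<partial>M) has_field_derivative (\<integral>x. F' z0 x \<partial>M)) (at z0)"
proof -
  have "((\<lambda>y. \<integral>x. F y x \<partial>M) has_derivative (\<lambda>v. \<integral>x. F' z0 x * v \<partial>M)) (at z0 within S)"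
  proof (rule has_derivative_lebesgue_integral[OF S(3) int g])
    show "((\<lambda>y. F y x) has_derivative (\<lambda>v. F' z0 x * v)) (at z0 within S)" if "x \<in> space M" for x
      using der[OF that S(3)] by (simp add: has_field_derivative_def has_derivative_at_withinI)
    show "norm (F z x - F z0 x) \<le> g x * norm (z - z0)" if x: "x \<in> space M" and z: "z \<in> S" for x z
      using der[OF x] bound[OF x] z S
      by (intro field_differentiable_bound[of S _ "\<lambda>z. F' z x"]) (auto intro: has_field_derivative_at_within)
    show "norm (F' z0 x * v) \<le> g x * norm v" if "x \<in> space M" for x v
      using bound[OF that S(3)] by (simp add: norm_mult mult_right_mono)
  qed (use meas in auto)
  then show ?thesis
    unfolding has_field_derivative_def integral_mult_left_zero at_within_open[OF S(3) S(1)] .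
qed

section \<open>Uniqueness for the Laplace transform on the half line\<close>

abbreviation lpos :: "real measure" where
  "lpos \<equiv> restrict_space lborel {0<..}"

lemma borel_measurable_lpos:
  fixes f :: "real \<Rightarrow> 'b::topological_space"
  assumes "continuous_on {0<..} f"
  shows "f \<in> borel_measurable lpos"
proof -
  have "sets lpos = sets (restrict_space borel {0<..})"
    by (rule sets_restrict_space_cong) simp
  from measurable_cong_sets[OF this refl] show ?thesis
    using borel_measurable_continuous_on_restrict[OF assms] by simp
qed

lemma space_lpos [simp]: "space lpos = {0<..}"
  by (simp add: space_restrict_space)

text \<open>With the substitution \<open>u = exp (- x)\<close>, the hypothesis kills all integrals
  of \<phi> against \<open>exp (- x)\<close> times a polynomial in \<open>exp (- x)\<close>.
  Weierstrass approximation extends this to continuous functions on the unit interval, and a tent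
  function then isolates a point where \<phi> does not vanish. The spare factor
  \<open>exp (- x)\<close> reflects that \<open>n\<close> starts at 1.\<close>

lemma laplace_unique:
  fixes \<phi> :: "real \<Rightarrow> complex"
  assumes cont: "continuous_on {0<..} \<phi>" and int: "integrable lpos \<phi>"
    and zero: "\<And>n::nat. n \<ge> 1 \<Longrightarrow> (\<integral>x. exp (- (real n * x)) *\<^sub>R \<phi> x \<partial>lpos) = 0"
    and x0: "x0 > 0"
  shows "\<phi> x0 = 0"
proof -
  have phim [measurable]: "\<phi> \<in> borel_measurable lpos" by (rule borel_measurable_lpos[OF cont])
  have mul: "integrable lpos (\<lambda>x. h x *\<^sub>R \<phi> x)" if "continuous_on {0<..} h" "\<And>x. x > 0 \<Longrightarrow> \<bar>h x\<bar> \<le> B"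
    for h :: "real \<Rightarrow> real" and B
  proof (rule Bochner_Integration.integrable_bound[OF integrable_mult_left[OF integrable_norm[OF int], of B]])
    show "(\<lambda>x. h x *\<^sub>R \<phi> x) \<in> borel_measurable lpos"
      using borel_measurable_lpos[OF that(1)] by simp
    show "AE x in lpos. norm (h x *\<^sub>R \<phi> x) \<le> norm (norm (\<phi> x) * B)"
      by (rule AE_I2) (auto simp: abs_mult mult.commute[of _ "norm _"] intro!: mult_left_mono order_trans[OF that(2)])
  qed
  have c: "(\<integral>x. (exp (-x) * g (exp (-x))) *\<^sub>R \<phi> x \<partial>lpos) = 0" if g: "continuous_on {0..1} g" for g :: "real \<Rightarrow> real"
  proof -
    have gc: "continuous_on {0<..} (\<lambda>x. exp (-x) * g (exp (-x)))"
      by (intro continuous_intros continuous_on_compose2[OF g]) auto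
    have "bounded (g ` {0..1})" by (intro compact_imp_bounded compact_continuous_image g) auto
    then obtain Bg where "\<forall>x\<in>{0..1}. \<bar>g x\<bar> \<le> Bg" by (auto simp: bounded_iff)
    then have Bg: "\<And>x. x \<in> {0..1} \<Longrightarrow> \<bar>g x\<bar> \<le> Bg" by blast
    have eB: "\<bar>exp (-x) * u\<bar> \<le> B" if "x > 0" "\<bar>u\<bar> \<le> B" for x u B :: real
    proof -
      have "\<bar>exp (-x) * u\<bar> = exp (-x) * \<bar>u\<bar>" by (simp add: abs_mult)
      also have "\<dots> \<le> 1 * B" using that by (intro mult_mono) auto
      finally show ?thesis by simp
    qed
    have gi: "integrable lpos (\<lambda>x. (exp (-x) * g (exp (-x))) *\<^sub>R \<phi> x)"
      by (rule mul[OF gc, of Bg]) (rule eB, auto intro: Bg)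
    let ?I = "\<integral>x. (exp (-x) * g (exp (-x))) *\<^sub>R \<phi> x \<partial>lpos"
    have nI: "norm ?I \<le> e * (\<integral>x. norm (\<phi> x) \<partial>lpos)" if e: "e > 0" for e
    proof -
      obtain p where p: "real_polynomial_function p" "\<And>x. x \<in> {0..1} \<Longrightarrow> \<bar>g x - p x\<bar> < e"
        using Stone_Weierstrass_real_polynomial_function[OF _ g e] by auto
      then obtain a n where pa: "p = (\<lambda>x. \<Sum>i\<le>n. a i * x ^ i)"
        using real_polynomial_function_iff_sum by auto
      have pe: "(exp (-x) * p (exp (-x))) *\<^sub>R \<phi> x = (\<Sum>i\<le>n. a i *\<^sub>R (exp (- (real (Suc i) * x)) *\<^sub>R \<phi> x))" for x
      proof -
        have "exp (-x) * exp (-x) ^ i = exp (- (real (Suc i) * x))" for i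
          by (metis exp_of_nat_mult mult_minus_right power_Suc)
        then have "exp (-x) * p (exp (-x)) = (\<Sum>i\<le>n. a i * exp (- (real (Suc i) * x)))"
          unfolding pa sum_distrib_left by (metis mult.left_commute)
        then show ?thesis by (simp add: scaleR_left.sum)
      qed
      have ei: "integrable lpos (\<lambda>x. exp (- (real (Suc i) * x)) *\<^sub>R \<phi> x)" for i
        by (rule mul[where B=1]) (auto intro!: continuous_intros)
      have pi: "integrable lpos (\<lambda>x. (exp (-x) * p (exp (-x))) *\<^sub>R \<phi> x)"
        unfolding pe by (intro Bochner_Integration.integrable_sum integrable_scaleR_right ei)
      have p0: "(\<integral>x. (exp (-x) * p (exp (-x))) *\<^sub>R \<phi> x \<partial>lpos) = 0"
      proof -
        have "(\<integral>x. (exp (-x) * p (exp (-x))) *\<^sub>R \<phi> x \<partial>lpos) =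
            (\<Sum>i\<le>n. \<integral>x. a i *\<^sub>R (exp (- (real (Suc i) * x)) *\<^sub>R \<phi> x) \<partial>lpos)"
          unfolding pe by (rule Bochner_Integration.integral_sum) (intro integrable_scaleR_right ei)
        also have "\<dots> = 0"
          by (rule sum.neutral) (simp only: Bochner_Integration.integral_scaleR_right zero[of "Suc _"] scaleR_zero_right, simp)
        finally show ?thesis .
      qed
      have de: "(exp (-x) * (g (exp (-x)) - p (exp (-x)))) *\<^sub>R \<phi> x =
          (exp (-x) * g (exp (-x))) *\<^sub>R \<phi> x - (exp (-x) * p (exp (-x))) *\<^sub>R \<phi> x" for x
        by (simp only: right_diff_distrib scaleR_left_diff_distrib)
      have "norm ?I = norm (\<integral>x. (exp (-x) * (g (exp (-x)) - p (exp (-x)))) *\<^sub>R \<phi> x \<partial>lpos)"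
        unfolding de by (simp only: Bochner_Integration.integral_diff[OF gi pi] p0 diff_zero)
      also have "\<dots> \<le> (\<integral>x. norm ((exp (-x) * (g (exp (-x)) - p (exp (-x)))) *\<^sub>R \<phi> x) \<partial>lpos)"
        by (rule integral_norm_bound)
      also have "\<dots> \<le> (\<integral>x. e * norm (\<phi> x) \<partial>lpos)"
      proof (rule integral_mono)
        show "integrable lpos (\<lambda>x. norm ((exp (-x) * (g (exp (-x)) - p (exp (-x)))) *\<^sub>R \<phi> x))"
          unfolding de by (intro integrable_norm Bochner_Integration.integrable_diff gi pi)
        show "norm ((exp (-x) * (g (exp (-x)) - p (exp (-x)))) *\<^sub>R \<phi> x) \<le> e * norm (\<phi> x)" if "x \<in> space lpos" for x
          unfolding norm_scaleR real_norm_def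
          by (intro mult_right_mono eB less_imp_le[OF p(2)]) (use that in auto)
      qed (use int in auto)
      finally show ?thesis by simp
    qed
    \<comment> \<open>Approximating within \<open>e / (J + 1)\<close> instead of
      \<open>e / J\<close> avoids a division by zero when the integral \<open>J\<close> of the norm
      vanishes.\<close>
    have aux: "e / (J + 1) > 0 \<and> e / (J + 1) * J \<le> 0 + e" if "J \<ge> 0" "e > 0" for e J :: real
      using that by (auto simp: field_simps)
    have J: "(\<integral>x. norm (\<phi> x) \<partial>lpos) \<ge> 0" by (rule integral_nonneg_AE) simp
    have nI': "norm ?I \<le> 0 + e" if "e > 0" for e
      by (rule order_trans[OF nI]) (rule conjunct1[OF aux[OF J that]], rule conjunct2[OF aux[OF J that]])
    have "norm ?I \<le> 0" by (rule field_le_epsilon) (rule nI')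
    then show ?thesis by simp
  qed
  show ?thesis
  proof (rule ccontr)
    assume ne: "\<phi> x0 \<noteq> 0"
    \<comment> \<open>Multiplying by the conjugate of \<open>\<phi> x0\<close> makes the real part
      positive at \<open>x0\<close>, hence near it, so that a sign argument becomes possible for a
      complex function.\<close>
    let ?r = "\<lambda>x. Re (cnj (\<phi> x0) * \<phi> x)"
    have rc: "continuous_on {0<..} ?r" by (intro continuous_intros cont)
    have r0: "?r x0 > 0" using ne by (simp add: complex_neq_0 power2_eq_square)
    have "isCont ?r x0" using rc x0 by (simp add: continuous_on_eq_continuous_at)
    then have "eventually (\<lambda>x. ?r x > 0) (at x0)" using r0 unfolding isCont_def by (rule order_tendstoD)
    then obtain d where d1: "d > 0" and d2: "\<And>x. x \<noteq> x0 \<Longrightarrow> dist x x0 < d \<Longrightarrow> ?r x > 0"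
      unfolding eventually_at by auto
    have d: "d > 0" "?r x > 0" if "dist x x0 < d" for x
      using d1 d2[OF _ that] r0 by (cases "x = x0"; blast)+
    \<comment> \<open>A tent in the variable \<open>u = exp (- x)\<close>, positive exactly for
      \<open>x\<close> strictly between \<open>x0 - d\<close> and \<open>x0 + d\<close>.\<close>
    define g where "g u = max 0 (min (u - exp (- (x0 + d))) (exp (- (x0 - d)) - u))" for u
    have gc: "continuous_on S g" for S unfolding g_def by (intro continuous_intros)
    let ?f = "\<lambda>x. indicator {0<..} x *\<^sub>R (exp (-x) * g (exp (-x)) * ?r x)"
    have blin: "bounded_linear (\<lambda>z. Re (cnj (\<phi> x0) * z))"
      by (rule bounded_linear_compose[OF bounded_linear_Re bounded_linear_mult_right])
    have gle: "\<bar>exp (-x) * g (exp (-x))\<bar> \<le> 1" if "x > 0" for x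
    proof -
      have "exp (-x) \<le> 1" "exp (- (x0 + d)) > 0" using that by auto
      then have "g (exp (-x)) \<le> 1" "g (exp (-x)) \<ge> 0" unfolding g_def by linarith+
      then show ?thesis using that by (simp add: abs_mult mult_le_one)
    qed
    have gi: "integrable lpos (\<lambda>x. (exp (-x) * g (exp (-x))) *\<^sub>R \<phi> x)"
      by (rule mul[of _ 1]) (auto intro!: continuous_intros continuous_on_compose2[OF gc] gle)
    have fe: "?f x = indicator {0<..} x *\<^sub>R (Re (cnj (\<phi> x0) * ((exp (-x) * g (exp (-x))) *\<^sub>R \<phi> x)))" for x
      by (simp add: algebra_simps)
    have fi: "integrable lborel ?f"
      using integrable_bounded_linear[OF blin gi] unfolding fe by (subst (asm) integrable_restrict_space) auto
    have "(\<integral>x. ?f x \<partial>lborel) = (\<integral>x. Re (cnj (\<phi> x0) * ((exp (-x) * g (exp (-x))) *\<^sub>R \<phi> x)) \<partial>lpos)"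
      unfolding fe by (subst integral_restrict_space) auto
    also have "\<dots> = Re (cnj (\<phi> x0) * (\<integral>x. ((exp (-x) * g (exp (-x))) *\<^sub>R \<phi> x) \<partial>lpos))"
      by (rule integral_bounded_linear[OF blin gi])
    also have "\<dots> = 0" by (subst c[OF gc]) simp
    finally have f0: "(\<integral>x. ?f x \<partial>lborel) = 0" .
    have "(\<integral>x. ?f x \<partial>lborel) > 0"
    proof (rule integral_pos_isCont[OF fi, of x0])
      show "?f x \<ge> 0" for x
      proof (cases "dist x x0 < d")
        case True
        then show ?thesis using d(2)[OF True] by (auto intro!: mult_nonneg_nonneg simp: g_def)
      next
        case False
        then have "x0 + d \<le> x \<or> x \<le> x0 - d" unfolding dist_real_def by linarith
        then have "exp (-x) \<le> exp (- (x0 + d)) \<or> exp (- (x0 - d)) \<le> exp (-x)" by auto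
        then have "g (exp (-x)) = 0" unfolding g_def by linarith
        then show ?thesis by simp
      qed
      have "continuous_on {0<..} (\<lambda>x. exp (-x) * g (exp (-x)) * ?r x)"
        by (intro continuous_intros continuous_on_compose2[OF gc] rc) auto
      then have "continuous_on {0<..} ?f"
        by (rule continuous_on_eq) auto
      then show "isCont ?f x0" using x0 by (simp add: continuous_on_eq_continuous_at)
      have "g (exp (-x0)) > 0" using d1 by (simp add: g_def)
      then show "?f x0 > 0" using x0 r0 by simp
    qed
    with f0 show False by simp
  qed
qed

section \<open>A decay theorem in the half plane\<close>

text \<open>As \<rho> increases, the factors above 1 form an initial segment of the product. Its
  length \<open>p\<close>, which depends on \<open>s\<close>, is the exponent at which the decay
  bound on the imaginary axis will be applied.\<close>

lemma prod_max_le_prefix: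
  fixes \<rho> :: "nat \<Rightarrow> real"
  assumes pos: "\<And>j. \<rho> j > 0" and mono: "incseq \<rho>" and s: "s \<ge> 0"
  shows "\<exists>p. (\<Prod>j<k. max 1 (s / \<rho> j)) = s ^ p / (\<Prod>j<p. \<rho> j)"
proof (induction k)
  case 0
  then show ?case by (intro exI[of _ 0]) simp
next
  case (Suc k)
  show ?case
  proof (cases "s \<le> \<rho> k")
    case True
    then have "max 1 (s / \<rho> k) = 1" using pos[of k] by (simp add: max_def)
    then show ?thesis using Suc by simp
  next
    case False
    have "max 1 (s / \<rho> j) = s / \<rho> j" if "j \<in> {..<Suc k}" for j
    proof -
      have "\<rho> j \<le> s" using incseqD[OF mono, of j k] that False by simp
      then show ?thesis using pos[of j] by (simp add: max_def)
    qed
    then have "(\<Prod>j<Suc k. max 1 (s / \<rho> j)) = (\<Prod>j<Suc k. s / \<rho> j)" by (rule prod.cong[OF refl])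
    also have "\<dots> = s ^ Suc k / (\<Prod>j<Suc k. \<rho> j)" unfolding prod_dividef by simp
    finally show ?thesis by blast
  qed
qed

text \<open>For \<open>z = \<i> t r\<close> the squared modulus is
  \<open>(1 - s)^2 + s = 1 - s + s^2\<close> with \<open>s = t^2\<close>, which is at most 1 or at
  most \<open>s^2\<close> according as \<open>s\<close> lies below or above 1.\<close>

lemma norm_quadratic_imaginary_axis:
  fixes z :: complex
  assumes z: "Re z = 0" and r: "r > 0"
  shows "norm (1 + z / of_real r + (z / of_real r)^2) \<le> max 1 (norm z ^ 2 / r^2)"
proof -
  define t where "t = Im z / r"
  have zr: "z / of_real r = \<i> * of_real t" using z r by (simp add: t_def complex_eq_iff)
  have e: "1 + z / of_real r + (z / of_real r)^2 = Complex (1 - t^2) t"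
    unfolding zr by (simp add: complex_eq_iff power_mult_distrib)
  have m: "norm z ^ 2 / r^2 = t^2" using z by (simp add: t_def cmod_power2 power_divide)
  have "(1 - t^2)^2 + t^2 \<le> (max 1 (t^2))^2"
  proof -
    have "s \<ge> 0 \<Longrightarrow> (1 - s)^2 + s \<le> (max 1 s)^2" for s :: real
    proof (cases "s \<le> 1")
      case True
      then show "s \<ge> 0 \<Longrightarrow> ?thesis" using mult_left_mono[of s 1 s] by (simp add: max_def power2_eq_square algebra_simps)
    next
      case False
      then show ?thesis by (simp add: max_def power2_eq_square algebra_simps)
    qed
    then show ?thesis by simp
  qed
  then show ?thesis unfolding e m by (simp add: complex_norm real_le_lsqrt)
qed

text \<open>The products \<open>G * R k\<close> are bounded by \<open>C\<close> uniformly in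
  \<open>k\<close>: on the imaginary axis because the decay of \<open>G\<close> compensates the
  growth of \<open>R k\<close>, on a large arc because \<open>G\<close> is estimated there with two
  powers of \<open>norm z\<close> to spare. At \<open>x\<close> the polynomials \<open>R k\<close>
  grow at least like the partial sums of the divergent series, which forces \<open>G\<close> to
  vanish.\<close>

lemma halfplane_decay_imp_zero:
  fixes G :: "complex \<Rightarrow> complex" and \<rho> :: "nat \<Rightarrow> real"
  assumes hol: "G holomorphic_on {z. Re z > 0}" and cont: "continuous_on {z. Re z \<ge> 0} G"
    and C: "C > 0"
    and bound: "\<And>z p. Re z \<ge> 0 \<Longrightarrow> norm (G z) * norm z ^ (2 * p) \<le> C * (\<Prod>j<p. \<rho> j)"
    and pos: "\<And>j. \<rho> j > 0" and mono: "incseq \<rho>"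
    and div: "\<not> summable (\<lambda>j. 1 / sqrt (\<rho> j))"
    and x: "x > 0"
  shows "G (of_real x) = 0"
proof -
  define r where "r j = sqrt (\<rho> j)" for j
  have r: "r j > 0" "(r j)^2 = \<rho> j" for j using pos[of j] by (auto simp: r_def)
  define R :: "nat \<Rightarrow> complex \<Rightarrow> complex"
    where "R k z = (\<Prod>j<k. 1 + z / of_real (r j) + (z / of_real (r j))^2)" for k z
  have Rb: "norm (G z * R k z) \<le> C" if z: "Re z > 0" for z k
  proof -
    define P where "P = (\<Prod>j<Suc k. \<rho> j)"
    define K where "K = (\<Prod>j<k. 1 + 1 / r j + 1 / \<rho> j)"
    have P: "P > 0" unfolding P_def by (intro prod_pos) (auto simp: pos)
    have K: "K > 0" unfolding K_def by (intro prod_pos) (auto intro!: add_pos_pos simp: pos r)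
    \<comment> \<open>The radius exceeds \<open>norm z\<close>, so that \<open>z\<close> lies in the
      half disc, and it is at least \<open>P * K\<close>, so that the arc estimate can end with
      \<open>P * K / N^2 \<le> 1\<close>.\<close>
    define N where "N = norm z + 1 + P * K"
    have "P * K > 0" using P K by simp
    then have N: "N > norm z" "N \<ge> 1" "N \<ge> P * K" unfolding N_def by auto
    define S where "S = ball 0 N \<inter> {z::complex. Re z > 0}"
    have oS: "open S" unfolding S_def by (intro open_Int open_ball open_halfspace_Re_gt)
    have clS: "closure S \<subseteq> cball 0 N \<inter> {z. Re z \<ge> 0}"
      by (rule closure_minimal) (auto simp: S_def intro!: closed_Int closed_halfspace_Re_ge)
    show ?thesis
    proof (rule maximum_modulus_frontier[where S=S and f="\<lambda>z. G z * R k z"])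
      show "(\<lambda>z. G z * R k z) holomorphic_on interior S"
        unfolding interior_open[OF oS] R_def
        by (intro holomorphic_intros holomorphic_on_subset[OF hol])
          (use r(1) in \<open>auto simp: S_def less_imp_neq[symmetric]\<close>)
      show "continuous_on (closure S) (\<lambda>z. G z * R k z)"
        unfolding R_def
        by (intro continuous_intros continuous_on_subset[OF cont])
          (use r(1) clS in \<open>auto simp: less_imp_neq[symmetric]\<close>)
      show "bounded S" unfolding S_def by (rule bounded_subset[of "ball 0 N"]) auto
      show "z \<in> S" using z N by (simp add: S_def)
      fix w assume "w \<in> frontier S"
      then have w: "w \<in> cball 0 N" "Re w \<ge> 0" "w \<notin> S"
        using clS oS by (auto simp: frontier_def interior_open)
      then consider "Re w = 0" | "norm w = N" by (force simp: S_def)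
      then show "norm (G w * R k w) \<le> C"
      proof cases
        case 1
        have "norm (R k w) \<le> (\<Prod>j<k. max 1 (norm w ^ 2 / \<rho> j))"
          unfolding R_def prod_norm[symmetric]
          by (intro prod_mono conjI norm_ge_zero) (use norm_quadratic_imaginary_axis[OF 1 r(1)] r(2) in simp)
        also obtain p where "(\<Prod>j<k. max 1 (norm w ^ 2 / \<rho> j)) = (norm w ^ 2) ^ p / (\<Prod>j<p. \<rho> j)"
          using prod_max_le_prefix[OF pos mono, of "norm w ^ 2" k] by auto
        finally have le: "norm (R k w) \<le> norm w ^ (2 * p) / (\<Prod>j<p. \<rho> j)" by (simp add: power_mult)
        have pp: "(\<Prod>j<p. \<rho> j) > 0" by (intro prod_pos) (auto simp: pos)
        have "norm (G w * R k w) \<le> norm (G w) * (norm w ^ (2 * p) / (\<Prod>j<p. \<rho> j))"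
          unfolding norm_mult by (intro mult_left_mono le) simp
        also have "\<dots> \<le> C" using bound[OF w(2), of p] pp by (simp add: field_simps)
        finally show ?thesis .
      next
        case 2
        have "norm (1 + w / of_real (r j) + (w / of_real (r j))^2) \<le> (1 + 1 / r j + 1 / \<rho> j) * N^2" for j
        proof -
          have "norm (1 + w / of_real (r j) + (w / of_real (r j))^2) \<le> 1 + N / r j + N^2 / \<rho> j"
            by (intro order_trans[OF norm_triangle_ineq] add_mono)
              (use r[of j] 2 in \<open>auto simp: norm_divide norm_power power_divide\<close>)
          also have "\<dots> \<le> N^2 + N^2 / r j + N^2 / \<rho> j"
            using N(2) r(1)[of j] pos[of j] power_increasing[of 1 2 N] one_le_power[of N 2]
            by (intro add_mono divide_right_mono) auto
          finally show ?thesis by (simp add: algebra_simps)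
        qed
        then have "norm (R k w) \<le> (\<Prod>j<k. (1 + 1 / r j + 1 / \<rho> j) * N^2)"
          unfolding R_def prod_norm[symmetric] by (intro prod_mono conjI norm_ge_zero)
        also have "\<dots> = K * N^(2*k)"
          unfolding prod.distrib K_def by (simp add: power_mult)
        finally have le: "norm (R k w) \<le> K * N^(2*k)" .
        have N0: "N > 0" using N(2) by simp
        have "norm (G w * R k w) \<le> norm (G w) * (K * N^(2*k))"
          unfolding norm_mult by (intro mult_left_mono le) simp
        \<comment> \<open>The decay exponent \<open>Suc k\<close>, one more than the number of
          factors of \<open>R k\<close>, leaves the factor \<open>1 / N^2\<close>.\<close>
        also have "\<dots> = (norm (G w) * N^(2 * Suc k)) * K / N^2"
          using N0 by (simp add: field_simps power2_eq_square)
        also have "\<dots> \<le> (C * P) * K / N^2"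
          using bound[OF w(2), of "Suc k"] K N0 unfolding 2 P_def
          by (intro divide_right_mono mult_right_mono) auto
        also have "\<dots> = C * ((P * K) / N^2)" by simp
        also have "\<dots> \<le> C * 1"
        proof (intro mult_left_mono)
          have "P * K \<le> N * 1" using N by simp
          also have "\<dots> \<le> N * N" using N by (intro mult_left_mono) auto
          finally show "(P * K) / N^2 \<le> 1" using N0 by (simp add: power2_eq_square divide_le_eq)
        qed (use C in auto)
        finally show ?thesis by simp
      qed
    qed
  qed
  show ?thesis
  proof (rule ccontr)
    assume ne: "G (of_real x) \<noteq> 0"
    have Rlow: "1 + x * (\<Sum>j<k. 1 / r j) \<le> norm (R k (of_real x))" for k
    proof -
      have "1 + (\<Sum>j<k. x / r j) \<le> (\<Prod>j<k. 1 + x / r j)"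
      proof (induction k)
        case (Suc k)
        have "(\<Sum>j<k. x / r j) \<ge> 0" using x r(1) by (intro sum_nonneg) (simp add: less_imp_le)
        then have "1 * (x / r k) \<le> (\<Prod>j<k. 1 + x / r j) * (x / r k)"
          using Suc x r(1)[of k] by (intro mult_right_mono) auto
        then show ?case using Suc by (simp add: distrib_left)
      qed simp
      also have "\<dots> \<le> (\<Prod>j<k. norm (1 + complex_of_real x / of_real (r j) + (of_real x / of_real (r j))^2))"
      proof (intro prod_mono conjI)
        fix j
        have "1 + complex_of_real x / of_real (r j) + (of_real x / of_real (r j))^2 = of_real (1 + x / r j + (x / r j)^2)" by simp
        then have "norm (1 + complex_of_real x / of_real (r j) + (of_real x / of_real (r j))^2) = 1 + x / r j + (x / r j)^2"
          using x r(1)[of j] by (simp only: norm_of_real) (auto intro!: abs_of_nonneg add_nonneg_nonneg)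
        then show "1 + x / r j \<le> norm (1 + complex_of_real x / of_real (r j) + (of_real x / of_real (r j))^2)" by simp
        show "0 \<le> 1 + x / r j" using x r(1)[of j] by simp
      qed
      finally show ?thesis unfolding R_def prod_norm by (simp add: sum_distrib_left)
    qed
    have S: "(\<Sum>j<k. 1 / r j) \<le> C / (norm (G (of_real x)) * x)" for k
    proof -
      have "norm (G (of_real x)) * (1 + x * (\<Sum>j<k. 1 / r j)) \<le> norm (G (of_real x)) * norm (R k (of_real x))"
        by (intro mult_left_mono Rlow) simp
      also have "\<dots> \<le> C" using Rb[of "of_real x" k] x by (simp add: norm_mult)
      finally have "norm (G (of_real x)) * (x * (\<Sum>j<k. 1 / r j)) \<le> C"
        by (smt (verit) distrib_left mult_cancel_left1 norm_ge_zero)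
      then show ?thesis using ne x by (simp add: field_simps)
    qed
    have "summable (\<lambda>j. 1 / r j)"
    proof (rule bounded_imp_summable)
      show "(\<Sum>j\<le>k. 1 / r j) \<le> C / (norm (G (of_real x)) * x)" for k
        using S[of "Suc k"] by (simp only: lessThan_Suc_atMost)
    qed (use r(1) in \<open>simp add: less_imp_le\<close>)
    then show False using div by (simp add: r_def)
  qed
qed

section \<open>Flat functions in the upper half plane\<close>

lemma integrable_exp_lpos:
  assumes r: "r > 0"
  shows "integrable lpos (\<lambda>u. exp (- (u * r)))"
proof -
  have "integrable lborel (\<lambda>u. indicator {0<..} u *\<^sub>R exp (- (u * r)))"
  proof (rule Bochner_Integration.integrable_bound[OF integrable_mult_left[OF integrable_inverse_1_plus_square, of "1 + 2 / r^2"]])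
    show "AE u in lborel. norm (indicator {0<..} u *\<^sub>R exp (- (u * r))) \<le> norm (1 / (1 + u^2) * (1 + 2 / r^2))"
    proof (rule AE_I2)
      fix u :: real
      show "norm (indicator {0<..} u *\<^sub>R exp (- (u * r))) \<le> norm (1 / (1 + u^2) * (1 + 2 / r^2))"
      proof (cases "u > 0")
        case True
        have "1 + u * r + (u * r)^2 / 2 \<le> exp (u * r)"
          by (rule exp_lower_Taylor_quadratic) (use True r in simp)
        then have e: "1 + (u * r)^2 / 2 \<le> exp (u * r)" using True r mult_pos_pos[of u r] by linarith
        have "1 + u^2 \<le> (1 + 2 / r^2) * (1 + (u * r)^2 / 2)"
          using r by (simp add: field_simps)
        also have "\<dots> \<le> (1 + 2 / r^2) * exp (u * r)"
          by (intro mult_left_mono e) simp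
        finally have "1 + u^2 \<le> (1 + 2 / r^2) * exp (u * r)" .
        moreover have "1 + u^2 > 0" by (simp add: add_pos_nonneg)
        moreover have "1 + 2 / r^2 > 0" by (simp add: add_pos_nonneg)
        ultimately show ?thesis using True
          by (simp add: exp_minus field_simps abs_of_pos)
      qed simp
    qed
  qed simp
  then show ?thesis by (subst integrable_restrict_space) auto
qed

lemma integrable_times_exp_lpos:
  assumes r: "r > 0"
  shows "integrable lpos (\<lambda>u. u * exp (- (u * r)))"
proof (rule Bochner_Integration.integrable_bound[OF integrable_mult_left[OF integrable_exp_lpos[of "r/2"], of "2 / r"]])
  show "(\<lambda>u. u * exp (- (u * r))) \<in> borel_measurable lpos"
    by (rule borel_measurable_lpos) (intro continuous_intros)
  show "AE u in lpos. norm (u * exp (- (u * r))) \<le> norm (exp (- (u * (r / 2))) * (2 / r))"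
  proof (rule AE_I2)
    fix u assume u: "u \<in> space lpos"
    have "u * (r / 2) \<le> exp (u * (r / 2))" using exp_ge_add_one_self[of "u * (r / 2)"] by linarith
    then have "u \<le> 2 / r * exp (u * (r / 2))" using r by (simp add: field_simps)
    then have "u * exp (- (u * r)) \<le> 2 / r * exp (u * (r / 2)) * exp (- (u * r))"
      by (intro mult_right_mono) auto
    also have "\<dots> = 2 / r * exp (u * (r / 2) + - (u * r))" unfolding exp_add by simp
    also have "u * (r / 2) + - (u * r) = - (u * (r / 2))" by simp
    finally show "norm (u * exp (- (u * r))) \<le> norm (exp (- (u * (r / 2))) * (2 / r))"
      using u r by (simp add: abs_mult mult.commute)
  qed
qed (use r in simp)

lemma open_upper_half: "open upper_half" and convex_upper_half: "convex upper_half"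
  unfolding upper_half_def by (rule open_halfspace_Im_gt, rule convex_halfspace_Im_gt)

section \<open>The transform of a flat function along rotated rays\<close>

lemma rotated_ray_in_upper_half:
  assumes "u > 0" "Re z > 0" shows "\<i> * of_real u / z \<in> upper_half"
proof -
  have "z \<noteq> 0" using assms by auto
  then have "Im (\<i> * of_real u / z) = u * Re z / (norm z)^2"
    by (simp add: Im_divide cmod_power2)
  then show ?thesis using assms \<open>z \<noteq> 0\<close> by (simp add: upper_half_def)
qed

text \<open>The successive derivatives are a given family rather than iterates of
  \<open>deriv\<close>, so that termwise differences for two functions can be inserted
  later.\<close>

locale flat_halfplane =
  fixes F :: "nat \<Rightarrow> complex \<Rightarrow> complex" and K :: "nat \<Rightarrow> real"
  assumes der: "\<And>p z. z \<in> upper_half \<Longrightarrow> (F p has_field_derivative F (Suc p) z) (at z)"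
    and bound: "\<And>p z. z \<in> upper_half \<Longrightarrow> norm (F p z) \<le> K p"
    and flat: "\<And>p. (F p \<longlongrightarrow> 0) (at 0 within upper_half)"
begin

text \<open>Formally, with \<open>v = u / z\<close>, this is \<open>z\<close> times the Laplace
  transform of \<open>F p (\<i> v)\<close> at \<open>z^2\<close>, taken along the ray through
  \<open>1 / z\<close>. Turning the ray gives convergence for every \<open>z\<close> with positive
  real part, so \<open>z^2\<close> ranges over a slit plane; this is where the square roots of the
  quotients originate.\<close>

definition J :: "nat \<Rightarrow> complex \<Rightarrow> complex" where
  "J p z = (\<integral>u. F p (\<i> * of_real u / z) * exp (- (of_real u * z)) \<partial>lpos)"

lemma K_nonneg: "K p \<ge> 0"
proof -
  have "\<i> \<in> upper_half" by (simp add: upper_half_def)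
  from bound[OF this, of p] show ?thesis by (meson norm_ge_zero order_trans)
qed

lemma continuous_ray:
  assumes "Re z > 0"
  shows "continuous_on {0<..} (\<lambda>u. F p (\<i> * of_real u / z))"
proof -
  have "continuous_on upper_half (F p)"
    using der open_upper_half by (meson DERIV_continuous continuous_at_imp_continuous_on)
  then show ?thesis
    by (rule continuous_on_compose2)
      (use assms rotated_ray_in_upper_half[OF _ assms] in \<open>auto intro!: continuous_intros\<close>)
qed

lemma norm_integrand:
  assumes "u > 0" "Re z > 0"
  shows "norm (F p (\<i> * of_real u / z) * exp (- (of_real u * z))) \<le> K p * exp (- (u * Re z))"
  using bound[OF rotated_ray_in_upper_half[OF assms], of p]
  by (simp add: norm_mult mult_right_mono)

lemma integrable_integrand:
  assumes "Re z > 0"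
  shows "integrable lpos (\<lambda>u. F p (\<i> * of_real u / z) * exp (- (of_real u * z)))"
proof (rule Bochner_Integration.integrable_bound[OF integrable_mult_right[OF integrable_exp_lpos[OF assms], of "K p"]])
  show "(\<lambda>u. F p (\<i> * of_real u / z) * exp (- (of_real u * z))) \<in> borel_measurable lpos"
    by (intro borel_measurable_lpos continuous_intros continuous_ray assms)
  show "AE u in lpos. norm (F p (\<i> * of_real u / z) * exp (- (of_real u * z))) \<le> norm (K p * exp (- (u * Re z)))"
    by (rule AE_I2) (use norm_integrand[OF _ assms, of _ p] K_nonneg[of p] in \<open>simp add: abs_mult\<close>)
qed

lemma norm_J_le:
  assumes "d > 0" "Re z \<ge> d"
  shows "norm (J p z) \<le> K p * (\<integral>u. exp (- (u * d)) \<partial>lpos)"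
proof -
  have z: "Re z > 0" using assms by simp
  have "norm (J p z) \<le> (\<integral>u. norm (F p (\<i> * of_real u / z) * exp (- (of_real u * z))) \<partial>lpos)"
    unfolding J_def by (rule integral_norm_bound)
  also have "\<dots> \<le> (\<integral>u. K p * exp (- (u * d)) \<partial>lpos)"
  proof (rule integral_mono)
    fix u assume u: "u \<in> space lpos"
    have "exp (- (u * Re z)) \<le> exp (- (u * d))" using assms u by simp
    then show "norm (F p (\<i> * of_real u / z) * exp (- (of_real u * z))) \<le> K p * exp (- (u * d))"
      by (intro order_trans[OF norm_integrand[OF _ z] mult_left_mono[OF _ K_nonneg]]) (use u in auto)
  qed (intro integrable_norm integrable_integrand z integrable_mult_right integrable_exp_lpos assms)+
  finally show ?thesis by simp
qed

text \<open>The derivative of \<open>?W p\<close> is integrated over the half line; the boundary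
  term at 0 vanishes by flatness, the one at infinity by the exponential. Differentiating
  \<open>F p\<close> along the ray produces \<open>\<i> / z\<close> and differentiating the
  exponential produces \<open>- z\<close>, so each integration by parts gains
  \<open>1 / z^2\<close>.\<close>

lemma J_Suc:
  assumes z: "Re z > 0"
  shows "z^2 * J p z = \<i> * J (Suc p) z"
proof -
  have z0: "z \<noteq> 0" using z by auto
  let ?W = "\<lambda>p u. F p (\<i> * of_real u / z) * exp (- (of_real u * z))"
  let ?W' = "\<lambda>u. (\<i> / z) * ?W (Suc p) u - z * ?W p u"
  have Wd: "(?W p has_vector_derivative ?W' u) (at u)" if u: "u > 0" for u
  proof -
    note d = der[OF rotated_ray_in_upper_half[OF u z], of p]
    have "((\<lambda>w. F p (\<i> * w / z) * exp (- (w * z))) has_field_derivative ?W' u) (at (of_real u))"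
      by (rule derivative_eq_intros DERIV_chain2[where f="F p" and g="\<lambda>w. \<i> * w / z" and x="of_real u", OF d] refl
          | use z0 in \<open>simp add: algebra_simps\<close>)+
    then show ?thesis by (rule has_vector_derivative_real_field)
  qed
  have i: "integrable lpos ?W'"
    by (intro Bochner_Integration.integrable_diff integrable_mult_right integrable_integrand z)
  have i': "set_integrable lborel (einterval 0 \<infinity>) ?W'"
    using i unfolding set_integrable_def by (subst (asm) integrable_restrict_space) (auto simp: zero_ereal_def)
  have Wc: "continuous_on {0<..} ?W'"
    by (intro continuous_intros continuous_ray z)
  have "(LBINT u=0..\<infinity>. ?W' u) = 0 - 0"
  proof (rule interval_integral_FTC_integrable)
    show "(?W p has_vector_derivative ?W' u) (at u)" if "0 < ereal u" "ereal u < \<infinity>" for u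
      using Wd that by simp
    show "isCont ?W' u" if "0 < ereal u" "ereal u < \<infinity>" for u
      using Wc that by (simp add: continuous_on_eq_continuous_at)
    have ray: "filterlim (\<lambda>u. \<i> * of_real u / z) (at 0 within upper_half) (at_right 0)"
      unfolding filterlim_at
    proof
      show "\<forall>\<^sub>F u in at_right 0. \<i> * of_real u / z \<in> upper_half \<and> \<i> * of_real u / z \<noteq> 0"
        using rotated_ray_in_upper_half[OF _ z] z0 by (auto simp: eventually_at_right_less eventually_at_filter)
      have "((\<lambda>u. \<i> * of_real u / z) \<longlongrightarrow> \<i> * of_real 0 / z) (at_right 0)"
        by (intro tendsto_intros z0)
      then show "((\<lambda>u. \<i> * of_real u / z) \<longlongrightarrow> 0) (at_right 0)" by simp
    qed
    have "((\<lambda>u. F p (\<i> * of_real u / z)) \<longlongrightarrow> 0) (at_right 0)"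
      by (rule filterlim_compose[OF flat ray])
    moreover have "((\<lambda>u. exp (- (of_real u * z))) \<longlongrightarrow> exp (- (of_real 0 * z))) (at_right 0)"
      by (intro tendsto_intros)
    ultimately have "(?W p \<longlongrightarrow> 0) (at_right 0)"
      using tendsto_mult by fastforce
    then show "((?W p \<circ> real_of_ereal) \<longlongrightarrow> 0) (at_right 0)"
      by (simp add: ereal_tendsto_simps zero_ereal_def)
    have "((\<lambda>u. K p * exp (- (u * Re z))) \<longlongrightarrow> 0) at_top"
      using z by real_asymp
    then have "(?W p \<longlongrightarrow> 0) at_top"
      by (rule Lim_null_comparison[rotated])
        (use norm_integrand[OF _ z, of _ p] in \<open>auto intro!: eventually_mono[OF eventually_gt_at_top[of 0]]\<close>)
    then show "((?W p \<circ> real_of_ereal) \<longlongrightarrow> 0) (at_left \<infinity>)"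
      by (simp add: ereal_tendsto_simps)
  qed (use i' in auto)
  then have "(\<integral>u. ?W' u \<partial>lpos) = 0"
    by (subst integral_restrict_space) (auto simp: interval_lebesgue_integral_0_infty set_lebesgue_integral_def)
  then have "(\<i> / z) * J (Suc p) z - z * J p z = 0"
    unfolding J_def using integrable_integrand[OF z] by simp
  then show ?thesis using z0 by (simp add: field_simps power2_eq_square)
qed

lemma norm_J_power:
  assumes z: "Re z > 0"
  shows "norm (J 0 z) * norm z ^ (2 * p) = norm (J p z)"
proof (induction p)
  case (Suc p)
  have "norm (J 0 z) * norm z ^ (2 * Suc p) = norm (z^2 * J p z)"
    using Suc by (simp add: norm_mult norm_power power2_eq_square mult_ac)
  then show ?case unfolding J_Suc[OF z] by (simp add: norm_mult)
qed simp

lemma J_holomorphic: "J 0 holomorphic_on {z. Re z > 0}"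
proof (rule holomorphic_onI)
  fix z0 assume "z0 \<in> {z. Re z > 0}"
  then have z0: "Re z0 > 0" by simp
  \<comment> \<open>On the ball of radius \<open>r\<close> both \<open>Re z\<close> and
    \<open>norm z\<close> are at least \<open>r\<close>, so a multiple of
    \<open>u * exp (- (u * r))\<close> majorises the \<open>z\<close>-derivative of the integrand
    for all \<open>z\<close> in the ball at once.\<close>
  define r where "r = Re z0 / 2"
  have r: "r > 0" using z0 by (simp add: r_def)
  have ball: "Re z \<ge> r" "Re z > 0" "z \<noteq> 0" "norm z \<ge> r" if "z \<in> ball z0 r" for z
  proof -
    have "\<bar>Re z0 - Re z\<bar> < r" using that abs_Re_le_cmod[of "z0 - z"] by (simp add: dist_norm)
    then show 1: "Re z \<ge> r" using abs_ge_self[of "Re z0 - Re z"] unfolding r_def by linarith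
    then show "Re z > 0" using r by linarith
    then show "z \<noteq> 0" by auto
    show "norm z \<ge> r" using 1 complex_Re_le_cmod[of z] by linarith
  qed
  let ?F' = "\<lambda>z u. (F (Suc 0) (\<i> * of_real u / z) * (- (\<i> * of_real u / z^2)) - of_real u * F 0 (\<i> * of_real u / z)) * exp (- (of_real u * z))"
  have "((\<lambda>z. J 0 z) has_field_derivative (\<integral>u. ?F' z0 u \<partial>lpos)) (at z0)"
    unfolding J_def
  proof (rule has_field_derivative_lebesgue_integral[where S="ball z0 r" and g="\<lambda>u. (K 1 / r^2 + K 0) * (u * exp (- (u * r)))"])
    show "integrable lpos (\<lambda>u. (K 1 / r^2 + K 0) * (u * exp (- (u * r))))"
      by (intro integrable_mult_right integrable_times_exp_lpos r)
    fix u z assume u: "u \<in> space lpos" and z: "z \<in> ball z0 r"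
    have uz: "u > 0" "Re z > 0" "z \<noteq> 0" using u ball[OF z] by auto
    note d = der[OF rotated_ray_in_upper_half[OF uz(1,2)], of 0]
    show "((\<lambda>z. F 0 (\<i> * of_real u / z) * exp (- (of_real u * z))) has_field_derivative ?F' z u) (at z)"
      by (rule derivative_eq_intros DERIV_chain2[where f="F 0" and g="\<lambda>z. \<i> * of_real u / z" and x=z, OF d] refl
          | use uz in \<open>simp add: algebra_simps power2_eq_square\<close>)+
    have "norm (?F' z u) \<le> (K 1 * (u / r^2) + u * K 0) * exp (- (u * r))"
      unfolding norm_mult
    proof (intro mult_mono)
      show "norm (F (Suc 0) (\<i> * of_real u / z) * (- (\<i> * of_real u / z^2)) - of_real u * F 0 (\<i> * of_real u / z)) \<le> K 1 * (u / r^2) + u * K 0"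
      proof (intro order_trans[OF norm_triangle_ineq4] add_mono)
        have "norm (- (\<i> * of_real u / z^2)) \<le> u / r^2"
          using ball[OF z] r u by (simp add: norm_mult norm_divide norm_power) (intro divide_left_mono power_mono mult_pos_pos, auto)
        then show "norm (F (Suc 0) (\<i> * of_real u / z) * (- (\<i> * of_real u / z^2))) \<le> K 1 * (u / r^2)"
          unfolding norm_mult using bound[OF rotated_ray_in_upper_half[of u z], of 1] ball[OF z] u K_nonneg
          by (intro mult_mono) auto
        show "norm (of_real u * F 0 (\<i> * of_real u / z)) \<le> u * K 0"
          unfolding norm_mult using bound[OF rotated_ray_in_upper_half[of u z], of 0] ball[OF z] u
          by (intro mult_mono) auto
      qed
      show "norm (exp (- (of_real u * z))) \<le> exp (- (u * r))"
        using ball[OF z] u by simp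
    qed (use u r K_nonneg in auto)
    then show "norm (?F' z u) \<le> (K 1 / r^2 + K 0) * (u * exp (- (u * r)))"
      by (simp add: algebra_simps)
  next
    show "?F' z0 \<in> borel_measurable lpos"
      by (intro borel_measurable_lpos continuous_intros continuous_ray z0) (use z0 in auto)
  qed (use r ball in \<open>auto intro!: integrable_integrand\<close>)
  then show "J 0 field_differentiable at z0 within {z. Re z > 0}"
    using field_differentiable_at_within field_differentiable_def by blast
qed

text \<open>At \<open>z = sqrt (n + 1)\<close> a rescaling turns \<open>J 0\<close> into a multiple
  of the Laplace transform of \<open>F 0 (\<i> v)\<close> at \<open>n + 1\<close>. Hence
  \<open>F 0\<close> vanishes on the imaginary half axis, and the identity theorem spreads this over
  the half plane.\<close>

lemma J_zero_imp_zero: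
  assumes J0: "\<And>x. x > 0 \<Longrightarrow> J 0 (of_real x) = 0" and z: "z \<in> upper_half"
  shows "F 0 z = 0"
proof -
  have hol: "F 0 holomorphic_on upper_half"
    using der[of _ 0] by (meson field_differentiable_at_within field_differentiable_def holomorphic_onI)
  have ray: "F 0 (\<i> * of_real v) = 0" if v: "v > 0" for v
  proof -
    \<comment> \<open>\<open>F 0\<close> is merely bounded, so \<open>exp (- v)\<close> is attached
      to obtain an integrable function; this shifts the nodes of the Laplace transform from
      \<open>n\<close> to \<open>n + 1\<close>.\<close>
    have "F 0 (\<i> * of_real v) * exp (- of_real v) = 0"
    proof (rule laplace_unique[OF _ _ _ v])
      show "continuous_on {0<..} (\<lambda>v. F 0 (\<i> * of_real v) * exp (- complex_of_real v))"
        using continuous_ray[of 1 0] by (intro continuous_intros) auto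
      show "integrable lpos (\<lambda>v. F 0 (\<i> * of_real v) * exp (- complex_of_real v))"
        using integrable_integrand[of 1 0] by simp
      fix n :: nat
      define x where "x = sqrt (real n + 1)"
      have x: "x > 0" "x * x = real n + 1" unfolding x_def by auto
      let ?g = "\<lambda>u. indicator {0<..} u *\<^sub>R (F 0 (\<i> * of_real u / of_real x) * exp (- (of_real u * of_real x)))"
      have "0 = (\<integral>u. ?g u \<partial>lborel)"
        using J0[OF x(1)] unfolding J_def by (subst (asm) integral_restrict_space) auto
      also have "\<dots> = \<bar>x\<bar> *\<^sub>R (\<integral>u. ?g (0 + x * u) \<partial>lborel)"
        by (rule lborel_integral_real_affine) (use x in simp)
      finally have "(\<integral>u. ?g (0 + x * u) \<partial>lborel) = 0" using x by simp
      moreover have "?g (0 + x * u) = indicator {0<..} u *\<^sub>R (exp (- (real n * u)) *\<^sub>R (F 0 (\<i> * of_real u) * exp (- complex_of_real u)))" for u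
      proof -
        have "complex_of_real (x * u) * of_real x = of_real (real n * u) + of_real u"
          using x(2) by (simp add: algebra_simps flip: of_real_mult of_real_add)
        then have e: "exp (- (complex_of_real (x * u) * of_real x)) = of_real (exp (- (real n * u))) * exp (- complex_of_real u)"
          by (simp add: exp_add[symmetric] exp_of_real[symmetric])
        have "\<i> * complex_of_real (x * u) / of_real x = \<i> * of_real u" using x by simp
        then show ?thesis using x(1) unfolding add_0 e
          by (simp add: indicator_def zero_less_mult_iff scaleR_conv_of_real)
      qed
      ultimately show "(\<integral>u. exp (- (real n * u)) *\<^sub>R (F 0 (\<i> * of_real u) * exp (- complex_of_real u)) \<partial>lpos) = 0"
        by (subst integral_restrict_space) auto
    qed
    then show ?thesis by simp
  qed
  show ?thesis
  proof (rule analytic_continuation[OF hol open_upper_half, of "{\<i> * of_real v |v. v > 0}" \<i>])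
    show "connected upper_half" by (rule convex_connected[OF convex_upper_half])
    show "{\<i> * complex_of_real v |v. v > 0} \<subseteq> upper_half" by (auto simp: upper_half_def)
    show "\<i> \<in> upper_half" by (simp add: upper_half_def)
    show "\<i> islimpt {\<i> * complex_of_real v |v. v > 0}"
      unfolding islimpt_sequential
    proof (intro exI[of _ "\<lambda>n. \<i> * of_real (1 + 1 / real (Suc n))"] conjI allI)
      fix n show "\<i> * of_real (1 + 1 / real (Suc n)) \<in> {\<i> * complex_of_real v |v. v > 0} - {\<i>}"
        by (auto simp: complex_eq_iff intro!: exI[of _ "1 + 1 / real (Suc n)"] add_pos_pos)
    next
      have "(\<lambda>n. 1 + 1 / real (Suc n)) \<longlonglongrightarrow> 1" by real_asymp
      from tendsto_mult[OF tendsto_const[of \<i>] tendsto_of_real[OF this, where 'a=complex]]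
      show "(\<lambda>n. \<i> * of_real (1 + 1 / real (Suc n))) \<longlonglongrightarrow> \<i>" by simp
    qed
  qed (use z ray in auto)
qed

end

text \<open>The bound for \<open>J\<close> degenerates at the imaginary axis, while the decay lemma
  needs a bound up to the axis. So \<open>J 0\<close> is shifted by \<open>d = x / 2\<close>; no
  decay is lost since \<open>norm z \<le> norm (z + d)\<close> in the right half plane, and the
  shifted function at \<open>d\<close> is \<open>J 0\<close> at \<open>x\<close>.\<close>

lemma flat_halfplane_zero:
  assumes fl: "flat_halfplane F (\<lambda>p. B * h ^ p * N p)" and B: "B > 0" and h: "h > 0"
    and N: "\<And>p. N p > 0" and mono: "incseq (quot N)"
    and div: "\<not> summable (\<lambda>p. 1 / sqrt (quot N p))" and z: "z \<in> upper_half"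
  shows "F 0 z = 0"
proof -
  interpret flat_halfplane F "\<lambda>p. B * h ^ p * N p" by (rule fl)
  have Nprod: "h ^ p * N p = N 0 * (\<Prod>j<p. h * quot N j)" for p
  proof (induction p)
    case (Suc p)
    have "N (Suc p) = N p * quot N p" using less_imp_neq[OF N[of p]] by (simp add: quot_def)
    then have "h ^ Suc p * N (Suc p) = (h ^ p * N p) * (h * quot N p)" by simp
    also have "\<dots> = N 0 * (\<Prod>j<p. h * quot N j) * (h * quot N p)" by (simp only: Suc)
    finally show ?case by (simp only: prod.lessThan_Suc mult.assoc)
  qed simp
  have "J 0 (of_real x) = 0" if x: "x > 0" for x
  proof -
    define d where "d = x / 2"
    have d: "d > 0" using x by (simp add: d_def)
    let ?I = "\<integral>u. exp (- (u * d)) \<partial>lpos"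
    have I0: "?I \<ge> 0" by (rule integral_nonneg_AE) simp
    have hol: "(\<lambda>z. J 0 (z + of_real d)) holomorphic_on {z. Re z > - d}"
      by (rule holomorphic_on_compose_gen[OF _ J_holomorphic, unfolded o_def]) (auto intro!: holomorphic_intros)
    define G where "G = (\<lambda>z. J 0 (z + of_real d))"
    have "G (of_real d) = 0"
    proof (rule halfplane_decay_imp_zero[where G=G and x=d and C="B * N 0 * ?I + 1" and \<rho>="\<lambda>j. h * quot N j"])
      show "G holomorphic_on {z. Re z > 0}"
        unfolding G_def by (rule holomorphic_on_subset[OF hol]) (use d in auto)
      show "continuous_on {z. Re z \<ge> 0} G"
        unfolding G_def by (rule continuous_on_subset[OF holomorphic_on_imp_continuous_on[OF hol]]) (use d in auto)
      show "0 < B * N 0 * ?I + 1" using B N[of 0] I0 by (simp add: add_nonneg_pos)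
      show pos: "h * quot N j > 0" for j using h N by (simp add: quot_def)
      show "incseq (\<lambda>j. h * quot N j)" using mono h by (simp add: incseq_def)
      have eq: "(\<lambda>j. 1 / sqrt (quot N j)) = (\<lambda>j. sqrt h * (1 / sqrt (h * quot N j)))"
        using h by (simp add: real_sqrt_mult)
      show "\<not> summable (\<lambda>j. 1 / sqrt (h * quot N j))"
      proof
        assume "summable (\<lambda>j. 1 / sqrt (h * quot N j))"
        from summable_mult[OF this, of "sqrt h"] show False using div unfolding eq by blast
      qed
      fix z :: complex and p assume z: "Re z \<ge> 0"
      have "(Re z)\<^sup>2 \<le> (Re z + d)\<^sup>2" by (rule power_mono) (use z d in auto)
      then have "norm z \<le> norm (z + of_real d)" by (simp add: cmod_def)
      then have "norm (J 0 (z + of_real d)) * norm z ^ (2 * p) \<le> norm (J 0 (z + of_real d)) * norm (z + of_real d) ^ (2 * p)"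
        by (intro mult_left_mono power_mono) auto
      also have "\<dots> = norm (J p (z + of_real d))" by (rule norm_J_power) (use z d in simp)
      also have "\<dots> \<le> B * h ^ p * N p * ?I" by (rule norm_J_le[OF d]) (use z in simp)
      also have "\<dots> = (B * N 0 * ?I) * (\<Prod>j<p. h * quot N j)" using Nprod[of p] by (simp add: mult_ac)
      also have "\<dots> \<le> (B * N 0 * ?I + 1) * (\<Prod>j<p. h * quot N j)"
        by (intro mult_right_mono prod_nonneg) (auto intro: less_imp_le[OF pos])
      finally show "norm (G z) * norm z ^ (2 * p) \<le> (B * N 0 * ?I + 1) * (\<Prod>j<p. h * quot N j)" unfolding G_def .
    qed (use d in auto)
    then show ?thesis by (simp add: d_def G_def)
  qed
  from J_zero_imp_zero[OF this z] show ?thesis .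
qed

section \<open>The Borel map and the moments\<close>

lemma weight_seq_pos: "weight_seq N \<Longrightarrow> N p > 0"
  by (simp add: weight_seq_def)

lemma weight_seq_incseq_quot:
  assumes "weight_seq N" shows "incseq (quot N)"
proof (rule incseq_SucI)
  fix p
  have "(N (Suc p))^2 \<le> N p * N (Suc (Suc p))"
    using assms unfolding weight_seq_def by (metis Suc_eq_plus1 diff_Suc_1 le_add2)
  then show "quot N p \<le> quot N (Suc p)"
    using weight_seq_pos[OF assms] by (simp add: quot_def field_simps power2_eq_square)
qed

lemma has_field_derivative_higher_deriv:
  assumes "f holomorphic_on S" "open S" "z \<in> S"
  shows "((deriv ^^ p) f has_field_derivative (deriv ^^ Suc p) f z) (at z)"
  using holomorphic_derivI[OF holomorphic_higher_deriv[OF assms(1,2)] assms(2,3)] by simp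

lemma at_zero_within_upper_half_nontrivial: "at 0 within upper_half \<noteq> bot"
proof -
  have "0 islimpt upper_half"
    unfolding islimpt_sequential
  proof (intro exI[of _ "\<lambda>n. \<i> * of_real (1 / real (Suc n))"] conjI allI)
    show "\<i> * of_real (1 / real (Suc n)) \<in> upper_half - {0}" for n
      by (auto simp: upper_half_def simp del: of_nat_Suc)
    have "(\<lambda>n. 1 / real (Suc n)) \<longlonglongrightarrow> 0" by real_asymp
    from tendsto_mult[OF tendsto_const[of \<i>] tendsto_of_real[OF this, where 'a=complex]]
    show "(\<lambda>n. \<i> * of_real (1 / real (Suc n))) \<longlonglongrightarrow> 0" by simp
  qed
  then show ?thesis by (simp add: trivial_limit_within)
qed

text \<open>The bound on the next derivative makes \<open>(deriv ^^ p) f\<close> Lipschitz on the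
  convex half plane, hence uniformly continuous, so it has a limit at the boundary point 0. Only
  this makes the \<open>Lim\<close> in \<open>Borel_map\<close> a genuine limit and not an arbitrary
  value.\<close>

lemma AH_tendsto_Borel_map:
  assumes "f \<in> AH N"
  shows "((deriv ^^ p) f \<longlongrightarrow> Borel_map f p) (at 0 within upper_half)"
proof -
  obtain h B where hol: "f holomorphic_on upper_half"
    and b: "\<And>p z. z \<in> upper_half \<Longrightarrow> norm ((deriv ^^ p) f z) \<le> B * h^p * N p"
    using assms unfolding AH_def by auto
  have "(B * h^Suc p * N (Suc p))-lipschitz_on upper_half ((deriv ^^ p) f)"
  proof (rule lipschitz_onI)
    show "dist ((deriv ^^ p) f x) ((deriv ^^ p) f y) \<le> B * h^Suc p * N (Suc p) * dist x y"
      if "x \<in> upper_half" "y \<in> upper_half" for x y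
      unfolding dist_norm
      by (rule field_differentiable_bound[OF convex_upper_half _ b[of _ "Suc p"] that])
        (auto intro: has_field_derivative_at_within has_field_derivative_higher_deriv[OF hol open_upper_half] simp del: funpow.simps)
    have "\<i> \<in> upper_half" by (simp add: upper_half_def)
    from b[OF this, of "Suc p"] show "0 \<le> B * h^Suc p * N (Suc p)" by (meson norm_ge_zero order_trans)
  qed
  then have "uniformly_continuous_on upper_half ((deriv ^^ p) f)"
    by (rule lipschitz_on_uniformly_continuous)
  moreover have "0 \<in> closure upper_half"
    using at_zero_within_upper_half_nontrivial by (simp add: trivial_limit_within closure_def)
  ultimately obtain l where l: "((deriv ^^ p) f \<longlongrightarrow> l) (at 0 within upper_half)"
    by (rule uniformly_continuous_on_extension_at_closure)
  then have "Borel_map f p = l"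
    unfolding Borel_map_def by (rule tendsto_Lim[OF at_zero_within_upper_half_nontrivial])
  then show ?thesis using l by simp
qed

lemma Borel_map_injective:
  assumes N: "weight_seq N" and div: "\<not> summable (\<lambda>p. 1 / sqrt (quot N p))"
    and f: "f \<in> AH N" and g: "g \<in> AH N" and eq: "Borel_map f = Borel_map g"
    and z: "z \<in> upper_half"
  shows "f z = g z"
proof -
  obtain h1 B1 where hf: "f holomorphic_on upper_half" and h1: "h1 > 0"
    and b1: "\<And>p z. z \<in> upper_half \<Longrightarrow> norm ((deriv ^^ p) f z) \<le> B1 * h1^p * N p"
    using f unfolding AH_def by auto
  obtain h2 B2 where hg: "g holomorphic_on upper_half" and h2: "h2 > 0"
    and b2: "\<And>p z. z \<in> upper_half \<Longrightarrow> norm ((deriv ^^ p) g z) \<le> B2 * h2^p * N p"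
    using g unfolding AH_def by auto
  let ?F = "\<lambda>p z. (deriv ^^ p) f z - (deriv ^^ p) g z"
  define h where "h = max h1 h2"
  have weaken: "B' * h'^p * N p \<le> \<bar>B'\<bar> * h^p * N p" if "0 < h'" "h' \<le> h" for B' h' p
    using that weight_seq_pos[OF N, of p] by (intro mult_right_mono mult_mono power_mono) auto
  \<comment> \<open>The difference obeys bounds of the same kind with the larger of the two
    \<open>h\<close>; the summand 1 keeps the constant strictly positive.\<close>
  have "flat_halfplane ?F (\<lambda>p. (\<bar>B1\<bar> + \<bar>B2\<bar> + 1) * h^p * N p)"
  proof
    show "(?F p has_field_derivative ?F (Suc p) z) (at z)" if "z \<in> upper_half" for p z
      by (intro DERIV_diff has_field_derivative_higher_deriv[OF _ open_upper_half that] hf hg)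
    show "(?F p \<longlongrightarrow> 0) (at 0 within upper_half)" for p
      using tendsto_diff[OF AH_tendsto_Borel_map[OF f, of p] AH_tendsto_Borel_map[OF g, of p]] eq by simp
    fix p z assume zu: "z \<in> upper_half"
    have "norm (?F p z) \<le> \<bar>B1\<bar> * h^p * N p + \<bar>B2\<bar> * h^p * N p"
      by (intro order_trans[OF norm_triangle_ineq4] add_mono order_trans[OF b1[OF zu] weaken] order_trans[OF b2[OF zu] weaken])
        (use h1 h2 in \<open>auto simp: h_def\<close>)
    also have "\<dots> \<le> (\<bar>B1\<bar> + \<bar>B2\<bar> + 1) * h^p * N p"
      using h1 weight_seq_pos[OF N, of p] by (simp add: h_def algebra_simps)
    finally show "norm (?F p z) \<le> (\<bar>B1\<bar> + \<bar>B2\<bar> + 1) * h^p * N p" .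
  qed
  from flat_halfplane_zero[OF this _ _ weight_seq_pos[OF N] weight_seq_incseq_quot[OF N] div z]
  have "?F 0 z = 0" using h1 by (auto simp: h_def)
  then show ?thesis by simp
qed

section \<open>Moments and the Fourier-Laplace transform\<close>

lemma norm_exp_diff_one_le:
  fixes w :: complex
  assumes "Re w \<le> 0"
  shows "norm (exp w - 1) \<le> norm w"
proof -
  have "norm (exp w - exp 0) \<le> 1 * norm (w - 0)"
    by (rule field_differentiable_bound[of "{z. Re z \<le> 0}" _ exp])
      (use assms in \<open>auto intro!: convex_halfspace_Re_le has_field_derivative_at_within[OF DERIV_exp]\<close>)
  then show ?thesis by simp
qed

text \<open>\<open>moments\<close> is defined by the gauge integral; absolute integrability
  identifies it with the Lebesgue integral, for which dominated convergence and Fubini are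
  used.\<close>

lemma moments_eq_lpos:
  assumes "integrable lpos (\<lambda>x. x ^ p *\<^sub>R \<phi> x)"
  shows "moments \<phi> p = (\<integral>x. x ^ p *\<^sub>R \<phi> x \<partial>lpos)"
proof -
  have "set_integrable lborel {0<..} (\<lambda>x. x ^ p *\<^sub>R \<phi> x)"
    using assms unfolding set_integrable_def by (subst (asm) integrable_restrict_space) auto
  from set_borel_integral_eq_integral(2)[OF this] show ?thesis
    unfolding moments_def set_lebesgue_integral_def by (subst integral_restrict_space) auto
qed

text \<open>The logarithm in \<open>Mtilde\<close> arises by splitting the half line at
  \<open>h * quot M p\<close> and \<open>h * quot M (p + 1)\<close> and using the bounds for the
  exponents \<open>p\<close>, \<open>p + 1\<close> and \<open>p + 2\<close> on the three pieces. The
  outer pieces contribute \<open>D\<close> each and the middle one, with integrand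
  \<open>D / x\<close>, contributes \<open>D * ln (m' / m)\<close>; the total is
  \<open>D * ln (exp 2 * m' / m)\<close>.\<close>

lemma CM_moment_bound:
  assumes M: "weight_seq M" and \<phi>: "\<phi> \<in> CM M"
  obtains B h where "h > 0" "\<And>p. integrable lpos (\<lambda>x. x ^ p *\<^sub>R \<phi> x)"
    "\<And>p. (\<integral>x. norm (x ^ p *\<^sub>R \<phi> x) \<partial>lpos) \<le> B * h ^ p * Mtilde M p"
proof -
  obtain h B where cont: "continuous_on {0<..} \<phi>" and h: "h > 0"
    and b: "\<And>p x. x > 0 \<Longrightarrow> x^p * norm (\<phi> x) \<le> B * h^p * M p"
    using \<phi> unfolding CM_def by auto
  have Mp: "M p > 0" for p by (rule weight_seq_pos[OF M])
  have B: "B \<ge> 0"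
  proof -
    have "0 \<le> B * M 0" using b[of 1 0] norm_ge_zero[of "\<phi> 1"] by (simp del: norm_ge_zero)
    then show ?thesis using Mp[of 0] by (simp add: zero_le_mult_iff)
  qed
  have meas: "(\<lambda>x. x ^ p *\<^sub>R \<phi> x) \<in> borel_measurable lpos" for p
    by (intro borel_measurable_lpos continuous_intros cont)
  have key: "(\<integral>\<^sup>+x. norm (x ^ p *\<^sub>R \<phi> x) \<partial>lpos) \<le> ennreal (B * h * h ^ p * Mtilde M p)" for p
  proof -
    define m where "m = quot M p"
    define m' where "m' = quot M (Suc p)"
    have m: "m > 0" "m' > 0" "m \<le> m'"
      using Mp incseqD[OF weight_seq_incseq_quot[OF M], of p "Suc p"] by (auto simp: m_def m'_def quot_def)
    \<comment> \<open>\<open>D\<close> is the bound for the exponent \<open>p + 1\<close>. In its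
      terms the other two bounds are \<open>D / a\<close> and \<open>D * b'\<close>, so the three
      majorants agree at the break points.\<close>
    define D where "D = B * h ^ Suc p * M (Suc p)"
    have D0: "D \<ge> 0" unfolding D_def using B h Mp[of "Suc p"] by simp
    define a where "a = h * m"
    define b' where "b' = h * m'"
    have ab: "a > 0" "a \<le> b'" "b' > 0" using m h by (auto simp: a_def b'_def)
    have A: "B * h^p * M p = D / a"
      using Mp[of p] Mp[of "Suc p"] h by (simp add: D_def a_def m_def quot_def)
    have E: "B * h^(Suc (Suc p)) * M (Suc (Suc p)) = D * b'"
      using Mp[of "Suc p"] h by (simp add: D_def b'_def m'_def quot_def)
    let ?g1 = "\<lambda>x. ennreal (D / a) * indicator {0..a} x"
    let ?g2 = "\<lambda>x. ennreal (D / x) * indicator {a..b'} x"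
    let ?g3 = "\<lambda>x. ennreal (D * b' / x^2) * indicator {b'..} x"
    have "(\<integral>\<^sup>+x. norm (x ^ p *\<^sub>R \<phi> x) \<partial>lpos) = (\<integral>\<^sup>+x. ennreal (norm (x ^ p *\<^sub>R \<phi> x)) * indicator {0<..} x \<partial>lborel)"
      by (rule nn_integral_restrict_space) simp
    also have "\<dots> \<le> (\<integral>\<^sup>+x. ?g1 x + (?g2 x + ?g3 x) \<partial>lborel)"
    proof (rule nn_integral_mono)
      fix x :: real
      show "ennreal (norm (x ^ p *\<^sub>R \<phi> x)) * indicator {0<..} x \<le> ?g1 x + (?g2 x + ?g3 x)"
      proof (cases "x > 0")
        case True
        have n: "norm (x ^ p *\<^sub>R \<phi> x) = x^p * norm (\<phi> x)" using True by simp
        consider "x \<le> a" | "a \<le> x" "x \<le> b'" | "b' \<le> x" by linarith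
        then show ?thesis
        proof cases
          case 1
          have "x^p * norm (\<phi> x) \<le> D / a" using b[OF True, of p] A by simp
          then have "ennreal (norm (x ^ p *\<^sub>R \<phi> x)) \<le> ennreal (D / a)" unfolding n by (rule ennreal_leI)
          then show ?thesis using True 1 by (auto simp: add_increasing2)
        next
          case 2
          have "x * (x^p * norm (\<phi> x)) \<le> D" using b[OF True, of "Suc p"] by (simp add: D_def mult_ac)
          then have "x^p * norm (\<phi> x) \<le> D / x" using True by (simp add: field_simps)
          then have "ennreal (norm (x ^ p *\<^sub>R \<phi> x)) \<le> ennreal (D / x)" unfolding n by (rule ennreal_leI)
          then show ?thesis using True 2 by (auto simp: add_increasing2 add_increasing)
        next
          case 3
          have "x^2 * (x^p * norm (\<phi> x)) \<le> D * b'" using b[OF True, of "Suc (Suc p)"] E by (simp add: power2_eq_square mult_ac)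
          then have "x^p * norm (\<phi> x) \<le> D * b' / x^2" using True by (simp add: field_simps)
          then have "ennreal (norm (x ^ p *\<^sub>R \<phi> x)) \<le> ennreal (D * b' / x^2)" unfolding n by (rule ennreal_leI)
          then show ?thesis using True 3 by (auto simp: add_increasing2 add_increasing)
        qed
      qed simp
    qed
    also have "\<dots> = (\<integral>\<^sup>+x. ?g1 x \<partial>lborel) + ((\<integral>\<^sup>+x. ?g2 x \<partial>lborel) + (\<integral>\<^sup>+x. ?g3 x \<partial>lborel))"
      by (subst nn_integral_add; simp)+
    also have "(\<integral>\<^sup>+x. ?g1 x \<partial>lborel) = ennreal (D / a) * ennreal a"
      using ab by (simp add: nn_integral_cmult)
    also have "\<dots> = ennreal D"
      using ab D0 by (subst ennreal_mult[symmetric]) auto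
    also have "(\<integral>\<^sup>+x. ?g2 x \<partial>lborel) = ennreal (D * ln b' - D * ln a)"
      by (rule nn_integral_FTC_Icc) (use ab D0 in \<open>auto intro!: derivative_eq_intros\<close>)
    also have "(\<integral>\<^sup>+x. ?g3 x \<partial>lborel) = ennreal (0 - (- (D * b' / b')))"
      by (rule nn_integral_FTC_atLeast)
        (use ab D0 in \<open>auto intro!: derivative_eq_intros simp: power2_eq_square\<close>, real_asymp)
    also have "0 - (- (D * b' / b')) = D" using ab by simp
    also have "ennreal D + (ennreal (D * ln b' - D * ln a) + ennreal D) = ennreal (D + (D * ln b' - D * ln a) + D)"
      using D0 ab by (subst ennreal_plus[symmetric] | simp add: mult_left_mono)+
    also have "D + (D * ln b' - D * ln a) + D = D * (2 + ln (m' / m))"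
      using m h by (simp add: a_def b'_def ln_mult ln_div algebra_simps)
    also have "2 + ln (m' / m) = ln (exp 2 * m' / m)"
      using m by (simp add: ln_mult ln_div)
    also have "D * ln (exp 2 * m' / m) = B * h * h ^ p * Mtilde M p"
      by (simp add: D_def Mtilde_def m_def m'_def)
    finally show ?thesis .
  qed
  have int: "integrable lpos (\<lambda>x. x ^ p *\<^sub>R \<phi> x)" for p
    by (rule integrableI_bounded[OF meas]) (rule le_less_trans[OF key], simp)
  show thesis
  proof (rule that[OF h int])
    fix p
    have "ennreal (\<integral>x. norm (x ^ p *\<^sub>R \<phi> x) \<partial>lpos) \<le> ennreal (B * h * h ^ p * Mtilde M p)"
      using key[of p] by (subst nn_integral_eq_integral[symmetric]) (auto intro!: integrable_norm int simp del: norm_scaleR)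
    moreover have "Mtilde M p \<ge> 0"
    proof -
      have q: "quot M p > 0" using Mp by (simp add: quot_def)
      have "1 * quot M p \<le> exp 2 * quot M (p + 1)"
        using incseqD[OF weight_seq_incseq_quot[OF M], of p "p + 1"] q by (intro mult_mono) auto
      then have "1 \<le> exp 2 * quot M (p + 1) / quot M p" using q by (simp add: le_divide_eq)
      then show ?thesis unfolding Mtilde_def using Mp[of "p + 1"] by (intro mult_nonneg_nonneg) (auto intro: ln_ge_zero)
    qed
    ultimately show "(\<integral>x. norm (x ^ p *\<^sub>R \<phi> x) \<partial>lpos) \<le> B * h * h ^ p * Mtilde M p"
      using B h by (subst (asm) ennreal_le_iff) auto
  qed
qed

lemma CM_integrable:
  assumes "weight_seq M" and "\<phi> \<in> CM M"
  shows "integrable lpos (\<lambda>x. x ^ p *\<^sub>R \<phi> x)"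
proof -
  obtain B h where "h > 0" and int: "\<And>p. integrable lpos (\<lambda>x. x ^ p *\<^sub>R \<phi> x)"
    and "\<And>p. (\<integral>x. norm (x ^ p *\<^sub>R \<phi> x) \<partial>lpos) \<le> B * h ^ p * Mtilde M p"
    by (rule CM_moment_bound[OF assms], rule that)
  show ?thesis by (rule int)
qed

text \<open>The \<open>p\<close>-th derivative of the Fourier-Laplace transform of \<phi>, given by
  an integral of its own so that it is also available at the boundary point 0.\<close>

definition FT :: "(real \<Rightarrow> complex) \<Rightarrow> nat \<Rightarrow> complex \<Rightarrow> complex" where
  "FT \<phi> p z = (\<integral>x. (\<i> * of_real x) ^ p * \<phi> x * exp (\<i> * z * of_real x) \<partial>lpos)"

lemma norm_exp_upper_half:
  assumes "Im z \<ge> 0" "x \<ge> 0" shows "norm (exp (\<i> * z * of_real x)) \<le> 1"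
  using assms by simp

text \<open>In the closed upper half plane the exponential has modulus at most 1, so the absolute
  moments majorise everything: the moment of order \<open>p\<close> the integrand itself, the moment
  of order \<open>p + 1\<close> its derivative and, by \<open>norm (exp w - 1) \<le> norm w\<close>,
  its increment from the boundary point 0.\<close>

lemma FT_properties:
  assumes cont: "continuous_on {0<..} \<phi>" and int: "\<And>p. integrable lpos (\<lambda>x. x ^ p *\<^sub>R \<phi> x)"
  shows integrable_FT: "Im z \<ge> 0 \<Longrightarrow> integrable lpos (\<lambda>x. (\<i> * of_real x) ^ p * \<phi> x * exp (\<i> * z * of_real x))"
    and norm_FT_le: "Im z \<ge> 0 \<Longrightarrow> norm (FT \<phi> p z) \<le> (\<integral>x. norm (x ^ p *\<^sub>R \<phi> x) \<partial>lpos)"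
    and FT_has_derivative: "z \<in> upper_half \<Longrightarrow> (FT \<phi> p has_field_derivative FT \<phi> (Suc p) z) (at z)"
    and FT_zero: "FT \<phi> p 0 = \<i> ^ p * moments \<phi> p"
    and FT_tendsto: "(FT \<phi> p \<longlongrightarrow> FT \<phi> p 0) (at 0 within upper_half)"
proof -
  have n: "norm ((\<i> * of_real x) ^ p * \<phi> x * exp (\<i> * z * of_real x)) \<le> norm (x ^ p *\<^sub>R \<phi> x)"
    if "x \<in> space lpos" "Im z \<ge> 0" for x p z
    using mult_left_mono[OF norm_exp_upper_half[of z x], of "norm (x ^ p *\<^sub>R \<phi> x)"] that
    by (simp add: norm_mult norm_power)
  have meas: "(\<lambda>x. (\<i> * of_real x) ^ p * \<phi> x * exp (\<i> * z * of_real x)) \<in> borel_measurable lpos" for p z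
    by (intro borel_measurable_lpos continuous_intros cont)
  show I: "Im z \<ge> 0 \<Longrightarrow> integrable lpos (\<lambda>x. (\<i> * of_real x) ^ p * \<phi> x * exp (\<i> * z * of_real x))" for p z
    by (rule Bochner_Integration.integrable_bound[OF int[of p] meas]) (intro AE_I2 n)
  show "Im z \<ge> 0 \<Longrightarrow> norm (FT \<phi> p z) \<le> (\<integral>x. norm (x ^ p *\<^sub>R \<phi> x) \<partial>lpos)" for p z
    unfolding FT_def
    by (rule order_trans[OF integral_norm_bound integral_mono[OF integrable_norm[OF I] integrable_norm[OF int[of p]] n]])
  show "z \<in> upper_half \<Longrightarrow> (FT \<phi> p has_field_derivative FT \<phi> (Suc p) z) (at z)" for p z
    unfolding FT_def
  proof (rule has_field_derivative_lebesgue_integral[OF open_upper_half convex_upper_half,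
        where g="\<lambda>x. norm (x ^ Suc p *\<^sub>R \<phi> x)"])
    show "((\<lambda>z. (\<i> * of_real x) ^ p * \<phi> x * exp (\<i> * z * of_real x)) has_field_derivative
        (\<i> * of_real x) ^ Suc p * \<phi> x * exp (\<i> * z * of_real x)) (at z)" for x z
      by (rule derivative_eq_intros refl)+ simp
  qed (auto intro!: integrable_norm int I n meas simp: upper_half_def simp del: norm_scaleR power_Suc)
  show "FT \<phi> p 0 = \<i> ^ p * moments \<phi> p"
    unfolding FT_def moments_eq_lpos[OF int] by (simp add: power_mult_distrib scaleR_conv_of_real mult.assoc)
  let ?C = "\<integral>x. norm (x ^ Suc p *\<^sub>R \<phi> x) \<partial>lpos"
  show "(FT \<phi> p \<longlongrightarrow> FT \<phi> p 0) (at 0 within upper_half)"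
  proof (rule Lim_null_comparison[THEN LIM_zero_cancel])
    show "((\<lambda>z. norm z * ?C) \<longlongrightarrow> 0) (at 0 within upper_half)"
      by (rule tendsto_eq_intros refl)+ simp
    have "norm (FT \<phi> p z - FT \<phi> p 0) \<le> norm z * ?C" if "z \<in> upper_half" for z
    proof -
      have z: "Im z \<ge> 0" using that by (simp add: upper_half_def)
      let ?d = "\<lambda>x. (\<i> * of_real x) ^ p * \<phi> x * exp (\<i> * z * of_real x) - (\<i> * of_real x) ^ p * \<phi> x * exp (\<i> * 0 * of_real x)"
      have d: "norm (?d x) \<le> norm z * norm (x ^ Suc p *\<^sub>R \<phi> x)" if x: "x \<in> space lpos" for x
      proof -
        have "norm (?d x) = norm (x ^ p *\<^sub>R \<phi> x) * norm (exp (\<i> * z * of_real x) - 1)"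
        proof -
          have "?d x = (\<i> * of_real x) ^ p * \<phi> x * (exp (\<i> * z * of_real x) - 1)" by (simp add: algebra_simps)
          then show ?thesis by (simp only: norm_mult norm_power norm_scaleR) (simp add: power_abs)
        qed
        also have "\<dots> \<le> norm (x ^ p *\<^sub>R \<phi> x) * norm (\<i> * z * of_real x)"
          by (intro mult_left_mono norm_exp_diff_one_le) (use z x in \<open>auto intro: mult_nonneg_nonneg\<close>)
        finally show ?thesis using x by (simp add: norm_mult mult_ac)
      qed
      have "norm (FT \<phi> p z - FT \<phi> p 0) = norm (\<integral>x. ?d x \<partial>lpos)"
        unfolding FT_def by (subst Bochner_Integration.integral_diff[OF I I]) (use z in auto)
      also have "\<dots> \<le> (\<integral>x. norm z * norm (x ^ Suc p *\<^sub>R \<phi> x) \<partial>lpos)"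
      proof (rule order_trans[OF integral_norm_bound integral_mono[OF _ _ d]])
        show "integrable lpos (\<lambda>x. norm (?d x))"
          by (intro integrable_norm Bochner_Integration.integrable_diff I) (use z in auto)
      qed (intro integrable_mult_right integrable_norm int)
      finally show ?thesis by simp
    qed
    then show "\<forall>\<^sub>F z in at 0 within upper_half. norm (FT \<phi> p z - FT \<phi> p 0) \<le> norm z * ?C"
      by (auto simp: eventually_at_filter)
  qed
qed

lemma higher_deriv_FT:
  assumes cont: "continuous_on {0<..} \<phi>" and int: "\<And>p. integrable lpos (\<lambda>x. x ^ p *\<^sub>R \<phi> x)"
    and z: "z \<in> upper_half"
  shows "(deriv ^^ p) (FT \<phi> 0) z = FT \<phi> p z"
  using z
proof (induction p arbitrary: z)
  case (Suc p)
  have "deriv ((deriv ^^ p) (FT \<phi> 0)) z = deriv (FT \<phi> p) z"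
    by (rule deriv_cong_ev[OF _ refl]) (use eventually_nhds_in_open[OF open_upper_half Suc.prems] Suc.IH in \<open>auto elim: eventually_mono\<close>)
  then show ?case using DERIV_imp_deriv[OF FT_has_derivative[OF cont int Suc.prems]] by simp
qed simp

lemma FT_in_AH:
  assumes M: "weight_seq M" and \<phi>: "\<phi> \<in> CM M"
  shows "FT \<phi> 0 \<in> AH (Mtilde M)" and "Borel_map (FT \<phi> 0) p = \<i> ^ p * moments \<phi> p"
proof -
  obtain B h where h: "h > 0" and int: "\<And>p. integrable lpos (\<lambda>x. x ^ p *\<^sub>R \<phi> x)"
    and b: "\<And>p. (\<integral>x. norm (x ^ p *\<^sub>R \<phi> x) \<partial>lpos) \<le> B * h ^ p * Mtilde M p"
    by (rule CM_moment_bound[OF assms], rule that)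
  have cont: "continuous_on {0<..} \<phi>" using \<phi> by (simp add: CM_def)
  note hd = higher_deriv_FT[OF cont int]
  have "norm ((deriv ^^ p) (FT \<phi> 0) z) \<le> B * h ^ p * Mtilde M p" if "z \<in> upper_half" for p z
    using norm_FT_le[OF cont int, of z p] b[of p] that unfolding hd[OF that] by (simp add: upper_half_def)
  moreover have "FT \<phi> 0 holomorphic_on upper_half"
    by (rule holomorphic_onI)
      (unfold field_differentiable_def, rule exI, rule has_field_derivative_at_within, rule FT_has_derivative[OF cont int])
  ultimately show "FT \<phi> 0 \<in> AH (Mtilde M)" unfolding AH_def using h by blast
  have "((deriv ^^ p) (FT \<phi> 0) \<longlongrightarrow> FT \<phi> p 0) (at 0 within upper_half)"
    by (rule Lim_transform_within[OF FT_tendsto[OF cont int, of p], of 1]) (auto simp: hd)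
  then show "Borel_map (FT \<phi> 0) p = \<i> ^ p * moments \<phi> p"
    unfolding Borel_map_def FT_zero[OF cont int, symmetric]
    by (rule tendsto_Lim[OF at_zero_within_upper_half_nontrivial])
qed

text \<open>Equal moments give the two Fourier-Laplace transforms equal derivatives at 0, so the
  transforms coincide. Their values at \<open>\<i> n\<close> are the Laplace transforms at
  \<open>n\<close>, which determine \<phi> and \<psi>.\<close>

lemma moments_injective_if_Borel_injective:
  assumes M: "weight_seq M"
    and inj: "\<forall>f\<in>AH (Mtilde M). \<forall>g\<in>AH (Mtilde M). Borel_map f = Borel_map g \<longrightarrow> (\<forall>z\<in>upper_half. f z = g z)"
    and \<phi>: "\<phi> \<in> CM M" and \<psi>: "\<psi> \<in> CM M" and eq: "moments \<phi> = moments \<psi>" and x: "x > 0"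
  shows "\<phi> x = \<psi> x"
proof -
  have "Borel_map (FT \<phi> 0) = Borel_map (FT \<psi> 0)"
    using FT_in_AH(2)[OF M \<phi>] FT_in_AH(2)[OF M \<psi>] eq by auto
  then have FTeq: "FT \<phi> 0 z = FT \<psi> 0 z" if "z \<in> upper_half" for z
    using inj FT_in_AH(1)[OF M \<phi>] FT_in_AH(1)[OF M \<psi>] that by blast
  have c1: "continuous_on {0<..} \<phi>" and c2: "continuous_on {0<..} \<psi>" using \<phi> \<psi> by (auto simp: CM_def)
  have i1: "\<And>p. integrable lpos (\<lambda>x. x ^ p *\<^sub>R \<phi> x)" by (rule CM_integrable[OF M \<phi>])
  have i2: "\<And>p. integrable lpos (\<lambda>x. x ^ p *\<^sub>R \<psi> x)" by (rule CM_integrable[OF M \<psi>])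
  have "\<phi> x - \<psi> x = 0"
  proof (rule laplace_unique[OF _ _ _ x])
    show "continuous_on {0<..} (\<lambda>x. \<phi> x - \<psi> x)" by (intro continuous_intros c1 c2)
    show "integrable lpos (\<lambda>x. \<phi> x - \<psi> x)"
      using Bochner_Integration.integrable_diff[OF i1[of 0] i2[of 0]] by simp
    fix n :: nat assume n: "n \<ge> 1"
    let ?z = "\<i> * of_nat n"
    have z: "?z \<in> upper_half" "Im ?z \<ge> 0" using n by (auto simp: upper_half_def)
    have e: "exp (- (real n * x)) *\<^sub>R (\<phi> x - \<psi> x) =
        (\<i> * of_real x) ^ 0 * \<phi> x * exp (\<i> * ?z * of_real x) - (\<i> * of_real x) ^ 0 * \<psi> x * exp (\<i> * ?z * of_real x)" for x
    proof -
      have "\<i> * ?z * of_real x = of_real (- (real n * x))" by (simp add: complex_eq_iff)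
      then have "exp (\<i> * ?z * of_real x) = of_real (exp (- (real n * x)))" by (simp only: exp_of_real)
      then show ?thesis by (simp only: scaleR_conv_of_real) (simp add: algebra_simps)
    qed
    show "(\<integral>x. exp (- (real n * x)) *\<^sub>R (\<phi> x - \<psi> x) \<partial>lpos) = 0"
      unfolding e Bochner_Integration.integral_diff[OF integrable_FT[OF c1 i1 z(2)] integrable_FT[OF c2 i2 z(2)]]
      using FTeq[OF z(1)] by (simp add: FT_def)
  qed
  then show ?thesis by simp
qed

section \<open>Entire functions of exponential type with prescribed decay\<close>

text \<open>This is the integral of \<open>exp (s w)\<close> over \<open>s\<close> between 0 and 1,
  so on the imaginary axis it is the Fourier transform of a uniform density. The value at 0 fills
  the removable singularity.\<close>

definition expm1_div :: "complex \<Rightarrow> complex" where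
  "expm1_div w = (if w = 0 then 1 else (exp w - 1) / w)"

text \<open>The three estimates serve to bound an infinite product, to make it decay and to make it
  converge. For the third, \<open>exp z - z\<close> is compared with its value at 0 on a half disc
  of radius \<open>norm w\<close>, where its derivative \<open>exp z - 1\<close> is at most
  \<open>norm w\<close> in modulus.\<close>

lemma norm_expm1_div_le:
  assumes "Re w \<le> 0"
  shows "norm (expm1_div w) \<le> 1" and "norm w * norm (expm1_div w) \<le> 2" and "norm (expm1_div w - 1) \<le> norm w"
proof -
  show "norm (expm1_div w) \<le> 1"
    using norm_exp_diff_one_le[OF assms] by (simp add: expm1_div_def norm_divide divide_le_eq)
  have "norm (exp w - 1) \<le> norm (exp w) + norm (1::complex)" by (rule norm_triangle_ineq4)
  also have "\<dots> \<le> 2" using assms by simp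
  finally show "norm w * norm (expm1_div w) \<le> 2" by (simp add: expm1_div_def norm_divide)
  let ?S = "{z. Re z \<le> 0} \<inter> cball 0 (norm w)"
  have "norm ((exp w - w) - (exp 0 - 0)) \<le> norm w * norm (w - 0)"
  proof (rule field_differentiable_bound[of ?S _ "\<lambda>z. exp z - 1"])
    show "convex ?S" by (intro convex_Int convex_halfspace_Re_le convex_cball)
    show "((\<lambda>a. exp a - a) has_field_derivative exp z - 1) (at z within ?S)" for z
      by (auto intro!: derivative_eq_intros)
    show "norm (exp z - 1) \<le> norm w" if "z \<in> ?S" for z
      using norm_exp_diff_one_le[of z] that by auto
  qed (use assms in auto)
  then have "norm (exp w - 1 - w) \<le> norm w * norm w" by (simp add: algebra_simps)
  then show "norm (expm1_div w - 1) \<le> norm w"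
  proof (cases "w = 0")
    case False
    then have "expm1_div w - 1 = (exp w - 1 - w) / w" by (simp add: expm1_div_def diff_divide_distrib)
    then show ?thesis using False \<open>norm (exp w - 1 - w) \<le> norm w * norm w\<close>
      by (simp add: norm_divide divide_le_eq)
  qed (simp add: expm1_div_def)
qed

text \<open>For nonzero \<open>t\<close>, \<open>expm1_div (\<i> t)\<close> is
  \<open>exp (\<i> t / 2)\<close> times the real number \<open>sin (t / 2) / (t / 2)\<close>, which
  changes sign. Squaring removes the sign, and the phase becomes exactly
  \<open>exp (\<i> t)\<close>.\<close>

lemma expm1_div_imaginary_sq:
  "expm1_div (\<i> * of_real t) ^ 2 = exp (\<i> * of_real t) * of_real (norm (expm1_div (\<i> * of_real t)) ^ 2)"
proof (cases "t = 0")
  case False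
  define u where "u = exp (\<i> * of_real t)"
  have uu: "u * cnj u = 1" unfolding complex_norm_square[symmetric] u_def by simp
  have e: "expm1_div (\<i> * of_real t) = (u - 1) / (\<i> * of_real t)" using False by (simp add: expm1_div_def u_def)
  have "u * ((u - 1) * (cnj u - 1)) = u * (u * cnj u) - u * u - u * cnj u + u" by (simp add: algebra_simps)
  also have "\<dots> = - ((u - 1)^2)" unfolding uu by (simp add: power2_eq_square algebra_simps)
  finally have *: "u * ((u - 1) * (cnj u - 1)) = - ((u - 1)^2)" .
  have "of_real (norm (expm1_div (\<i> * of_real t)) ^ 2) = ((u - 1) * (cnj u - 1)) / of_real (t^2)"
  proof -
    have "norm (expm1_div (\<i> * of_real t)) ^ 2 = norm (u - 1) ^ 2 / t^2"
      unfolding e by (simp add: norm_divide norm_mult power_divide)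
    then show ?thesis by (simp only: of_real_divide complex_norm_square[of "u - 1"]) simp
  qed
  then have "u * of_real (norm (expm1_div (\<i> * of_real t)) ^ 2) = - ((u - 1)^2) / of_real (t^2)"
    by (simp only: times_divide_eq_right *)
  also have "\<dots> = expm1_div (\<i> * of_real t) ^ 2"
    unfolding e by (simp add: power_divide power_mult_distrib)
  finally show ?thesis by (simp add: u_def)
qed (simp add: expm1_div_def)

text \<open>Cauchy's theorem on half discs: the arc of length \<open>R * pi\<close> contributes at
  most \<open>C / (1 + R^2) * R * pi\<close>, which tends to 0. The version for convex sets asks for
  continuity up to the boundary only, so the diameter may lie on the real axis.\<close>

lemma integral_eq_0_of_upper_half_decay:
  fixes F :: "complex \<Rightarrow> complex"
  assumes cont: "continuous_on {z. Im z \<ge> 0} F" and hol: "F holomorphic_on {z. Im z > 0}"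
    and b: "\<And>z. Im z \<ge> 0 \<Longrightarrow> norm (F z) \<le> C / (1 + norm z ^ 2)"
  shows "integrable lborel (\<lambda>t. F (of_real t))" and "(\<integral>t. F (of_real t) \<partial>lborel) = 0"
proof -
  have contr: "continuous_on S (\<lambda>t. F (of_real t))" for S :: "real set"
    by (rule continuous_on_compose2[OF cont]) (auto intro!: continuous_intros)
  have C0: "C \<ge> 0" using b[of 0] norm_ge_zero[of "F 0"] by (simp del: norm_ge_zero)
  show int: "integrable lborel (\<lambda>t. F (of_real t))"
  proof (rule Bochner_Integration.integrable_bound[OF integrable_mult_right[OF integrable_inverse_1_plus_square, of C]])
    show "(\<lambda>t. F (of_real t)) \<in> borel_measurable lborel"
      using borel_measurable_continuous_onI[OF contr] by simp
    show "AE t in lborel. norm (F (complex_of_real t)) \<le> norm (C * (1 / (1 + t^2)))"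
      by (rule AE_I2, rule order_trans[OF b]) (use C0 in auto)
  qed
  have bound: "norm (integral {-R..R} (\<lambda>t. F (of_real t))) \<le> C / (1 + R^2) * R * pi" if R: "R > 0" for R
  proof -
    let ?l = "linepath (- of_real R) (of_real R) :: real \<Rightarrow> complex"
    let ?c = "part_circlepath 0 R 0 pi"
    have pl: "path_image ?l \<subseteq> {z. Im z \<ge> 0}" 
      by (auto simp: closed_segment_def)
    have pc: "path_image ?c \<subseteq> {z. Im z \<ge> 0}"
      using R by (auto simp: path_image_part_circlepath' closed_segment_eq_real_ivl intro!: mult_nonneg_nonneg sin_ge_zero)
    have "(F has_contour_integral 0) (?l +++ ?c)"
    proof (rule Cauchy_theorem_convex[OF cont convex_halfspace_Im_ge, of "{}"])
      show "F field_differentiable at x" if "x \<in> interior {z. Im z \<ge> 0} - {}" for x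
      proof -
        have "interior {z. Im z \<ge> 0} = {z. Im z > 0}" 
          using interior_halfspace_ge[of \<i> 0] by (simp add: inner_complex_def)
        then show ?thesis using that holomorphic_on_imp_differentiable_at[OF hol open_halfspace_Im_gt] by auto
      qed
    qed (use pl pc in \<open>auto simp: path_image_join\<close>)
    moreover have il: "F contour_integrable_on ?l"
      by (rule contour_integrable_continuous_linepath) (use pl in \<open>auto intro: continuous_on_subset[OF cont]\<close>)
    moreover have ic: "F contour_integrable_on ?c"
      by (rule contour_integrable_continuous_part_circlepath) (use pc in \<open>auto intro: continuous_on_subset[OF cont]\<close>)
    ultimately have sum0: "contour_integral ?l F + contour_integral ?c F = 0"
      by (subst contour_integral_join[symmetric]) (auto dest: contour_integral_unique)
    have "contour_integral ?l F = integral {-R..R} (\<lambda>t. F (of_real t))"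
      using contour_integral_linepath_Reals_eq[of "- of_real R" "of_real R" F] R by simp
    moreover have "norm (contour_integral ?c F) \<le> C / (1 + R^2) * R * (pi - 0)"
    proof (rule has_contour_integral_bound_part_circlepath[OF has_contour_integral_integral[OF ic]])
      show "norm (F x) \<le> C / (1 + R^2)" if x: "x \<in> path_image ?c" for x
      proof -
        have "norm x = R" using x R in_path_image_part_circlepath[OF x] by simp
        then show ?thesis using b[of x] x pc by auto
      qed
    qed (use R C0 in auto)
    ultimately show ?thesis using sum0 by (simp add: eq_neg_iff_add_eq_0[symmetric])
  qed
  have "(\<lambda>n. integral {- real n..real n} (\<lambda>t. F (of_real t))) \<longlonglongrightarrow> (\<integral>t. F (of_real t) \<partial>lborel)"
  proof -
    have e: "integral {- real n..real n} (\<lambda>t. F (of_real t)) = (\<integral>t. indicator {- real n..real n} t *\<^sub>R F (of_real t) \<partial>lborel)" for n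
      using set_borel_integral_eq_integral(2)[of "{- real n..real n}" "\<lambda>t. F (of_real t)"] integrable_mult_indicator[OF _ int]
      unfolding set_integrable_def set_lebesgue_integral_def by simp
    show ?thesis unfolding e
    proof (rule integral_dominated_convergence[OF _ _ integrable_norm[OF int]])
      show "AE t in lborel. (\<lambda>n. indicator {- real n..real n} t *\<^sub>R F (of_real t)) \<longlonglongrightarrow> F (of_real t)"
      proof (rule AE_I2, rule tendsto_eventually)
        fix t :: real
        obtain n0 where "\<bar>t\<bar> \<le> real n0" using real_arch_simple by blast
        then show "\<forall>\<^sub>F n in sequentially. indicator {- real n..real n} t *\<^sub>R F (of_real t) = F (of_real t)"
          by (intro eventually_sequentiallyI[of n0]) (auto simp: indicator_def)
      qed
    qed (use int in \<open>auto intro!: AE_I2 simp: indicator_def\<close>)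
  qed
  moreover have "(\<lambda>n. integral {- real n..real n} (\<lambda>t. F (of_real t))) \<longlonglongrightarrow> 0"
  proof (rule Lim_null_comparison)
    show "\<forall>\<^sub>F n in sequentially. norm (integral {- real n..real n} (\<lambda>t. F (of_real t))) \<le> C / (1 + (real n)^2) * real n * pi"
      using eventually_gt_at_top[of 0] by eventually_elim (rule bound, simp)
    show "(\<lambda>n. C / (1 + (real n)^2) * real n * pi) \<longlonglongrightarrow> 0" by real_asymp
  qed
  ultimately show "(\<integral>t. F (of_real t) \<partial>lborel) = 0" by (rule LIMSEQ_unique)
qed

section \<open>Infinite product kernels on the upper half plane\<close>

locale kernel =
  fixes c :: "nat \<Rightarrow> real"
  assumes pos: "\<And>j. c j > 0" and summable: "summable c" and c0: "c 0 = 1"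
begin

text \<open>Two copies of each factor are taken: on the real line their product is an explicit phase
  times a nonnegative number, and each copy can contribute one power of decay.\<close>

definition partial :: "nat \<Rightarrow> complex \<Rightarrow> complex" where
  "partial n z = (\<Prod>j<n. expm1_div (\<i> * of_real (c j) * z) ^ 2)"

definition K :: "complex \<Rightarrow> complex" where
  "K z = lim (\<lambda>n. partial n z)"

lemma Re_le: "Im z \<ge> 0 \<Longrightarrow> Re (\<i> * of_real (c j) * z) \<le> 0"
  using pos[of j] by simp

lemma norm_factor_le: "Im z \<ge> 0 \<Longrightarrow> norm (expm1_div (\<i> * of_real (c j) * z)) \<le> 1"
  by (rule norm_expm1_div_le(1)[OF Re_le])

lemma norm_partial_le:
  assumes z: "Im z \<ge> 0" and "m \<le> n"
  shows "norm (partial n z) \<le> (\<Prod>j<m. norm (expm1_div (\<i> * of_real (c j) * z)) ^ 2)"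
proof -
  have "norm (partial n z) = (\<Prod>j<n. norm (expm1_div (\<i> * of_real (c j) * z)) ^ 2)"
    by (simp add: partial_def prod_norm[symmetric] norm_power)
  also have "\<dots> = (\<Prod>j\<in>{..<m} \<union> {m..<n}. norm (expm1_div (\<i> * of_real (c j) * z)) ^ 2)"
    by (rule prod.cong) (use assms in auto)
  also have "\<dots> = (\<Prod>j<m. norm (expm1_div (\<i> * of_real (c j) * z)) ^ 2) * (\<Prod>j\<in>{m..<n}. norm (expm1_div (\<i> * of_real (c j) * z)) ^ 2)"
    by (rule prod.union_disjoint) auto
  also have "\<dots> \<le> (\<Prod>j<m. norm (expm1_div (\<i> * of_real (c j) * z)) ^ 2) * 1"
    by (intro mult_left_mono prod_le_1 prod_nonneg) (auto intro!: power_le_one norm_factor_le[OF z])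
  finally show ?thesis by simp
qed

text \<open>The telescoping series of successive differences passes the Weierstrass test on bounded
  pieces: each difference contains \<open>e^2 - 1 = (e + 1) (e - 1)\<close>, where the first factor
  is at most 2 and the second at most \<open>c n * norm z\<close> in modulus.\<close>

lemma uniform_limit_partial:
  "uniform_limit ({z. Im z \<ge> 0} \<inter> cball 0 R) partial K sequentially"
proof -
  let ?S = "{z. Im z \<ge> 0} \<inter> cball 0 R"
  have "uniformly_convergent_on ?S (\<lambda>n z. \<Sum>i<n. partial (Suc i) z - partial i z)"
  proof (rule Weierstrass_m_test')
    show "norm (partial (Suc n) z - partial n z) \<le> 2 * \<bar>R\<bar> * c n" if "z \<in> ?S" for n z
    proof -
      let ?e = "expm1_div (\<i> * of_real (c n) * z)"
      have z: "Im z \<ge> 0" "norm z \<le> \<bar>R\<bar>" using that by auto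
      have "partial (Suc n) z - partial n z = partial n z * ((?e + 1) * (?e - 1))"
        by (simp add: partial_def power2_eq_square algebra_simps)
      also have "norm \<dots> \<le> 1 * ((1 + 1) * norm (\<i> * of_real (c n) * z))"
        unfolding norm_mult[of "partial n z"] norm_mult[of "?e + 1"]
        by (intro mult_mono norm_triangle_mono norm_factor_le norm_expm1_div_le(3) Re_le z)
          (use norm_partial_le[OF z(1), of 0 n] in auto)
      also have "\<dots> \<le> 2 * \<bar>R\<bar> * c n"
        using z(2) pos[of n] by (simp add: norm_mult mult.commute)
      finally show ?thesis .
    qed
    show "summable (\<lambda>n. 2 * \<bar>R\<bar> * c n)" by (rule summable_mult[OF summable])
  qed
  then obtain l where l: "uniform_limit ?S (\<lambda>n z. \<Sum>i<n. partial (Suc i) z - partial i z) l sequentially"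
    unfolding uniformly_convergent_on_def by blast
  have "uniform_limit ?S (\<lambda>n z. 1 + (\<Sum>i<n. partial (Suc i) z - partial i z)) (\<lambda>z. 1 + l z) sequentially"
    by (rule uniform_limit_add[OF uniform_limit_const l])
  moreover have "1 + (\<Sum>i<n. partial (Suc i) z - partial i z) = partial n z" for n z
    by (induction n) (simp add: partial_def, simp add: algebra_simps)
  ultimately have "uniform_limit ?S partial (\<lambda>z. 1 + l z) sequentially" by simp
  then have "uniformly_convergent_on ?S partial" unfolding uniformly_convergent_on_def by blast
  then show ?thesis unfolding uniformly_convergent_uniform_limit_iff K_def .
qed

lemma partial_tendsto: "Im z \<ge> 0 \<Longrightarrow> (\<lambda>n. partial n z) \<longlonglongrightarrow> K z"
  by (rule tendsto_uniform_limitI[OF uniform_limit_partial[of "norm z"]]) simp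

lemma continuous_on_factor: "continuous_on {z. Im z \<ge> 0} (\<lambda>z. expm1_div (\<i> * of_real (c j) * z))"
proof -
  have "continuous_on {w. Re w \<le> 0} expm1_div"
    unfolding continuous_on_eq_continuous_within
  proof
    fix w assume w: "w \<in> {w. Re w \<le> 0}"
    show "continuous (at w within {w. Re w \<le> 0}) expm1_div"
    proof (cases "w = 0")
      case True
      have "((\<lambda>v. expm1_div v) \<longlongrightarrow> 1) (at 0 within {w. Re w \<le> 0})"
      proof (rule Lim_null_comparison[THEN LIM_zero_cancel])
        show "\<forall>\<^sub>F v in at 0 within {w. Re w \<le> 0}. norm (expm1_div v - 1) \<le> norm v"
          by (auto simp: eventually_at_filter norm_expm1_div_le(3))
        show "(norm \<longlongrightarrow> 0) (at (0::complex) within {w. Re w \<le> 0})"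
          by (rule tendsto_eq_intros refl)+ simp
      qed
      moreover have "expm1_div 0 = 1" by (simp add: expm1_div_def)
      ultimately show ?thesis using True by (simp only: continuous_within)
    next
      case False
      have "continuous_on (- {0}) expm1_div"
        by (rule continuous_on_eq[of _ "\<lambda>w. (exp w - 1) / w"]) (auto intro!: continuous_intros simp: expm1_div_def)
      then show ?thesis using False
        by (simp add: continuous_on_eq_continuous_at continuous_at_imp_continuous_at_within open_Compl)
    qed
  qed
  then show ?thesis
    by (rule continuous_on_compose2) (auto intro!: continuous_intros simp: less_imp_le[OF pos])
qed

lemma continuous_on_K: "continuous_on {z. Im z \<ge> 0} K"
  unfolding continuous_on_eq_continuous_within
proof
  fix z assume z: "z \<in> {z. Im z \<ge> 0}"
  define R where "R = norm z + 1"
  have "continuous_on ({z. Im z \<ge> 0} \<inter> cball 0 R) K"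
    by (rule uniform_limit_theorem[OF _ uniform_limit_partial])
      (auto simp: partial_def intro!: always_eventually continuous_intros continuous_on_subset[OF continuous_on_factor])
  then have "continuous (at z within {z. Im z \<ge> 0} \<inter> cball 0 R) K"
    using z by (auto simp: continuous_on_eq_continuous_within R_def)
  moreover have "at z within {z. Im z \<ge> 0} \<inter> cball 0 R = at z within {z. Im z \<ge> 0}"
    by (rule at_within_nhd[of _ "ball 0 R"]) (auto simp: R_def)
  ultimately show "continuous (at z within {z. Im z \<ge> 0}) K" by simp
qed

lemma holomorphic_on_K: "K holomorphic_on {z. Im z > 0}"
proof (rule holomorphic_uniform_sequence[OF open_halfspace_Im_gt])
  show "partial n holomorphic_on {z. Im z > 0}" for n
  proof -
    have "(\<lambda>z. (\<Prod>j<n. ((exp (\<i> * of_real (c j) * z) - 1) / (\<i> * of_real (c j) * z)) ^ 2)) holomorphic_on {z. Im z > 0}"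
      by (intro holomorphic_intros) (use less_imp_neq[OF pos] in auto)
    then show ?thesis
      by (rule holomorphic_transform) (use less_imp_neq[OF pos] in \<open>auto simp: partial_def expm1_div_def intro!: prod.cong\<close>)
  qed
  fix z assume z: "z \<in> {z. Im z > 0}"
  then obtain d where d: "d > 0" "cball z d \<subseteq> {z. Im z > 0}"
    using open_contains_cball[of "{z. Im z > 0}"] open_halfspace_Im_gt by blast
  have "cball z d \<subseteq> {z. Im z \<ge> 0} \<inter> cball 0 (norm z + d)"
  proof
    fix w assume w: "w \<in> cball z d"
    have "norm w \<le> norm z + d" using w norm_triangle_ineq2[of w z] by (simp add: dist_norm norm_minus_commute)
    then show "w \<in> {z. Im z \<ge> 0} \<inter> cball 0 (norm z + d)" using w d by force
  qed
  then have "uniform_limit (cball z d) partial K sequentially"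
    by (rule uniform_limit_on_subset[OF uniform_limit_partial])
  then show "\<exists>d>0. cball z d \<subseteq> {z. Im z > 0} \<and> uniform_limit (cball z d) partial K sequentially"
    using d by blast
qed

text \<open>The index starts at 1 because the factor with \<open>c 0 = 1\<close> is reserved for the
  integrable weight \<open>1 / (1 + norm z ^ 2)\<close>.\<close>

definition C :: "nat \<Rightarrow> real" where "C p = (\<Prod>j<p. 2 / c (Suc j))"

lemma C_pos: "C p > 0"
  unfolding C_def by (intro prod_pos) (auto simp: pos)

text \<open>A squared factor absorbs one power of \<open>norm z\<close>, if one copy is bounded by
  its decay and the other by 1, or two powers, if the decay is used twice. The first estimate will
  control the derivatives of the Fourier transform, the second the even moments of
  \<open>norm K\<close>.\<close>

lemma norm_K_le:
  assumes z: "Im z \<ge> 0"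
  shows "norm z ^ p * norm (K z) \<le> 5 * C p / (1 + norm z ^ 2)"
    and "norm z ^ (2 * p) * norm (K z) \<le> 5 * (C p)^2 / (1 + norm z ^ 2)"
proof -
  let ?e = "\<lambda>j. norm (expm1_div (\<i> * of_real (c j) * z))"
  have e1: "?e j \<le> 1" "?e j \<ge> 0" for j using norm_factor_le[OF z] by auto
  have e2: "norm z * ?e j \<le> 2 / c j" for j
    using norm_expm1_div_le(2)[OF Re_le[OF z, of j]] pos[of j] by (simp add: norm_mult field_simps)
  have Kle: "norm (K z) \<le> (\<Prod>j<m. ?e j ^ 2)" for m
    by (rule tendsto_upperbound[OF tendsto_norm[OF partial_tendsto[OF z]]])
      (auto intro!: eventually_sequentiallyI[of m] norm_partial_le[OF z])
  have Kle': "norm (K z) \<le> ?e 0 ^ 2 * (\<Prod>j<p. ?e (Suc j) ^ 2)"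
    using Kle[of "Suc p"] by (simp only: prod.lessThan_Suc_shift)
  \<comment> \<open>The constant 5 adds the bound 1 for the squared factor and the bound
    \<open>2 ^ 2\<close> for that square times \<open>norm z ^ 2\<close>.\<close>
  have e0: "?e 0 ^ 2 \<le> 5 / (1 + norm z ^ 2)"
  proof -
    have "?e 0 ^ 2 \<le> 1 ^ 2" by (rule power_mono) (use e1 in auto)
    moreover have "(norm z * ?e 0) ^ 2 \<le> 2 ^ 2" using e2[of 0] c0 e1 by (intro power_mono) auto
    ultimately have "?e 0 ^ 2 * (1 + norm z ^ 2) \<le> 5" by (simp add: power_mult_distrib algebra_simps)
    then show ?thesis by (simp add: le_divide_eq add_pos_nonneg)
  qed
  have "norm z ^ p * norm (K z) \<le> norm z ^ p * (?e 0 ^ 2 * (\<Prod>j<p. ?e (Suc j) ^ 2))"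
    by (intro mult_left_mono Kle') simp
  also have "\<dots> = ?e 0 ^ 2 * (\<Prod>j<p. norm z * ?e (Suc j) ^ 2)" by (simp add: prod.distrib)
  also have "\<dots> \<le> 5 / (1 + norm z ^ 2) * C p"
    unfolding C_def
  proof (intro mult_mono e0 prod_mono conjI)
    fix j
    have "norm z * ?e (Suc j) ^ 2 \<le> norm z * ?e (Suc j) * 1"
      unfolding power2_eq_square mult.assoc[symmetric] by (intro mult_left_mono e1) auto
    then show "norm z * ?e (Suc j) ^ 2 \<le> 2 / c (Suc j)" using e2[of "Suc j"] by simp
  qed (auto intro!: prod_nonneg)
  finally show "norm z ^ p * norm (K z) \<le> 5 * C p / (1 + norm z ^ 2)" by simp
  have "norm z ^ (2 * p) * norm (K z) \<le> norm z ^ (2 * p) * (?e 0 ^ 2 * (\<Prod>j<p. ?e (Suc j) ^ 2))"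
    by (intro mult_left_mono Kle') simp
  also have "\<dots> = ?e 0 ^ 2 * (\<Prod>j<p. norm z * ?e (Suc j)) ^ 2"
    by (simp add: prod.distrib power_mult_distrib prod_power_distrib[symmetric] power_mult[symmetric] mult.commute[of 2])
  also have "\<dots> \<le> 5 / (1 + norm z ^ 2) * (C p) ^ 2"
    unfolding C_def by (intro mult_mono e0 power_mono prod_mono conjI e2 prod_nonneg) auto
  finally show "norm z ^ (2 * p) * norm (K z) \<le> 5 * (C p)^2 / (1 + norm z ^ 2)" by simp
qed

lemma continuous_K_real: "continuous_on S (\<lambda>t. K (of_real t))"
  by (rule continuous_on_compose2[OF continuous_on_K]) (auto intro!: continuous_intros)

lemma K_0: "K 0 = 1"
proof -
  have "(\<lambda>n. partial n 0) \<longlonglongrightarrow> K 0" by (rule partial_tendsto) simp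
  moreover have "partial n 0 = 1" for n by (simp add: partial_def expm1_div_def)
  ultimately show ?thesis by (simp add: LIMSEQ_const_iff)
qed

definition \<alpha> :: real where "\<alpha> = suminf c"

lemma alpha_pos: "\<alpha> > 0"
  unfolding \<alpha>_def by (rule suminf_pos[OF summable pos])

text \<open>The phases of the squared factors add up to the partial sums of \<open>c\<close>, and
  the identity survives the limit. It makes \<alpha> the centre of symmetry of the Fourier
  transform.\<close>

lemma K_real: "K (of_real t) = exp (\<i> * of_real (\<alpha> * t)) * of_real (norm (K (of_real t)))"
proof (rule LIMSEQ_unique)
  show "(\<lambda>n. partial n (of_real t)) \<longlonglongrightarrow> K (of_real t)" by (rule partial_tendsto) simp
  have "partial n (of_real t) = exp (\<i> * of_real ((\<Sum>j<n. c j) * t)) * of_real (norm (partial n (of_real t)))" for n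
  proof (induction n)
    case (Suc n)
    have "\<i> * of_real (c n) * of_real t = \<i> * of_real (c n * t)" by simp
    then have e: "partial (Suc n) (of_real t) = partial n (of_real t) * (expm1_div (\<i> * of_real (c n * t)))^2"
      by (simp only: partial_def prod.lessThan_Suc)
    have "exp (\<i> * of_real ((\<Sum>j<Suc n. c j) * t)) = exp (\<i> * of_real ((\<Sum>j<n. c j) * t)) * exp (\<i> * of_real (c n * t))"
      by (simp add: exp_add[symmetric] algebra_simps)
    then show ?case
      unfolding e norm_mult norm_power of_real_mult[of "norm _"] by (subst Suc, subst expm1_div_imaginary_sq) (simp only: mult_ac)
  qed (simp add: partial_def)
  moreover have "(\<lambda>n. exp (\<i> * of_real ((\<Sum>j<n. c j) * t)) * of_real (norm (partial n (of_real t))))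
      \<longlonglongrightarrow> exp (\<i> * of_real (\<alpha> * t)) * of_real (norm (K (of_real t)))"
    unfolding \<alpha>_def by (intro tendsto_intros summable_LIMSEQ[OF summable] partial_tendsto) simp
  ultimately show "(\<lambda>n. partial n (of_real t)) \<longlonglongrightarrow> exp (\<i> * of_real (\<alpha> * t)) * of_real (norm (K (of_real t)))"
    by presburger
qed

text \<open>For \<open>x \<ge> 0\<close> the exponential has modulus at most 1 in the upper half
  plane, so the decay of \<open>K\<close> allows the contour to be closed there. The case
  \<open>x = 0\<close> gives the vanishing moments of \<open>K\<close>, the general case the
  one-sided support of its Fourier transform.\<close>

lemma integral_power_exp_K:
  assumes x: "x \<ge> 0"
  shows "integrable lborel (\<lambda>t. of_real t ^ p * exp (\<i> * of_real x * of_real t) * K (of_real t))"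
    and "(\<integral>t. of_real t ^ p * exp (\<i> * of_real x * of_real t) * K (of_real t) \<partial>lborel) = 0"
proof -
  let ?F = "\<lambda>z. z ^ p * exp (\<i> * of_real x * z) * K z"
  have c: "continuous_on {z. Im z \<ge> 0} ?F" by (intro continuous_intros continuous_on_K)
  have h: "?F holomorphic_on {z. Im z > 0}" by (intro holomorphic_intros holomorphic_on_K)
  have b: "norm (?F z) \<le> 5 * C p / (1 + norm z ^ 2)" if z: "Im z \<ge> 0" for z
  proof -
    have "norm (?F z) = (norm z ^ p * norm (K z)) * norm (exp (\<i> * of_real x * z))"
      by (simp add: norm_mult norm_power)
    also have "\<dots> \<le> (norm z ^ p * norm (K z)) * 1"
      by (intro mult_left_mono) (use x z in auto)
    also have "\<dots> \<le> 5 * C p / (1 + norm z ^ 2)" using norm_K_le(1)[OF z] by simp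
    finally show ?thesis .
  qed
  show "integrable lborel (\<lambda>t. of_real t ^ p * exp (\<i> * of_real x * of_real t) * K (of_real t))"
    by (rule integral_eq_0_of_upper_half_decay(1)[OF c h b])
  show "(\<integral>t. of_real t ^ p * exp (\<i> * of_real x * of_real t) * K (of_real t) \<partial>lborel) = 0"
    by (rule integral_eq_0_of_upper_half_decay(2)[OF c h b])
qed

end

section \<open>The Fourier transform of the kernel\<close>

context kernel
begin

definition I5 :: real where "I5 = (\<integral>t. 5 / (1 + t^2) \<partial>lborel)"

lemma integrable_5: "integrable lborel (\<lambda>t::real. 5 / (1 + t^2))"
  using integrable_mult_right[OF integrable_inverse_1_plus_square, of 5] by simp

lemma I5_nonneg: "I5 \<ge> 0"
  unfolding I5_def by (rule integral_nonneg_AE) simp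

lemma integrable_real_K:
  assumes g: "continuous_on UNIV g" and b: "\<And>t. norm (g t) \<le> \<bar>t\<bar> ^ p"
  shows "integrable lborel (\<lambda>t. g t * K (of_real t))"
    and "(\<integral>t. norm (g t * K (of_real t)) \<partial>lborel) \<le> C p * I5"
proof -
  have le: "norm (g t * K (of_real t)) \<le> C p * (5 / (1 + t^2))" for t
  proof -
    have "norm (g t * K (of_real t)) \<le> \<bar>t\<bar> ^ p * norm (K (of_real t))"
      unfolding norm_mult by (intro mult_right_mono b) simp
    then show ?thesis using norm_K_le(1)[of "of_real t" p] by (simp add: mult.commute)
  qed
  show i: "integrable lborel (\<lambda>t. g t * K (of_real t))"
  proof (rule Bochner_Integration.integrable_bound[OF integrable_mult_right[OF integrable_5, of "C p"]])
    show "(\<lambda>t. g t * K (of_real t)) \<in> borel_measurable lborel"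
      using borel_measurable_continuous_onI[OF continuous_on_mult[OF g continuous_K_real]] by simp
    show "AE t in lborel. norm (g t * K (of_real t)) \<le> norm (C p * (5 / (1 + t^2)))"
      by (rule AE_I2, rule order_trans[OF le]) (use less_imp_le[OF C_pos[of p]] in simp)
  qed
  have "(\<integral>t. norm (g t * K (of_real t)) \<partial>lborel) \<le> (\<integral>t. C p * (5 / (1 + t^2)) \<partial>lborel)"
    by (intro integral_mono integrable_norm i integrable_mult_right integrable_5 le)
  then show "(\<integral>t. norm (g t * K (of_real t)) \<partial>lborel) \<le> C p * I5" unfolding I5_def integral_mult_right_zero .
qed

lemma integral_even_power_K_le:
  "integrable lborel (\<lambda>t. t ^ (2 * p) * norm (K (of_real t)))"
  "(\<integral>t. t ^ (2 * p) * norm (K (of_real t)) \<partial>lborel) \<le> (C p)^2 * I5"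
proof -
  have le: "t ^ (2 * p) * norm (K (of_real t)) \<le> (C p)^2 * (5 / (1 + t^2))" for t
  proof -
    have "\<bar>t\<bar> ^ (2 * p) = t ^ (2 * p)" by (simp add: power_mult)
    then show ?thesis using norm_K_le(2)[of "of_real t" p] by (simp add: mult.commute)
  qed
  show i: "integrable lborel (\<lambda>t. t ^ (2 * p) * norm (K (of_real t)))"
  proof (rule Bochner_Integration.integrable_bound[OF integrable_mult_right[OF integrable_5, of "(C p)^2"]])
    show "(\<lambda>t. t ^ (2 * p) * norm (K (of_real t))) \<in> borel_measurable lborel"
      using borel_measurable_continuous_onI[OF continuous_on_norm[OF continuous_K_real]] by simp
    show "AE t in lborel. norm (t ^ (2 * p) * norm (K (of_real t))) \<le> norm ((C p)^2 * (5 / (1 + t^2)))"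
      by (rule AE_I2) (use le in \<open>simp add: abs_mult power_mult\<close>)
  qed
  have "(\<integral>t. t ^ (2 * p) * norm (K (of_real t)) \<partial>lborel) \<le> (\<integral>t. (C p)^2 * (5 / (1 + t^2)) \<partial>lborel)"
    by (intro integral_mono i integrable_mult_right integrable_5 le)
  then show "(\<integral>t. t ^ (2 * p) * norm (K (of_real t)) \<partial>lborel) \<le> (C p)^2 * I5" unfolding I5_def integral_mult_right_zero .
qed

text \<open>The \<open>q\<close>-th derivative of the Fourier transform of \<open>K\<close> on the
  real line. Up to a constant, \<open>psi 0\<close> is an infinite convolution of uniform densities,
  hence a bump supported between 0 and \<open>2 * \<alpha>\<close>.\<close>

definition psi :: "nat \<Rightarrow> real \<Rightarrow> complex" where
  "psi q x = (\<integral>t. ((- \<i> * of_real t) ^ q * exp (- \<i> * of_real x * of_real t)) * K (of_real t) \<partial>lborel)"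

lemma continuous_psi_weight:
  "continuous_on UNIV (\<lambda>t. (- \<i> * of_real t) ^ q * exp (- \<i> * of_real x * of_real t))"
  by (intro continuous_intros)

lemma norm_psi_weight:
  "norm ((- \<i> * of_real t) ^ q * exp (- \<i> * of_real x * of_real t)) = \<bar>t\<bar> ^ q"
  by (simp add: norm_mult norm_power)

lemma norm_psi_le: "norm (psi q x) \<le> C q * I5"
  unfolding psi_def
  by (rule order_trans[OF integral_norm_bound integrable_real_K(2)[OF continuous_psi_weight]])
    (rule eq_refl[OF norm_psi_weight])

lemma psi_has_derivative: "(psi q has_vector_derivative psi (Suc q) x) (at x)"
  unfolding psi_def
\<comment> \<open>The modulus of the differentiated integrand does not depend on \<open>x\<close>,
  so its value at \<open>x = 0\<close> serves as the majorant.\<close>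
proof (rule has_vector_derivative_lebesgue_integral[where g="\<lambda>t. norm ((- \<i> * of_real t) ^ Suc q * exp (- \<i> * of_real 0 * of_real t) * K (of_real t))"])
  show "integrable lborel (\<lambda>t. ((- \<i> * of_real t) ^ q * exp (- \<i> * of_real x * of_real t)) * K (of_real t))" for x
    by (rule integrable_real_K(1)[OF continuous_psi_weight]) (rule eq_refl[OF norm_psi_weight])
  show "integrable lborel (\<lambda>t. norm ((- \<i> * of_real t) ^ Suc q * exp (- \<i> * of_real 0 * of_real t) * K (of_real t)))"
    by (rule integrable_norm, rule integrable_real_K(1)[OF continuous_psi_weight]) (rule eq_refl[OF norm_psi_weight])
  show "(\<lambda>t. ((- \<i> * of_real t) ^ Suc q * exp (- \<i> * of_real x * of_real t)) * K (of_real t)) \<in> borel_measurable lborel"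
    by (rule borel_measurable_integrable, rule integrable_real_K(1)[OF continuous_psi_weight]) (rule eq_refl[OF norm_psi_weight])
  show "norm ((- \<i> * of_real t) ^ Suc q * exp (- \<i> * of_real x * of_real t) * K (of_real t))
      \<le> norm ((- \<i> * of_real t) ^ Suc q * exp (- \<i> * of_real 0 * of_real t) * K (of_real t))" for x t
    by (simp only: norm_mult[of _ "K _"] norm_psi_weight)
  show "((\<lambda>x. ((- \<i> * of_real t) ^ q * exp (- \<i> * of_real x * of_real t)) * K (of_real t))
      has_vector_derivative ((- \<i> * of_real t) ^ Suc q * exp (- \<i> * of_real x * of_real t)) * K (of_real t)) (at x)" for t x
  proof -
    have "((\<lambda>z. ((- \<i> * of_real t) ^ q * exp (- \<i> * z * of_real t)) * K (of_real t))
      has_field_derivative ((- \<i> * of_real t) ^ Suc q * exp (- \<i> * of_real x * of_real t)) * K (of_real t)) (at (of_real x))"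
      by (rule derivative_eq_intros refl)+ simp
    then show ?thesis by (rule has_vector_derivative_real_field)
  qed
qed

lemma continuous_psi: "continuous_on S (psi q)"
  by (meson psi_has_derivative has_vector_derivative_continuous continuous_at_imp_continuous_on)

lemma psi_nonpos: "x \<le> 0 \<Longrightarrow> psi q x = 0"
proof -
  assume x: "x \<le> 0"
  have e: "((- \<i> * of_real t) ^ q * exp (- \<i> * of_real x * of_real t)) * K (of_real t) =
      (- \<i>) ^ q * (of_real t ^ q * exp (\<i> * of_real (- x) * of_real t) * K (of_real t))" for t
  proof -
    have "exp (\<i> * of_real (- x) * of_real t) = exp (- \<i> * of_real x * of_real t)" by simp
    then show ?thesis by (simp only: power_mult_distrib mult.assoc)
  qed
  have z: "(\<integral>t. of_real t ^ q * exp (\<i> * of_real (- x) * of_real t) * K (of_real t) \<partial>lborel) = 0"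
    by (rule integral_power_exp_K(2)) (use x in simp)
  show ?thesis unfolding psi_def e integral_mult_right_zero z by simp
qed

text \<open>On the real line \<open>K t = exp (2 \<i> \<alpha> t) * cnj (K t)\<close>, which reflects the vanishing of \<open>psi\<close> on the
  negative axis to the right of \<open>2 \<alpha>\<close>.\<close>
lemma psi_ge: "x \<ge> 2 * \<alpha> \<Longrightarrow> psi q x = 0"
proof -
  assume x: "x \<ge> 2 * \<alpha>"
  have e: "((- \<i> * of_real t) ^ q * exp (- \<i> * of_real x * of_real t)) * K (of_real t) =
      (- \<i>) ^ q * cnj (of_real t ^ q * exp (\<i> * of_real (x - 2 * \<alpha>) * of_real t) * K (of_real t))" for t
  proof -
    let ?n = "complex_of_real (norm (K (of_real t)))"
    have "exp (- \<i> * of_real x * of_real t) * K (of_real t) = exp (- \<i> * of_real x * of_real t) * (exp (\<i> * of_real (\<alpha> * t)) * ?n)"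
      by (subst K_real) simp
    also have "\<dots> = exp (- \<i> * of_real x * of_real t + \<i> * of_real (\<alpha> * t)) * ?n"
      by (simp only: exp_add mult.assoc)
    also have "- \<i> * of_real x * of_real t + \<i> * of_real (\<alpha> * t) = - \<i> * of_real (x - 2 * \<alpha>) * of_real t + - \<i> * of_real (\<alpha> * t)"
      by (simp add: algebra_simps)
    also have "exp \<dots> * ?n = exp (- \<i> * of_real (x - 2 * \<alpha>) * of_real t) * (exp (- \<i> * of_real (\<alpha> * t)) * ?n)"
      by (simp only: exp_add mult.assoc)
    also have "exp (- \<i> * of_real (\<alpha> * t)) * ?n = cnj (exp (\<i> * of_real (\<alpha> * t)) * ?n)"
      by (simp add: exp_cnj)
    also have "exp (\<i> * of_real (\<alpha> * t)) * ?n = K (of_real t)" by (rule K_real[symmetric])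
    also have "exp (- \<i> * of_real (x - 2 * \<alpha>) * of_real t) = cnj (exp (\<i> * of_real (x - 2 * \<alpha>) * of_real t))"
      by (simp add: exp_cnj)
    finally have "exp (- \<i> * of_real x * of_real t) * K (of_real t) =
      cnj (exp (\<i> * of_real (x - 2 * \<alpha>) * of_real t)) * cnj (K (of_real t))" .
    then show ?thesis
      by (simp only: power_mult_distrib complex_cnj_mult complex_cnj_power complex_cnj_complex_of_real mult.assoc)
  qed
  have z: "(\<integral>t. of_real t ^ q * exp (\<i> * of_real (x - 2 * \<alpha>) * of_real t) * K (of_real t) \<partial>lborel) = 0"
    by (rule integral_power_exp_K(2)) (use x in simp)
  show ?thesis unfolding psi_def e integral_mult_right_zero Bochner_Integration.integral_cnj z by simp
qed

text \<open>At the centre \<alpha> the exponential cancels the phase of \<open>K\<close> and leaves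
  the integral of \<open>norm K\<close>, which is positive because \<open>K 0 = 1\<close>.\<close>

lemma psi_alpha: "psi 0 \<alpha> \<noteq> 0"
proof -
  have e: "((- \<i> * of_real t) ^ 0 * exp (- \<i> * of_real \<alpha> * of_real t)) * K (of_real t) = complex_of_real (norm (K (of_real t)))" for t
  proof -
    have "exp (- \<i> * of_real \<alpha> * of_real t) * (exp (\<i> * of_real (\<alpha> * t)) * complex_of_real (norm (K (of_real t)))) = complex_of_real (norm (K (of_real t)))"
      unfolding mult.assoc[symmetric] exp_add[symmetric] by simp
    then have "exp (- \<i> * of_real \<alpha> * of_real t) * K (of_real t) = complex_of_real (norm (K (of_real t)))"
      unfolding K_real[symmetric] .
    then show ?thesis by simp
  qed
  have "psi 0 \<alpha> = of_real (\<integral>t. norm (K (of_real t)) \<partial>lborel)"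
    unfolding psi_def e by (rule integral_complex_of_real)
  moreover have "(\<integral>t. norm (K (of_real t)) \<partial>lborel) > 0"
  proof (rule integral_pos_isCont[of _ 0])
    show "integrable lborel (\<lambda>t. norm (K (of_real t)))" using integral_even_power_K_le(1)[of 0] by simp
    have "continuous_on UNIV (\<lambda>t. norm (K (of_real t)))" by (intro continuous_on_norm continuous_K_real)
    then show "isCont (\<lambda>t. norm (K (of_real t))) 0" by (simp add: continuous_on_eq_continuous_at)
  qed (simp_all add: K_0)
  ultimately show ?thesis by simp
qed

text \<open>After the substitution of \<open>t / sqrt n\<close> for \<open>t\<close>, dominated
  convergence shows that the integral times \<open>sqrt n\<close> tends to \<open>K 0\<close> times
  the Gaussian integral. This integral is the contribution of \<open>K\<close> to the Laplace
  transform at \<open>n\<close> of the function constructed below.\<close>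

lemma integral_gaussian_K_nonzero:
  "\<exists>n0. \<forall>n\<ge>n0. (\<integral>t. exp (- (real n * t^2)) *\<^sub>R K (of_real t) \<partial>lborel) \<noteq> 0"
proof -
  let ?G = "\<lambda>n::nat. \<integral>t. exp (- (real n * t^2)) *\<^sub>R K (of_real t) \<partial>lborel"
  let ?s = "\<lambda>n t. exp (- (t^2)) *\<^sub>R K (of_real (t / sqrt (real n)))"
  have K1: "norm (K (of_real t)) \<le> 5" for t
  proof -
    have "norm (K (of_real t)) \<le> 5 / (1 + t^2)" using norm_K_le(1)[of "of_real t" 0] by (simp add: C_def)
    also have "\<dots> \<le> 5 / 1" by (intro divide_left_mono) (auto simp: add_pos_nonneg)
    finally show ?thesis by simp
  qed
  have ge: "exp (- (t^2)) \<le> 1 / (1 + t^2)" for t :: real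
    using exp_ge_add_one_self[of "t^2"] by (simp add: exp_minus divide_inverse add_pos_nonneg le_imp_inverse_le)
  have gi: "integrable lborel (\<lambda>t::real. exp (- (t^2)))"
    by (rule Bochner_Integration.integrable_bound[OF integrable_inverse_1_plus_square])
      (use ge in \<open>auto intro!: AE_I2\<close>)
  have mK: "(\<lambda>t. K (of_real (t / r))) \<in> borel_measurable lborel" for r
  proof -
    have "continuous_on UNIV (\<lambda>t. K (of_real (t / r)))"
      by (cases "r = 0") (auto intro!: continuous_on_compose2[OF continuous_K_real[of UNIV]] continuous_intros simp del: of_real_divide)
    then show ?thesis using borel_measurable_continuous_onI by simp
  qed
  have "(\<lambda>n. \<integral>t. ?s n t \<partial>lborel) \<longlonglongrightarrow> (\<integral>t. exp (- (t^2)) *\<^sub>R (1::complex) \<partial>lborel)"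
  proof (rule integral_dominated_convergence[where w="\<lambda>t. exp (- (t^2)) * 5"])
    show "?s n \<in> borel_measurable lborel" for n using mK[of "sqrt (real n)"] by simp
    show "AE t in lborel. norm (?s n t) \<le> exp (- (t^2)) * 5" for n
      by (rule AE_I2) (simp del: of_real_divide add: K1)
    show "AE t in lborel. (\<lambda>n. ?s n t) \<longlonglongrightarrow> exp (- (t^2)) *\<^sub>R 1"
    proof (rule AE_I2)
      fix t :: real
      have "isCont (\<lambda>t. K (of_real t)) 0" using continuous_K_real[of UNIV] by (simp add: continuous_on_eq_continuous_at)
      moreover have "(\<lambda>n. t / sqrt (real n)) \<longlonglongrightarrow> 0" by real_asymp
      ultimately have "(\<lambda>n. K (of_real (t / sqrt (real n)))) \<longlonglongrightarrow> K (of_real 0)" by (rule isCont_tendsto_compose)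
      then show "(\<lambda>n. ?s n t) \<longlonglongrightarrow> exp (- (t^2)) *\<^sub>R 1" using K_0 by (intro tendsto_intros) simp
    qed
  qed (use gi in auto)
  moreover have "(\<integral>t. exp (- (t^2)) *\<^sub>R (1::complex) \<partial>lborel) \<noteq> 0"
  proof -
    have "(\<integral>t. exp (- ((t::real)^2)) \<partial>lborel) > 0"
      by (rule integral_pos_isCont[OF gi, of 0]) auto
    then show ?thesis using gi by (simp add: integral_scaleR_left)
  qed
  ultimately have "eventually (\<lambda>n. (\<integral>t. ?s n t \<partial>lborel) \<noteq> 0) sequentially"
    by (rule tendsto_imp_eventually_ne)
  then have "eventually (\<lambda>n. ?G n \<noteq> 0) sequentially"
    using eventually_gt_at_top[of 0]
  proof eventually_elim
    case (elim n)
    let ?r = "1 / sqrt (real n)"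
    have "?G n = \<bar>?r\<bar> *\<^sub>R (\<integral>t. exp (- (real n * (0 + ?r * t)^2)) *\<^sub>R K (of_real (0 + ?r * t)) \<partial>lborel)"
      by (rule lborel_integral_real_affine) (use elim in simp)
    also have "(\<lambda>t. exp (- (real n * (0 + ?r * t)^2)) *\<^sub>R K (of_real (0 + ?r * t))) = ?s n"
      using elim by (intro ext) (simp add: power_mult_distrib power_divide)
    finally show ?case using elim by simp
  qed
  then show ?thesis by (simp add: eventually_sequentially)
qed

end

text \<open>The inner integral is the convolution of \<psi> with the image of \<open>k t dt\<close>
  under squaring. Fubini and the shift \<open>x = u + t^2\<close> move the test function
  \<open>w\<close> onto the two ingredients; domination is available because for fixed
  \<open>t\<close> the integrand lives on an interval of length \<open>L\<close>.\<close>

lemma convolution_Fubini: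
  fixes k \<psi> w :: "real \<Rightarrow> complex" and W :: "real \<Rightarrow> real"
  assumes k: "continuous_on UNIV k" and \<psi>: "continuous_on UNIV \<psi>" and w: "continuous_on UNIV w"
    and supp: "\<And>u. u \<notin> {0..L} \<Longrightarrow> \<psi> u = 0" and L: "L \<ge> 0" and b: "\<And>u. norm (\<psi> u) \<le> B"
    and W: "\<And>u t. u \<in> {0..L} \<Longrightarrow> norm (w (u + t^2)) \<le> W t"
    and int: "integrable lborel (\<lambda>t. norm (k t) * W t)"
  shows "integrable lborel (\<lambda>x. w x * (\<integral>t. k t * \<psi> (x - (t^2)) \<partial>lborel))"
    and "(\<integral>x. w x * (\<integral>t. k t * \<psi> (x - (t^2)) \<partial>lborel) \<partial>lborel)
       = (\<integral>t. k t * (\<integral>u. w (u + t^2) * \<psi> u \<partial>lborel) \<partial>lborel)"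
proof -
  let ?f = "\<lambda>t x. w x * (k t * \<psi> (x - (t^2)))"
  have fc: "continuous_on UNIV (\<lambda>(t, x). ?f t x)"
    unfolding case_prod_beta
    by (intro continuous_intros continuous_on_compose2[OF w] continuous_on_compose2[OF k] continuous_on_compose2[OF \<psi>]) auto
  then have meas: "(\<lambda>(t, x). ?f t x) \<in> borel_measurable (lborel \<Otimes>\<^sub>M lborel)"
    using borel_measurable_continuous_onI[OF fc] by (simp add: lborel_prod)
  have B0: "B \<ge> 0" using b[of 0] norm_ge_zero[of "\<psi> 0"] by linarith
  have W0: "W t \<ge> 0" for t
  proof -
    have "norm (w (0 + t^2)) \<le> W t" by (rule W) (use L in simp)
    then show ?thesis by (rule order_trans[OF norm_ge_zero])
  qed
  have le: "norm (?f t x) \<le> (norm (k t) * W t * B) * indicator {t^2..t^2 + L} x" for t x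
  proof (cases "x - t^2 \<in> {0..L}")
    case True
    have "norm (w x) \<le> W t" using W[OF True, of t] by simp
    then have "norm (w x) * (norm (k t) * norm (\<psi> (x - (t^2)))) \<le> W t * (norm (k t) * B)"
      by (intro mult_mono b) (use B0 W0 in auto)
    then show ?thesis using True by (simp add: norm_mult mult_ac)
  next
    case False
    then show ?thesis using supp[OF False] B0 W0[of t] by simp
  qed
  have ii: "integrable lborel (\<lambda>x. (norm (k t) * W t * B) * indicator {t^2..t^2 + L} x)" for t
    by (intro integrable_mult_right integrable_real_indicator) (auto simp: emeasure_lborel_Icc_eq)
  have fi: "integrable lborel (?f t)" for t
  proof (rule Bochner_Integration.integrable_bound[OF ii[of t]])
    have "continuous_on UNIV (?f t)"
      by (intro continuous_intros continuous_on_compose2[OF w] continuous_on_compose2[OF \<psi>]) auto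
    then show "?f t \<in> borel_measurable lborel" using borel_measurable_continuous_onI by simp
    show "AE x in lborel. norm (?f t x) \<le> norm ((norm (k t) * W t * B) * indicator {t^2..t^2 + L} x)"
      by (rule AE_I2, rule order_trans[OF le]) (simp only: real_norm_def abs_ge_self)
  qed
  have I: "integrable (lborel \<Otimes>\<^sub>M lborel) (\<lambda>(t, x). ?f t x)"
  proof (rule lborel_pair.Fubini_integrable[OF meas])
    have nle: "(\<integral>x. norm (?f t x) \<partial>lborel) \<le> norm (k t) * W t * (B * L)" for t
    proof -
      have "(\<integral>x. norm (?f t x) \<partial>lborel) \<le> (\<integral>x. (norm (k t) * W t * B) * indicator {t^2..t^2 + L} x \<partial>lborel)"
        by (intro integral_mono integrable_norm fi ii le)
      then show ?thesis using L by (simp add: mult_ac)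
    qed
    show "integrable lborel (\<lambda>t. \<integral>x. norm ((\<lambda>(t, x). ?f t x) (t, x)) \<partial>lborel)"
    proof (rule Bochner_Integration.integrable_bound[OF integrable_mult_left[OF int, of "B * L"]])
      have "(\<lambda>(t, x). norm (?f t x)) \<in> borel_measurable (lborel \<Otimes>\<^sub>M lborel)"
        using measurable_compose[OF meas borel_measurable_norm] by (simp add: case_prod_beta)
      from lborel.borel_measurable_lebesgue_integral[OF this]
      show "(\<lambda>t. \<integral>x. norm ((\<lambda>(t, x). ?f t x) (t, x)) \<partial>lborel) \<in> borel_measurable lborel" by simp
      show "AE t in lborel. norm (\<integral>x. norm ((\<lambda>(t, x). ?f t x) (t, x)) \<partial>lborel) \<le> norm (norm (k t) * W t * (B * L))"
      proof (rule AE_I2)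
        fix t
        have "0 \<le> (\<integral>x. norm (?f t x) \<partial>lborel)" by (rule integral_nonneg_AE) simp
        then show "norm (\<integral>x. norm ((\<lambda>(t, x). ?f t x) (t, x)) \<partial>lborel) \<le> norm (norm (k t) * W t * (B * L))"
          using nle[of t] unfolding prod.case real_norm_def by linarith
      qed
    qed
    show "AE t in lborel. integrable lborel (\<lambda>x. (\<lambda>(t, x). ?f t x) (t, x))" using fi by simp
  qed
  have out: "(\<integral>t. ?f t x \<partial>lborel) = w x * (\<integral>t. k t * \<psi> (x - (t^2)) \<partial>lborel)" for x
    by (rule integral_mult_right_zero)
  show "integrable lborel (\<lambda>x. w x * (\<integral>t. k t * \<psi> (x - (t^2)) \<partial>lborel))"
    using lborel_pair.integrable_snd[OF I] unfolding out .
  have "(\<integral>x. w x * (\<integral>t. k t * \<psi> (x - (t^2)) \<partial>lborel) \<partial>lborel) = (\<integral>t. (\<integral>x. ?f t x \<partial>lborel) \<partial>lborel)"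
    using lborel_pair.Fubini_integral[OF I] unfolding out .
  also have "\<dots> = (\<integral>t. k t * (\<integral>u. w (u + t^2) * \<psi> u \<partial>lborel) \<partial>lborel)"
  proof (rule Bochner_Integration.integral_cong[OF refl])
    fix t
    have "(\<integral>x. ?f t x \<partial>lborel) = (\<integral>u. ?f t (t^2 + 1 * u) \<partial>lborel)"
      using lborel_integral_real_affine[of 1 "?f t" "t^2"] by simp
    also have "\<dots> = (\<integral>u. k t * (w (u + t^2) * \<psi> u) \<partial>lborel)"
      by (rule Bochner_Integration.integral_cong[OF refl]) (simp add: mult_ac add.commute)
    finally show "(\<integral>x. ?f t x \<partial>lborel) = k t * (\<integral>u. w (u + t^2) * \<psi> u \<partial>lborel)" by simp
  qed
  finally show "(\<integral>x. w x * (\<integral>t. k t * \<psi> (x - (t^2)) \<partial>lborel) \<partial>lborel)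
       = (\<integral>t. k t * (\<integral>u. w (u + t^2) * \<psi> u \<partial>lborel) \<partial>lborel)" .
qed

section \<open>Existence of functions with vanishing moments\<close>

lemma lpos_eq_lborel:
  fixes f :: "real \<Rightarrow> complex"
  assumes "\<And>x. x \<le> 0 \<Longrightarrow> f x = 0"
  shows "integral\<^sup>L lpos f = integral\<^sup>L lborel f" and "integrable lpos f \<longleftrightarrow> integrable lborel f"
proof -
  have "indicator {0<..} x *\<^sub>R f x = f x" for x using assms[of x] by (simp add: indicator_def)
  then show "integral\<^sup>L lpos f = integral\<^sup>L lborel f" "integrable lpos f \<longleftrightarrow> integrable lborel f"
    by (simp_all add: integral_restrict_space integrable_restrict_space)
qed

section \<open>Carleman's inequality and the comparison of the two series\<close>

lemma power_self_le_exp_fact: "real n ^ n \<le> exp (real n) * fact n"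
proof (induction n)
  case (Suc n)
  have "(real n + 1) ^ n \<le> exp 1 * real n ^ n"
  proof (cases "n = 0")
    case False
    have "(1 + 1 / real n) ^ n \<le> exp (1 / real n) ^ n"
      by (intro power_mono exp_ge_add_one_self) simp
    also have "\<dots> = exp 1" using False by (simp add: exp_of_nat_mult[symmetric])
    finally have "(1 + 1 / real n) ^ n * real n ^ n \<le> exp 1 * real n ^ n" by (rule mult_right_mono) simp
    moreover have "(1 + 1 / real n) ^ n * real n ^ n = (real n + 1) ^ n"
      using False by (simp add: power_mult_distrib[symmetric] distrib_right)
    ultimately show ?thesis by simp
  qed simp
  also have "\<dots> \<le> exp 1 * (exp (real n) * fact n)" by (intro mult_left_mono Suc) simp
  finally have "(real n + 1) * (real n + 1) ^ n \<le> (real n + 1) * (exp 1 * (exp (real n) * fact n))"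
    by (intro mult_left_mono) simp_all
  then show ?case by (simp add: exp_add mult_ac add.commute)
qed simp

lemma le_powr_inverse_of_power_le:
  fixes x y :: real
  assumes "x > 0" "n > 0" "x ^ n \<le> y" shows "x \<le> y powr (1 / real n)"
proof -
  have "x = (x ^ n) powr (1 / real n)" using assms by (simp add: powr_realpow[symmetric] powr_powr)
  also have "\<dots> \<le> y powr (1 / real n)" using assms by (intro powr_mono2) auto
  finally show ?thesis .
qed

text \<open>The arithmetic-geometric mean inequality is applied to \<open>(j + 1) * c j\<close>
  instead of \<open>c j\<close>; the factorial this introduces is at least
  \<open>((p + 1) / exp 1) ^ (p + 1)\<close>. The resulting weighted means are summed by a
  telescoping estimate.\<close>

lemma carleman_summable:
  fixes c :: "nat \<Rightarrow> real"
  assumes pos: "\<And>j. c j > 0" and sum: "summable c"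
  shows "summable (\<lambda>p. (\<Prod>j\<le>p. c j) powr (1 / real (Suc p)))"
proof -
  define T where "T n = (\<Sum>j<n. real (Suc j) * c j)" for n
  have T0: "T n \<ge> 0" for n unfolding T_def using pos by (intro sum_nonneg) (simp add: less_imp_le)
  have term_le: "(\<Prod>j\<le>p. c j) powr (1 / real (Suc p)) \<le> exp 1 * (T (Suc p) / (real (Suc p))^2)" for p
  proof -
    let ?n = "real (Suc p)"
    let ?P = "(\<Prod>j\<le>p. c j) powr (1 / ?n)"
    have P0: "?P \<ge> 0" by simp
    have "(\<Prod>j\<le>p. real (Suc j) * c j) powr (1 / real (card {..p})) \<le> (\<Sum>j\<le>p. real (Suc j) * c j / real (card {..p}))"
      by (rule arith_geom_mean) (use pos in \<open>auto intro!: mult_nonneg_nonneg less_imp_le\<close>)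
    also have "(\<Sum>j\<le>p. real (Suc j) * c j / real (card {..p})) = T (Suc p) / ?n"
      by (simp add: T_def sum_divide_distrib lessThan_Suc_atMost)
    also have "(\<Prod>j\<le>p. real (Suc j) * c j) = fact (Suc p) * (\<Prod>j\<le>p. c j)"
      by (simp only: prod.distrib) (simp add: fact_prod_Suc atLeast0LessThan lessThan_Suc_atMost del: fact_Suc)
    also have "(fact (Suc p) * (\<Prod>j\<le>p. c j)) powr (1 / real (card {..p})) = fact (Suc p) powr (1 / ?n) * ?P"
      using pos by (subst powr_mult) (auto intro!: prod_nonneg less_imp_le simp del: fact_Suc)
    finally have amgm: "fact (Suc p) powr (1 / ?n) * ?P \<le> T (Suc p) / ?n" .
    have "?n / exp 1 \<le> fact (Suc p) powr (1 / ?n)"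
    proof (rule le_powr_inverse_of_power_le)
      have "(?n / exp 1) ^ Suc p = ?n ^ Suc p / exp ?n"
        by (simp only: power_divide exp_of_nat_mult[symmetric] mult_1_right)
      also have "\<dots> \<le> fact (Suc p)"
        using power_self_le_exp_fact[of "Suc p"] by (simp add: divide_le_eq mult.commute del: fact_Suc power_Suc of_nat_Suc)
      finally show "(?n / exp 1) ^ Suc p \<le> fact (Suc p)" .
    qed auto
    then have "?n / exp 1 * ?P \<le> T (Suc p) / ?n"
      using amgm mult_right_mono[OF _ P0] by (meson order_trans)
    then have "?n * ?P \<le> exp 1 * (T (Suc p) / ?n)" by (simp add: divide_le_eq mult_ac del: of_nat_Suc)
    then have "?P \<le> exp 1 * (T (Suc p) / ?n) / ?n" by (simp add: le_divide_eq mult_ac del: of_nat_Suc)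
    then show ?thesis by (simp add: power2_eq_square del: of_nat_Suc)
  qed
  \<comment> \<open>The summand \<open>T n / n\<close> strengthens the estimate so that it telescopes.\<close>
  have tele: "(\<Sum>p<n. T (Suc p) / (real (Suc p))^2) + T n / real n \<le> 2 * (\<Sum>j<n. c j)" for n
  proof (induction n)
    case (Suc n)
    let ?n = "real (Suc n)"
    have TS: "T (Suc n) = T n + ?n * c n" by (simp add: T_def)
    have "T (Suc n) / ?n^2 + T (Suc n) / ?n = T n * (1 / ?n^2 + 1 / ?n) + c n * (1 / ?n + 1)"
      unfolding TS by (simp add: add_divide_distrib distrib_left power2_eq_square mult_ac del: of_nat_Suc)
    also have "\<dots> \<le> T n / real n + c n * 2"
    proof (intro add_mono mult_left_mono)
      show "T n * (1 / ?n^2 + 1 / ?n) \<le> T n / real n"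
      proof (cases "n = 0")
        case False
        have "1 / (x + 1)^2 + 1 / (x + 1) \<le> 1 / x" if "x > 0" for x :: real
        proof -
          have "1 / y^2 + 1 / y = (y + 1) / y^2" if "y > 0" for y :: real
            using that by (simp add: power2_eq_square field_simps)
          from this[of "x + 1"] have "1 / (x + 1)^2 + 1 / (x + 1) = (x + 2) / (x + 1)^2"
            using that by (simp add: add.assoc)
          moreover have "(x + 2) * x \<le> (x + 1)^2" by (simp add: power2_eq_square algebra_simps)
          then have "(x + 2) * x / (x + 1)^2 \<le> 1" using that by simp
          ultimately show ?thesis using that by (simp add: le_divide_eq)
        qed
        from this[of "real n"] have "1 / ?n^2 + 1 / ?n \<le> 1 / real n"
          using False by (simp add: add.commute)
        then show ?thesis using T0[of n] mult_left_mono[of _ "1 / real n" "T n"] by simp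
      qed (simp add: T_def)
    qed (use pos[of n] in auto)
    finally show ?case using Suc by (simp add: distrib_left del: of_nat_Suc)
  qed (simp add: T_def)
  have "summable (\<lambda>p. T (Suc p) / (real (Suc p))^2)"
  proof (rule bounded_imp_summable)
    show "0 \<le> T (Suc p) / (real (Suc p))^2" for p using T0 by simp
    show "(\<Sum>p\<le>n. T (Suc p) / (real (Suc p))^2) \<le> 2 * suminf c" for n
    proof -
      have "0 \<le> T (Suc n) / real (Suc n)" using T0 by simp
      then have "(\<Sum>p<Suc n. T (Suc p) / (real (Suc p))^2) \<le> 2 * (\<Sum>j<Suc n. c j)"
        using tele[of "Suc n"] by linarith
      also have "\<dots> \<le> 2 * suminf c"
        by (intro mult_left_mono sum_le_suminf sum) (use pos in \<open>auto intro: less_imp_le\<close>)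
      finally show ?thesis by (simp only: lessThan_Suc_atMost)
    qed
  qed
  from summable_mult[OF this, of "exp 1"] show ?thesis
    by (rule summable_comparison_test'[of _ 0]) (use term_le in simp)
qed

lemma prod_quot:
  assumes "\<And>p. N p > 0" shows "(\<Prod>j<p. quot N j) = N p / N 0"
  by (induction p) (use less_imp_neq[OF assms] in \<open>auto simp: quot_def\<close>)

text \<open>Carleman's inequality makes the roots \<open>y p\<close> of order \<open>p + 1\<close>
  of \<open>1 / sqrt (Mtilde M p)\<close> summable. If the logarithm in \<open>Mtilde M p\<close> is
  at most \<open>exp (p + 1)\<close>, these roots dominate \<open>1 / sqrt (quot M (p + 1))\<close>
  up to a constant. Otherwise the quotients jump so much that \<open>quot M (p + 1)\<close> is at
  least \<open>exp p * quot M 0\<close>, and a geometric series takes over.\<close>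

lemma summable_quot_of_Mtilde:
  assumes M: "weight_seq M" and M0: "M 0 = 1" and Mt: "weight_seq (Mtilde M)"
    and sum: "summable (\<lambda>p. 1 / sqrt (quot (Mtilde M) p))"
  shows "summable (\<lambda>p. 1 / sqrt (quot M p))"
proof -
  note Mp = weight_seq_pos[OF M] and Np = weight_seq_pos[OF Mt]
  have m: "quot M p > 0" for p using Mp by (simp add: quot_def)
  note mono = incseqD[OF weight_seq_incseq_quot[OF M]]
  \<comment> \<open>The initial entry makes the product of the first \<open>p + 1\<close> terms
    exactly \<open>1 / sqrt (Mtilde M p)\<close>.\<close>
  define c where "c j = (case j of 0 \<Rightarrow> 1 / sqrt (Mtilde M 0) | Suc j \<Rightarrow> 1 / sqrt (quot (Mtilde M) j))" for j
  have prodc: "(\<Prod>j\<le>p. c j) = 1 / sqrt (Mtilde M p)" for p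
  proof -
    have "(\<Prod>j\<le>p. c j) = c 0 * (\<Prod>j<p. c (Suc j))"
      by (simp only: lessThan_Suc_atMost[symmetric] prod.lessThan_Suc_shift)
    also have "(\<Prod>j<p. c (Suc j)) = 1 / sqrt (\<Prod>j<p. quot (Mtilde M) j)"
      by (induction p) (auto simp: c_def real_sqrt_mult)
    finally show ?thesis using Np[of 0] unfolding prod_quot[where N="Mtilde M", OF Np] by (simp add: c_def real_sqrt_divide)
  qed
  define y where "y p = (1 / sqrt (Mtilde M p)) powr (1 / real (Suc p))" for p
  have "summable c"
    by (subst summable_Suc_iff[symmetric]) (use sum in \<open>simp add: c_def\<close>)
  moreover have "c j > 0" for j
    using Np by (auto simp: c_def quot_def split: nat.splits)
  ultimately have y: "summable y" using carleman_summable[of c] unfolding prodc y_def by blast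
  have le: "1 / sqrt (quot M (Suc p)) \<le> sqrt (exp 1) * y p + 1 / sqrt (quot M 0) * exp (- 1 / 2) ^ p" for p
  proof -
    let ?m = "quot M (Suc p)"
    define L where "L = ln (exp 2 * ?m / quot M p)"
    have y0: "sqrt (exp 1) * y p \<ge> 0" by (simp add: y_def)
    have g0: "1 / sqrt (quot M 0) * exp (- 1 / 2) ^ p \<ge> 0" using m[of 0] by simp
    show ?thesis
    proof (cases "L \<le> exp (real (Suc p))")
      case True
      have "M (Suc p) = (\<Prod>j<Suc p. quot M j)" using prod_quot[where N=M, OF Mp, of "Suc p"] M0 by simp
      also have "\<dots> \<le> (\<Prod>j<Suc p. ?m)"
        by (intro prod_mono) (use m mono in \<open>auto intro: less_imp_le\<close>)
      finally have "M (Suc p) \<le> ?m ^ Suc p" by simp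
      then have "M (Suc p) * L \<le> ?m ^ Suc p * exp (real (Suc p))"
        by (intro mult_mono' True) (use Mp[of "Suc p"] Np[of p] in \<open>auto simp: Mtilde_def L_def zero_less_mult_iff intro: less_imp_le\<close>)
      also have "M (Suc p) * L = Mtilde M p" by (simp add: Mtilde_def L_def)
      also have "?m ^ Suc p * exp (real (Suc p)) = (exp 1 * ?m) ^ Suc p"
        unfolding power_mult_distrib exp_of_nat_mult[symmetric] by simp
      finally have "sqrt (Mtilde M p) \<le> sqrt (exp 1 * ?m) ^ Suc p"
        unfolding real_sqrt_power[symmetric] by (rule real_sqrt_le_mono)
      then have "(1 / sqrt (exp 1 * ?m)) ^ Suc p \<le> 1 / sqrt (Mtilde M p)"
        unfolding power_divide power_one using Np[of p] m[of "Suc p"] by (intro divide_left_mono) auto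
      then have "1 / sqrt (exp 1 * ?m) \<le> y p"
        unfolding y_def by (intro le_powr_inverse_of_power_le) (use m[of "Suc p"] in auto)
      then have "1 / sqrt ?m \<le> sqrt (exp 1) * y p"
        using m[of "Suc p"] by (simp add: real_sqrt_mult field_simps)
      then show ?thesis using g0 by linarith
    next
      case False
      have "real p + 2 \<le> exp (real (Suc p))" using exp_ge_add_one_self[of "real (Suc p)"] by simp
      \<comment> \<open>The summand 2 will cancel the \<open>exp 2\<close> inside the
        logarithm.\<close>
      then have "real p + 2 \<le> L" using False by simp
      then have "exp (real p + 2) \<le> exp 2 * ?m / quot M p"
        unfolding L_def using m by (subst (asm) ln_ge_iff) auto
      then have "exp (real p) * quot M p \<le> ?m"
        using m[of p] by (simp add: exp_add field_simps)
      moreover have "exp (real p) * quot M 0 \<le> exp (real p) * quot M p" by (intro mult_left_mono mono) auto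
      ultimately have "exp (real p) * quot M 0 \<le> ?m" by linarith
      then have "sqrt (exp (real p)) * sqrt (quot M 0) \<le> sqrt ?m"
        unfolding real_sqrt_mult[symmetric] by (rule real_sqrt_le_mono)
      then have "1 / sqrt ?m \<le> 1 / (sqrt (exp (real p)) * sqrt (quot M 0))"
        using m by (intro divide_left_mono) auto
      also have "sqrt (exp (real p)) = exp (real p / 2)"
        by (rule real_sqrt_unique) (simp_all add: power2_eq_square exp_add[symmetric])
      also have "1 / (exp (real p / 2) * sqrt (quot M 0)) = 1 / sqrt (quot M 0) * exp (- 1 / 2) ^ p"
      proof -
        have "exp (- 1 / 2) ^ p = exp (real p * (- 1 / 2))" by (rule exp_of_nat_mult[symmetric])
        also have "real p * (- 1 / 2) = - (real p / 2)" by simp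
        finally have "exp (- 1 / 2) ^ p = inverse (exp (real p / 2))" by (simp only: exp_minus)
        then show ?thesis by (simp only: divide_inverse inverse_mult_distrib mult_1_left mult.commute)
      qed
      finally show ?thesis using y0 by linarith
    qed
  qed
  have S: "summable (\<lambda>p. sqrt (exp 1) * y p + 1 / sqrt (quot M 0) * exp (- 1 / 2) ^ p)"
    by (intro summable_add summable_mult y summable_geometric) simp
  have "summable (\<lambda>p. 1 / sqrt (quot M (Suc p)))"
  proof (rule summable_comparison_test'[OF S])
    fix p
    have "norm (1 / sqrt (quot M (Suc p))) = 1 / sqrt (quot M (Suc p))" using m[of "Suc p"] by simp
    then show "norm (1 / sqrt (quot M (Suc p))) \<le> sqrt (exp 1) * y p + 1 / sqrt (quot M 0) * exp (- 1 / 2) ^ p"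
      using le[of p] by (simp only:)
  qed
  then show ?thesis by (subst (asm) summable_Suc_iff)
qed

section \<open>The function with vanishing moments\<close>

lemma power_add_le: "(a + b) ^ p \<le> 2 ^ p * (a ^ p + b ^ p)" if "a \<ge> 0" "b \<ge> 0" for a b :: real
proof -
  have "(a + b) ^ p \<le> (2 * max a b) ^ p" by (rule power_mono) (use that in auto)
  also have "\<dots> = 2 ^ p * max a b ^ p" by (rule power_mult_distrib)
  also have "\<dots> \<le> 2 ^ p * (a ^ p + b ^ p)"
    by (intro mult_left_mono) (use that in \<open>auto simp: max_def\<close>)
  finally show ?thesis .
qed

text \<open>\<open>M p\<close> is a product of quotients that are at least \<open>quot M 0\<close>.
  This absorbs a power \<open>L ^ p\<close>, caused by the bounded support of the test function,
  into a bound of the form \<open>h ^ p * M p\<close>.\<close>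

lemma weight_seq_power_le:
  assumes M: "weight_seq M" and M0: "M 0 = 1" and L: "L \<ge> 0"
  shows "L ^ p \<le> (L / quot M 0) ^ p * M p"
proof -
  note Mp = weight_seq_pos[OF M]
  have m: "quot M 0 > 0" using Mp by (simp add: quot_def)
  have "quot M 0 ^ p = (\<Prod>j<p. quot M 0)" by simp
  also have "\<dots> \<le> (\<Prod>j<p. quot M j)"
    by (intro prod_mono) (use m incseqD[OF weight_seq_incseq_quot[OF M]] in \<open>auto intro: less_imp_le\<close>)
  also have "\<dots> = M p" using prod_quot[where N=M, OF Mp] M0 by simp
  finally have "(L / quot M 0) ^ p * quot M 0 ^ p \<le> (L / quot M 0) ^ p * M p"
    by (intro mult_left_mono) (use L m in auto)
  then show ?thesis using m by (simp add: power_mult_distrib[symmetric])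
qed

text \<open>In \<open>\<integral> K t \<psi> (x - t^2) dt\<close> all derivatives fall on \<psi>,
  whereas a power \<open>x ^ p\<close> is governed by the moment of order \<open>2 * p\<close> of
  \<open>norm K\<close>; hence \<open>K\<close> is built from square roots of the quotients of
  \<open>M\<close>. The moments expand into even moments of \<open>K\<close>, which vanish. The
  Laplace transform is a Gaussian integral of \<open>K\<close> times the Laplace transform of
  \<psi>, so it cannot vanish at all large integers.\<close>

lemma nontrivial_function_with_zero_moments:
  assumes M: "weight_seq M" and M0: "M 0 = 1" and sumM: "summable (\<lambda>p. 1 / sqrt (quot M p))"
    and A: "\<And>p. A p > 0" and nq: "nq A"
  shows "\<exists>\<Phi>\<in>SMA M A. (\<forall>p. moments \<Phi> p = 0) \<and> (\<exists>x. \<Phi> x \<noteq> 0)"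
proof -
  note Mp = weight_seq_pos[OF M]
  have Ap: "Ahat A p > 0" for p using A by (simp add: Ahat_def)
  have qA: "quot (Ahat A) p = (real p + 1) * quot A p" for p
  proof -
    have "quot (Ahat A) p = (fact p * ((real p + 1) * A (Suc p))) / (fact p * A p)"
      by (simp add: quot_def Ahat_def mult_ac add.commute)
    then show ?thesis by (simp add: quot_def)
  qed
  \<comment> \<open>Entry 0 is the value 1 demanded by \<open>kernel\<close>; the shift of the other
    entries turns the constants \<open>C\<close> of the two kernels into products of
    quotients.\<close>
  define cM where "cM j = (case j of 0 \<Rightarrow> 1 | Suc j \<Rightarrow> 1 / sqrt (quot M j))" for j
  define cA where "cA j = (case j of 0 \<Rightarrow> 1 | Suc j \<Rightarrow> 1 / quot (Ahat A) j)" for j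
  interpret k: kernel cM
  proof
    show "cM j > 0" for j using Mp by (auto simp: cM_def quot_def split: nat.splits)
    show "summable cM" by (subst summable_Suc_iff[symmetric]) (use sumM in \<open>simp add: cM_def\<close>)
  qed (simp add: cM_def)
  interpret s: kernel cA
  proof
    show "cA j > 0" for j using Ap by (auto simp: cA_def quot_def split: nat.splits)
    show "summable cA" by (subst summable_Suc_iff[symmetric]) (use nq in \<open>simp add: cA_def nq_def qA\<close>)
  qed (simp add: cA_def)
  \<comment> \<open>Squaring undoes the square roots of the quotients, so the even moments of
    \<open>norm K\<close> are bounded by multiples of \<open>4 ^ p * M p\<close>.\<close>
  have kC: "(k.C p)^2 = 4 ^ p * M p" for p
  proof -
    have "(k.C p)^2 = (\<Prod>j<p. 4 * quot M j)"
      unfolding k.C_def prod_power_distrib cM_def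
      by (rule prod.cong[OF refl]) (use Mp in \<open>simp add: power_divide power_mult_distrib quot_def less_imp_le\<close>)
    also have "\<dots> = 4 ^ p * M p" unfolding prod.distrib prod_quot[where N=M, OF Mp] by (simp add: M0)
    finally show ?thesis .
  qed
  have sC: "s.C q = 2 ^ q * Ahat A q / Ahat A 0" for q
  proof -
    have "s.C q = (\<Prod>j<q. 2 * quot (Ahat A) j)"
      unfolding s.C_def cA_def by simp
    also have "\<dots> = 2 ^ q * Ahat A q / Ahat A 0" unfolding prod.distrib prod_quot[where N="Ahat A", OF Ap] by simp
    finally show ?thesis .
  qed
  define L where "L = 2 * s.\<alpha>"
  have L: "L \<ge> 0" using s.alpha_pos by (simp add: L_def)
  have supp: "s.psi q u = 0" if "u \<notin> {0..L}" for q u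
    using that s.psi_nonpos[of u q] s.psi_ge[of u q] by (auto simp: L_def)
  let ?k = "\<lambda>t. k.K (of_real t)"
  define D where "D q x = (\<integral>t. ?k t * s.psi q (x - t^2) \<partial>lborel)" for q x
  note kc = k.continuous_K_real
  note ki = k.integral_even_power_K_le
  have kin: "integrable lborel (\<lambda>t. norm (?k t))" using ki(1)[of 0] by simp
  have Dm: "(\<lambda>t. ?k t * s.psi q (x - t^2)) \<in> borel_measurable lborel" for q x
  proof -
    have "continuous_on UNIV (\<lambda>t. ?k t * s.psi q (x - t^2))"
      by (intro continuous_intros kc continuous_on_compose2[OF s.continuous_psi[of UNIV]]) auto
    then show ?thesis using borel_measurable_continuous_onI by simp
  qed
  have Db: "norm (?k t * s.psi q (x - t^2)) \<le> norm (?k t) * (s.C q * s.I5)" for t q x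
    unfolding norm_mult by (intro mult_left_mono s.norm_psi_le) simp
  have Di: "integrable lborel (\<lambda>t. ?k t * s.psi q (x - t^2))" for q x
    by (rule Bochner_Integration.integrable_bound[OF integrable_mult_left[OF kin, of "s.C q * s.I5"] Dm])
      (use Db[of _ q x] s.C_pos[of q] s.I5_nonneg in \<open>auto intro!: AE_I2\<close>)
  have ds: "deriv_seq D"
    unfolding deriv_seq_def D_def
  proof (intro allI)
    fix q x
    show "((\<lambda>x. \<integral>t. ?k t * s.psi q (x - t^2) \<partial>lborel) has_vector_derivative (\<integral>t. ?k t * s.psi (Suc q) (x - t^2) \<partial>lborel)) (at x)"
    proof (rule has_vector_derivative_lebesgue_integral[OF Di _ _ Db Dm])
      show "integrable lborel (\<lambda>t. norm (?k t) * (s.C (Suc q) * s.I5))" by (intro integrable_mult_left kin)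
      fix t y
      have "((\<lambda>y. s.psi q (y - t^2)) has_vector_derivative (1 *\<^sub>R s.psi (Suc q) (y - t^2))) (at y)"
        by (rule vector_diff_chain_at[unfolded o_def, OF _ s.psi_has_derivative])
          (auto intro!: derivative_eq_intros)
      then show "((\<lambda>y. ?k t * s.psi q (y - t^2)) has_vector_derivative ?k t * s.psi (Suc q) (y - t^2)) (at y)"
        using has_vector_derivative_mult_right[of _ _ _ "?k t"] by simp
    qed
  qed
  have D0: "D q x = 0" if "x \<le> 0" for q x
  proof -
    have "s.psi q (x - t^2) = 0" for t using that by (intro s.psi_nonpos) (simp add: order_trans[OF that])
    then show ?thesis by (simp add: D_def)
  qed
  \<comment> \<open>On the support of the integrand \<open>x = u + t^2\<close> with \<open>u\<close>
    between 0 and \<open>L\<close>, so \<open>W p t\<close> dominates \<open>x ^ p\<close>.\<close>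
  define W where "W p t = 2 ^ p * (L ^ p + t ^ (2 * p))" for p t
  have Wi: "integrable lborel (\<lambda>t. norm (?k t) * W p t)" for p
  proof -
    have "(\<lambda>t. norm (?k t) * W p t) = (\<lambda>t. 2 ^ p * (L ^ p * (t ^ (2 * 0) * norm (?k t)) + t ^ (2 * p) * norm (?k t)))"
      by (simp add: W_def algebra_simps)
    then show ?thesis using ki(1)[of 0] ki(1)[of p] by (simp del: mult_0_right power_0)
  qed
  have Wle: "norm (u + t^2) ^ p \<le> W p t" if "u \<in> {0..L}" for u t p
  proof -
    have "norm (u + t^2) ^ p \<le> (L + t^2) ^ p" by (rule power_mono) (use that in auto)
    also have "\<dots> \<le> 2 ^ p * (L ^ p + (t^2) ^ p)" by (rule power_add_le) (use L in auto)
    finally show ?thesis by (simp add: W_def power_mult)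
  qed
  \<comment> \<open>The 4 stems from \<open>kC\<close>, the quotient \<open>L / quot M 0\<close>
    from absorbing \<open>L ^ p\<close>, the factor 2 from the \<open>2 ^ p\<close> in
    \<open>W\<close>. As \<open>r \<ge> 2\<close>, powers of \<open>r\<close> also cover the
    \<open>2 ^ q\<close> in \<open>sC\<close>.\<close>
  define r where "r = 2 * (4 + L / quot M 0)"
  have m0: "quot M 0 > 0" using Mp by (simp add: quot_def)
  have Lm: "L / quot M 0 \<ge> 0" using L m0 by simp
  have r8: "r \<ge> 8" unfolding r_def using Lm by simp
  have WI: "(\<integral>t. norm (?k t) * W p t \<partial>lborel) \<le> 2 * k.I5 * r ^ p * M p" for p
  proof -
    have "(\<integral>t. norm (?k t) * W p t \<partial>lborel) = 2 ^ p * (L ^ p * (\<integral>t. t ^ (2 * 0) * norm (?k t) \<partial>lborel) + (\<integral>t. t ^ (2 * p) * norm (?k t) \<partial>lborel))"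
    proof -
      have e: "norm (?k t) * W p t = 2 ^ p * (L ^ p * (t ^ (2 * 0) * norm (?k t)) + t ^ (2 * p) * norm (?k t))" for t
        by (simp add: W_def algebra_simps)
      show ?thesis unfolding e integral_mult_right_zero
        by (subst Bochner_Integration.integral_add) (use ki(1)[of 0] ki(1)[of p] in \<open>auto simp del: mult_0_right power_0\<close>)
    qed
    also have "\<dots> \<le> 2 ^ p * (L ^ p * ((k.C 0)^2 * k.I5) + (k.C p)^2 * k.I5)"
      by (intro mult_left_mono add_mono ki(2)) (use L in auto)
    also have "\<dots> = 2 ^ p * k.I5 * (L ^ p + 4 ^ p * M p)"
      unfolding kC[of p] by (simp add: k.C_def algebra_simps)
    also have "\<dots> \<le> 2 ^ p * k.I5 * ((4 + L / quot M 0) ^ p * M p + (4 + L / quot M 0) ^ p * M p)"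
    proof (intro mult_left_mono add_mono)
      have "L ^ p \<le> (L / quot M 0) ^ p * M p" by (rule weight_seq_power_le[OF M M0 L])
      also have "\<dots> \<le> (4 + L / quot M 0) ^ p * M p"
        by (intro mult_right_mono power_mono) (use Lm Mp[of p] in auto)
      finally show "L ^ p \<le> (4 + L / quot M 0) ^ p * M p" .
      show "4 ^ p * M p \<le> (4 + L / quot M 0) ^ p * M p"
        by (intro mult_right_mono power_mono) (use Lm Mp[of p] in auto)
    qed (use k.I5_nonneg in auto)
    also have "\<dots> = 2 * k.I5 * r ^ p * M p" unfolding r_def power_mult_distrib by simp
    finally show ?thesis .
  qed
  have bound: "\<bar>x\<bar> ^ p * norm (D q x) \<le> (2 * k.I5 * s.I5 / Ahat A 0) * r ^ (p + q) * M p * Ahat A q" for p q x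
  proof -
    have "\<bar>x\<bar> ^ p * norm (D q x) \<le> \<bar>x\<bar> ^ p * (\<integral>t. norm (?k t * s.psi q (x - t^2)) \<partial>lborel)"
      unfolding D_def by (intro mult_left_mono integral_norm_bound) simp
    also have "\<dots> = (\<integral>t. \<bar>x\<bar> ^ p * norm (?k t * s.psi q (x - t^2)) \<partial>lborel)"
      by (rule integral_mult_right_zero[symmetric])
    also have "\<dots> \<le> (\<integral>t. (norm (?k t) * W p t) * (s.C q * s.I5) \<partial>lborel)"
    proof (intro integral_mono integrable_mult_right integrable_norm Di integrable_mult_left Wi)
      fix t
      show "\<bar>x\<bar> ^ p * norm (?k t * s.psi q (x - t^2)) \<le> (norm (?k t) * W p t) * (s.C q * s.I5)"
      proof (cases "x - t^2 \<in> {0..L}")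
        case True
        have "\<bar>x\<bar> ^ p \<le> W p t" using Wle[OF True, of t p] by simp
        then have "\<bar>x\<bar> ^ p * (norm (?k t) * norm (s.psi q (x - t^2))) \<le> W p t * (norm (?k t) * (s.C q * s.I5))"
          by (intro mult_mono mult_left_mono s.norm_psi_le) (auto intro: order_trans[OF zero_le_power[OF abs_ge_zero]])
        then show ?thesis by (simp add: norm_mult mult_ac)
      next
        case False
        have "W p t \<ge> 0" unfolding W_def using L by (simp add: power_mult)
        then show ?thesis unfolding supp[OF False] using s.C_pos[of q] s.I5_nonneg by simp
      qed
    qed
    also have "\<dots> = (\<integral>t. norm (?k t) * W p t \<partial>lborel) * (s.C q * s.I5)"
      by (rule integral_mult_left_zero)
    also have "\<dots> \<le> (2 * k.I5 * r ^ p * M p) * (r ^ q * Ahat A q / Ahat A 0 * s.I5)"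
    proof (intro mult_mono WI mult_right_mono s.I5_nonneg)
      show "s.C q \<le> r ^ q * Ahat A q / Ahat A 0" unfolding sC
        by (intro divide_right_mono mult_right_mono power_mono) (use r8 Ap[of 0] Ap[of q] in auto)
    qed (use k.I5_nonneg r8 Mp[of p] s.C_pos[of q] s.I5_nonneg Ap[of 0] Ap[of q] in auto)
    also have "\<dots> = (2 * k.I5 * s.I5 / Ahat A 0) * r ^ (p + q) * M p * Ahat A q"
      by (simp add: power_add)
    finally show ?thesis .
  qed
  have SMA: "D 0 \<in> SMA M A"
    unfolding SMA_def 
  proof (intro CollectI exI[of _ D] conjI allI impI)
    show "\<exists>h>0. \<exists>B. \<forall>p q x. \<bar>x\<bar> ^ p * norm (D q x) \<le> B * h ^ (p + q) * M p * Ahat A q"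
    proof (rule exI[of _ r], intro conjI)
      show "\<exists>B. \<forall>p q x. \<bar>x\<bar> ^ p * norm (D q x) \<le> B * r ^ (p + q) * M p * Ahat A q"
        by (rule exI, intro allI, rule bound)
    qed (use r8 in simp)
  qed (use ds D0 in auto)
  \<comment> \<open>The test function \<open>w\<close> will be a monomial for the moments and an
    exponential for the Laplace transform.\<close>
  have F: "integrable lborel (\<lambda>x. w x * D 0 x)"
    "(\<integral>x. w x * D 0 x \<partial>lborel) = (\<integral>t. ?k t * (\<integral>u. w (u + t^2) * s.psi 0 u \<partial>lborel) \<partial>lborel)"
    if "continuous_on UNIV w" "\<And>u t. u \<in> {0..L} \<Longrightarrow> norm (w (u + t^2)) \<le> V t"
      "integrable lborel (\<lambda>t. norm (?k t) * V t)" for w V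
  proof -
    note cF = convolution_Fubini[where k="?k" and \<psi>="s.psi 0" and w=w and W=V and L=L and B="s.C 0 * s.I5"]
    show "integrable lborel (\<lambda>x. w x * D 0 x)"
      unfolding D_def by (rule cF(1)) (fact kc s.continuous_psi that L s.norm_psi_le supp)+
    show "(\<integral>x. w x * D 0 x \<partial>lborel) = (\<integral>t. ?k t * (\<integral>u. w (u + t^2) * s.psi 0 u \<partial>lborel) \<partial>lborel)"
      unfolding D_def by (rule cF(2)) (fact kc s.continuous_psi that L s.norm_psi_le supp)+
  qed
  have psii: "integrable lborel (\<lambda>u. w u * s.psi 0 u)" if "continuous_on UNIV w" for w
  proof -
    have "integrable lborel (\<lambda>u. indicator {0..L} u *\<^sub>R (w u * s.psi 0 u))"
      by (rule borel_integrable_compact) (auto intro!: continuous_intros s.continuous_psi continuous_on_subset[OF that])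
    moreover have "indicator {0..L} u *\<^sub>R (w u * s.psi 0 u) = w u * s.psi 0 u" for u
      using supp[of u 0] by (auto simp: indicator_def)
    ultimately show ?thesis by simp
  qed
  have mom: "moments (D 0) p = 0" for p
  proof -
    let ?w = "\<lambda>x. complex_of_real x ^ p"
    have wc: "continuous_on UNIV ?w" by (intro continuous_intros)
    have wW: "norm (?w (u + t^2)) \<le> W p t" if "u \<in> {0..L}" for u t
      using Wle[OF that, of t p] by (simp only: norm_power norm_of_real real_norm_def)
    note Fp = F[of ?w, OF wc wW Wi]
    have e: "x ^ p *\<^sub>R D 0 x = ?w x * D 0 x" for x by (simp add: scaleR_conv_of_real)
    have "moments (D 0) p = (\<integral>x. ?w x * D 0 x \<partial>lpos)"
      using moments_eq_lpos[of p "D 0"] Fp(1) lpos_eq_lborel(2)[of "\<lambda>x. ?w x * D 0 x"] D0 unfolding e by simp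
    also have "\<dots> = (\<integral>t. ?k t * (\<integral>u. ?w (u + t^2) * s.psi 0 u \<partial>lborel) \<partial>lborel)"
      by (subst lpos_eq_lborel(1)) (use D0 Fp(2) in auto)
    \<comment> \<open>Binomial expansion of \<open>(u + t^2) ^ p\<close>. The exponential of 0
      equals 1 and brings the integrand into the form of \<open>integral_power_exp_K\<close> at
      \<open>x = 0\<close>.\<close>
    also have "\<dots> = (\<integral>t. (\<Sum>j\<le>p. (of_nat (p choose j) * (\<integral>u. of_real u ^ j * s.psi 0 u \<partial>lborel)) *
        (of_real t ^ (2 * (p - j)) * exp (\<i> * of_real 0 * of_real t) * ?k t)) \<partial>lborel)"
    proof (rule Bochner_Integration.integral_cong[OF refl])
      fix t
      have "?w (u + t^2) * s.psi 0 u = (\<Sum>j\<le>p. (of_nat (p choose j) * of_real t ^ (2 * (p - j))) * (of_real u ^ j * s.psi 0 u))" for u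
      proof -
        have "?w (u + t^2) = (\<Sum>j\<le>p. of_nat (p choose j) * of_real u ^ j * of_real t ^ (2 * (p - j)))"
          by (simp only: of_real_add of_real_power binomial_ring power_mult[of "complex_of_real t" 2])
        then have "?w (u + t^2) * s.psi 0 u = (\<Sum>j\<le>p. of_nat (p choose j) * of_real u ^ j * of_real t ^ (2 * (p - j)) * s.psi 0 u)"
          by (simp only: sum_distrib_right)
        also have "\<dots> = (\<Sum>j\<le>p. (of_nat (p choose j) * of_real t ^ (2 * (p - j))) * (of_real u ^ j * s.psi 0 u))"
          by (rule sum.cong[OF refl]) (simp only: mult_ac)
        finally show ?thesis .
      qed
      then have "(\<integral>u. ?w (u + t^2) * s.psi 0 u \<partial>lborel) =
          (\<integral>u. (\<Sum>j\<le>p. (of_nat (p choose j) * of_real t ^ (2 * (p - j))) * (of_real u ^ j * s.psi 0 u)) \<partial>lborel)" by simp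
      also have "\<dots> = (\<Sum>j\<le>p. (of_nat (p choose j) * of_real t ^ (2 * (p - j))) * (\<integral>u. of_real u ^ j * s.psi 0 u \<partial>lborel))"
        by (subst Bochner_Integration.integral_sum) (auto intro!: integrable_mult_right psii continuous_intros)
      finally show "?k t * (\<integral>u. ?w (u + t^2) * s.psi 0 u \<partial>lborel) =
        (\<Sum>j\<le>p. (of_nat (p choose j) * (\<integral>u. of_real u ^ j * s.psi 0 u \<partial>lborel)) *
          (of_real t ^ (2 * (p - j)) * exp (\<i> * of_real 0 * of_real t) * ?k t))"
        by (simp add: sum_distrib_left mult_ac)
    qed
    also have "\<dots> = 0"
      by (subst Bochner_Integration.integral_sum)
        (intro integrable_mult_right k.integral_power_exp_K(1) order_refl,
          simp only: integral_mult_right_zero k.integral_power_exp_K(2)[OF order_refl] mult_zero_right sum.neutral_const)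
    finally show ?thesis .
  qed
  have "\<exists>x. D 0 x \<noteq> 0"
  proof (rule ccontr)
    assume "\<nexists>x. D 0 x \<noteq> 0"
    then have z: "D 0 x = 0" for x by blast
    obtain n0 where n0: "\<And>n. n \<ge> n0 \<Longrightarrow> (\<integral>t. exp (- (real n * t^2)) *\<^sub>R ?k t \<partial>lborel) \<noteq> 0"
      using k.integral_gaussian_K_nonzero by blast
    \<comment> \<open>The Laplace transform of the vanishing function \<open>D 0\<close> is the
      Gaussian integral of \<open>K\<close> times that of \<open>s.psi 0\<close>; the first factor
      is nonzero from \<open>n0\<close> on.\<close>
    have Lz: "(\<integral>u. of_real (exp (- (real n * u))) * s.psi 0 u \<partial>lborel) = 0" if n: "n \<ge> n0" for n
    proof -
      let ?w = "\<lambda>x. complex_of_real (exp (- (real n * x)))"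
      have wc: "continuous_on UNIV ?w" by (intro continuous_intros)
      have wW: "norm (?w (u + t^2)) \<le> 1" if "u \<in> {0..L}" for u t using that by simp
      have "integrable lborel (\<lambda>t. norm (?k t) * 1)" using kin by simp
      note Fp = F(2)[of ?w, OF wc wW this]
      have "0 = (\<integral>x. ?w x * D 0 x \<partial>lborel)" by (simp add: z)
      also have "\<dots> = (\<integral>t. ?k t * (\<integral>u. ?w (u + t^2) * s.psi 0 u \<partial>lborel) \<partial>lborel)" by (rule Fp)
      also have "\<dots> = (\<integral>t. (exp (- (real n * t^2)) *\<^sub>R ?k t) * (\<integral>u. ?w u * s.psi 0 u \<partial>lborel) \<partial>lborel)"
      proof (rule Bochner_Integration.integral_cong[OF refl])
        fix t
        have "?w (u + t^2) * s.psi 0 u = ?w (t^2) * (?w u * s.psi 0 u)" for u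
        proof -
          have "exp (- (real n * (u + t^2))) = exp (- (real n * t^2)) * exp (- (real n * u))"
            unfolding exp_add[symmetric] by (simp add: algebra_simps)
          then show ?thesis by (simp only: of_real_mult mult.assoc)
        qed
        then have "(\<integral>u. ?w (u + t^2) * s.psi 0 u \<partial>lborel) = ?w (t^2) * (\<integral>u. ?w u * s.psi 0 u \<partial>lborel)"
          by (simp only: integral_mult_right_zero)
        then show "?k t * (\<integral>u. ?w (u + t^2) * s.psi 0 u \<partial>lborel) = (exp (- (real n * t^2)) *\<^sub>R ?k t) * (\<integral>u. ?w u * s.psi 0 u \<partial>lborel)"
          by (simp only: scaleR_conv_of_real mult_ac)
      qed
      also have "\<dots> = (\<integral>t. exp (- (real n * t^2)) *\<^sub>R ?k t \<partial>lborel) * (\<integral>u. ?w u * s.psi 0 u \<partial>lborel)"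
        by (rule integral_mult_left_zero)
      finally show ?thesis using n0[OF n] by simp
    qed
    \<comment> \<open>Only the nodes from \<open>n0\<close> on are available. So uniqueness is
      applied to \<open>exp (- n0 u) * s.psi 0 u\<close>, whose transform at \<open>n\<close> is
      that of \<open>s.psi 0\<close> at \<open>n + n0\<close>, and evaluated at the centre of the
      support, where \<open>s.psi 0\<close> does not vanish.\<close>
    have "of_real (exp (- (real n0 * s.\<alpha>))) * s.psi 0 s.\<alpha> = 0"
    proof (rule laplace_unique[OF _ _ _ s.alpha_pos])
      show "continuous_on {0<..} (\<lambda>u. of_real (exp (- (real n0 * u))) * s.psi 0 u)"
        by (intro continuous_intros s.continuous_psi)
      have "integrable lborel (\<lambda>u. of_real (exp (- (real n0 * u))) * s.psi 0 u)"
        by (intro psii continuous_intros)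
      then show "integrable lpos (\<lambda>u. of_real (exp (- (real n0 * u))) * s.psi 0 u)"
        by (subst lpos_eq_lborel(2)) (simp_all add: s.psi_nonpos)
      fix n :: nat
      have e: "exp (- (real n * u)) *\<^sub>R (of_real (exp (- (real n0 * u))) * s.psi 0 u) = of_real (exp (- (real (n + n0) * u))) * s.psi 0 u" for u
      proof -
        have "exp (- (real (n + n0) * u)) = exp (- (real n * u)) * exp (- (real n0 * u))"
          unfolding exp_add[symmetric] by (simp add: algebra_simps)
        then show ?thesis by (simp only: scaleR_conv_of_real of_real_mult mult.assoc)
      qed
      show "(\<integral>u. exp (- (real n * u)) *\<^sub>R (of_real (exp (- (real n0 * u))) * s.psi 0 u) \<partial>lpos) = 0"
        unfolding e using Lz[of "n + n0"] by (subst lpos_eq_lborel(1)) (simp_all add: s.psi_nonpos)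
    qed
    then show False using s.psi_alpha by simp
  qed
  then show ?thesis using SMA mom by blast
qed

section \<open>The equivalences\<close>

lemma SMA_subset_SM: "SMA M A \<subseteq> SM M"
proof
  fix \<phi> assume "\<phi> \<in> SMA M A"
  then obtain D h B where D: "deriv_seq D" "D 0 = \<phi>" "\<forall>x<0. \<phi> x = 0" and h: "h > 0"
    and b: "\<And>p q x. \<bar>x\<bar>^p * norm (D q x) \<le> B * h^(p+q) * M p * Ahat A q"
    unfolding SMA_def by blast
  have "\<bar>x\<bar>^p * norm (D q x) \<le> (B * h^q * Ahat A q) * h^p * M p" for p q x
    using b[of x p q] by (simp add: power_add mult_ac)
  then show "\<phi> \<in> SM M" unfolding SM_def using D h by blast
qed

lemma SM_subset_CM: "SM M \<subseteq> CM M"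
proof
  fix \<phi> assume "\<phi> \<in> SM M"
  then obtain D h where D: "deriv_seq D" "D 0 = \<phi>" and h: "h > 0"
    and b: "\<And>q. \<exists>B. \<forall>p x. \<bar>x\<bar>^p * norm (D q x) \<le> B * h^p * M p"
    unfolding SM_def by blast
  have "continuous_on {0<..} (D 0)"
    using D(1) unfolding deriv_seq_def
    by (meson has_vector_derivative_continuous continuous_at_imp_continuous_on)
  moreover obtain B where "\<And>p x. \<bar>x\<bar>^p * norm (D 0 x) \<le> B * h^p * M p" using b[of 0] by blast
  then have "x^p * norm (D 0 x) \<le> B * h^p * M p" if "x > 0" for p x
    using that by (metis abs_of_pos)
  ultimately show "\<phi> \<in> CM M" unfolding CM_def using D(2) h by blast
qed

text \<open>The support condition in \<open>SM\<close> speaks of negative arguments, and continuity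
  settles the point 0. This bridges equality on the positive axis, as in (iii), and equality
  everywhere, as \<open>inj_on\<close> demands.\<close>

lemma SM_eq_0_nonpos:
  assumes "\<phi> \<in> SM M" "x \<le> 0" shows "\<phi> x = 0"
proof -
  obtain D where D: "deriv_seq D" "D 0 = \<phi>" and z: "\<forall>x<0. \<phi> x = 0"
    using assms(1) unfolding SM_def by blast
  have "isCont \<phi> 0"
    using D unfolding deriv_seq_def by (metis has_vector_derivative_continuous)
  then have "(\<phi> \<longlongrightarrow> \<phi> 0) (at_left 0)"
    by (simp add: isCont_def filterlim_at_split)
  moreover have "(\<phi> \<longlongrightarrow> 0) (at_left 0)"
    by (rule tendsto_eventually) (use z in \<open>auto simp: eventually_at_filter\<close>)
  ultimately have "\<phi> 0 = 0" by (intro tendsto_unique[of "at_left 0"]) auto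
  then show ?thesis using z assms(2) by (cases "x = 0") auto
qed

lemma zero_in_SMA:
  assumes "\<And>p. M p > 0" "\<And>q. Ahat A q > 0"
  shows "(\<lambda>_. 0) \<in> SMA M A"
  unfolding SMA_def
proof (intro CollectI exI[of _ "\<lambda>_ _. 0"] conjI)
  show "deriv_seq (\<lambda>_ _. 0)" by (simp add: deriv_seq_def)
  show "\<exists>h>0. \<exists>B. \<forall>p q x. \<bar>x\<bar> ^ p * norm (0::complex) \<le> B * h ^ (p + q) * M p * Ahat A q"
    by (rule exI[of _ 1], rule conjI, simp, rule exI[of _ 0], simp)
qed auto

theorem theorem4p5:
  fixes M A :: "nat \<Rightarrow> real"
  assumes "weight_seq M" and "M 0 = 1"
    and "weight_seq (Mtilde M)" and "fact_incl (Mtilde M)"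
    and "\<forall>p. A p > 0" and "nq A" and "weight_seq (Ahat A)"
  defines "cond_i \<equiv> \<not> summable (\<lambda>p. 1 / sqrt (quot (Mtilde M) p))"
    and "cond_ii \<equiv> (\<forall>f\<in>AH (Mtilde M). \<forall>g\<in>AH (Mtilde M).
                    Borel_map f = Borel_map g \<longrightarrow> (\<forall>z\<in>upper_half. f z = g z))"
    and "cond_iii \<equiv> (\<forall>\<phi>\<in>CM M. \<forall>\<psi>\<in>CM M.
                    moments \<phi> = moments \<psi> \<longrightarrow> (\<forall>x>0. \<phi> x = \<psi> x))"
    and "cond_iv \<equiv> inj_on moments (SM M)"
    and "cond_v \<equiv> inj_on moments (SMA M A)"
  shows "(cond_i \<longleftrightarrow> cond_ii) \<and> (cond_i \<longleftrightarrow> cond_iii) \<and>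
         (cond_i \<longleftrightarrow> cond_iv) \<and> (cond_i \<longleftrightarrow> cond_v)"
proof -
  note M = assms(1) and Mt = assms(3)
  have i_ii: "cond_i \<Longrightarrow> cond_ii"
    unfolding cond_i_def cond_ii_def using Borel_map_injective[OF Mt] by blast
  have ii_iii: "cond_ii \<Longrightarrow> cond_iii"
    unfolding cond_ii_def cond_iii_def using moments_injective_if_Borel_injective[OF M] by blast
  have iii_iv: "cond_iii \<Longrightarrow> cond_iv"
    unfolding cond_iii_def cond_iv_def
  proof (rule inj_onI)
    fix \<phi> \<psi>
    assume inj: "\<forall>\<phi>\<in>CM M. \<forall>\<psi>\<in>CM M. moments \<phi> = moments \<psi> \<longrightarrow> (\<forall>x>0. \<phi> x = \<psi> x)"
      and \<phi>: "\<phi> \<in> SM M" and \<psi>: "\<psi> \<in> SM M" and eq: "moments \<phi> = moments \<psi>"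
    have "\<phi> x = \<psi> x" if "x > 0" for x using inj \<phi> \<psi> eq SM_subset_CM that by blast
    moreover have "\<phi> x = \<psi> x" if "x \<le> 0" for x using SM_eq_0_nonpos \<phi> \<psi> that by metis
    ultimately show "\<phi> = \<psi>" by (meson ext not_le)
  qed
  have iv_v: "cond_iv \<Longrightarrow> cond_v"
    unfolding cond_iv_def cond_v_def by (rule inj_on_subset[OF _ SMA_subset_SM])
  have v_i: "cond_i" if "cond_v"
    unfolding cond_i_def
  proof
    assume "summable (\<lambda>p. 1 / sqrt (quot (Mtilde M) p))"
    from summable_quot_of_Mtilde[OF M assms(2) Mt this]
    have sumM: "summable (\<lambda>p. 1 / sqrt (quot M p))" .
    have A: "A p > 0" for p using assms(5) by blast
    obtain \<Phi> x where \<Phi>: "\<Phi> \<in> SMA M A" "\<And>p. moments \<Phi> p = 0" "\<Phi> x \<noteq> 0"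
      using nontrivial_function_with_zero_moments[where A=A, OF M assms(2) sumM A assms(6)] by blast
    \<comment> \<open>Injectivity is contradicted by comparing \<Phi> with the zero function, a
      second member of the space with the same moments.\<close>
    have "moments \<Phi> = moments (\<lambda>_. 0)" using \<Phi>(2) by (auto simp: moments_def)
    moreover have "(\<lambda>_. 0) \<in> SMA M A"
      by (rule zero_in_SMA[OF weight_seq_pos[OF M] weight_seq_pos[OF assms(7)]])
    ultimately have "\<Phi> = (\<lambda>_. 0)" using \<open>cond_v\<close> \<Phi>(1) unfolding cond_v_def by (meson inj_onD)
    then show False using \<Phi>(3) by simp
  qed
  show ?thesis using i_ii ii_iii iii_iv iv_v v_i by blast
qed

end
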